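(* Let $a>0$, $b>0$, $\sigma>0$, $\frac12<\beta<1$, $r_0>0$, and let $r=\{r_t,t\ge 0\}$ be the unique strong (a.s. strictly positive) solution of $dr_t=(a-br_t)\,dt+\sigma r_t^{\beta}\,dW_t$ with initial value $r_0$, where $W=\{W_t,t\ge0\}$ is a Wiener process. Let $T>0$. Then for any $t\in[0,T]$, $$\beta=\lim_{h\to0}\frac{\log\left(\frac{[r]_{t+h}-[r]_t}{\sigma^2h}\right)}{2\log r_t}\quad\text{a.s.},$$ where $$[r]_t=\lim_{n\to\infty}\sum_{k=1}^{2^n}\left(r_{\frac{kt}{2^n}}-r_{\frac{(k-1)t}{2^n}}\right)^2.$$
   Context: The stochastic differential equation is the Chan–Karolyi–Longstaff–Sanders (CKLS) model; under the stated conditions on the parameters it has a unique strong solution, which is a.s. strictly positive. The process $[r]$ is the (continuous) quadratic variation process of $r$. The path $\{r_t,t\in[0,T]\}$ is observed continuously and $\sigma$ is assumed known, so the formula gives the value of $\beta$ from the observations.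
   Formalization: The case t = 0 with r_0 = 1 is excluded, because there log r_0 = 0 and the quotient whose limit is taken is undefined. *)

theory Defs
  imports "HOL-Probability.Probability"
begin

text \<open>
  A stochastic process is a function \<open>X :: real \<Rightarrow> 'a \<Rightarrow> real\<close> of time and outcome; only
  its values at times \<open>t \<ge> 0\<close> matter.
\<close>

definition wiener_process :: "'a measure \<Rightarrow> (real \<Rightarrow> 'a \<Rightarrow> real) \<Rightarrow> bool" where
  "wiener_process M W \<longleftrightarrow>
     (\<forall>t\<ge>0. W t \<in> borel_measurable M) \<and>
     (AE \<omega> in M. W 0 \<omega> = 0) \<and>
     (AE \<omega> in M. continuous_on {0..} (\<lambda>t. W t \<omega>)) \<and>
     (\<forall>s t. 0 \<le> s \<longrightarrow> s < t \<longrightarrow>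
        distributed M lborel (\<lambda>\<omega>. W t \<omega> - W s \<omega>) (\<lambda>x. ennreal (normal_density 0 (sqrt (t - s)) x))) \<and>
     (\<forall>(n::nat) \<tau>. 0 \<le> \<tau> 0 \<longrightarrow> (\<forall>i<n. \<tau> i < \<tau> (Suc i)) \<longrightarrow>
        prob_space.indep_vars M (\<lambda>_. borel) (\<lambda>i \<omega>. W (\<tau> (Suc i)) \<omega> - W (\<tau> i) \<omega>) {..<n})"

definition brownian_filtration :: "'a measure \<Rightarrow> (real \<Rightarrow> 'a \<Rightarrow> real) \<Rightarrow> real \<Rightarrow> 'a measure" where
  "brownian_filtration M W t =
     sigma (space M) ((\<Union>s\<in>{0..t}. {W s -` A \<inter> space M | A. A \<in> sets borel}) \<union> null_sets M)"

definition adapted_process :: "(real \<Rightarrow> 'a measure) \<Rightarrow> (real \<Rightarrow> 'a \<Rightarrow> real) \<Rightarrow> bool" where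
  "adapted_process F X \<longleftrightarrow> (\<forall>t\<ge>0. X t \<in> borel_measurable (F t))"

text \<open>
  Measurability is part of the definition: \<open>measure M\<close> is \<open>0\<close> on non-measurable sets, so
  without it non-measurable functions could converge vacuously.
\<close>
definition tendsto_in_probability ::
  "'a measure \<Rightarrow> (nat \<Rightarrow> 'a \<Rightarrow> real) \<Rightarrow> ('a \<Rightarrow> real) \<Rightarrow> bool" where
  "tendsto_in_probability M X Y \<longleftrightarrow>
     (\<forall>n. X n \<in> borel_measurable M) \<and> Y \<in> borel_measurable M \<and>
     (\<forall>\<epsilon>>0. (\<lambda>n. measure M {\<omega> \<in> space M. \<bar>X n \<omega> - Y \<omega>\<bar> > \<epsilon>}) \<longlonglongrightarrow> 0)"

text \<open>
  A simple process is a finite sum of terms \<open>\<xi> \<cdot> indicator {s<..t}\<close> with \<open>\<xi>\<close> bounded and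
  measurable at time \<open>s\<close>, given as the list of the triples \<open>(s, t, \<xi>)\<close>.  The intervals may
  overlap; this gives the same class of processes as disjoint intervals do.
\<close>
type_synonym 'a simple_process = "(real \<times> real \<times> ('a \<Rightarrow> real)) list"

definition simple_process :: "(real \<Rightarrow> 'a measure) \<Rightarrow> 'a simple_process \<Rightarrow> bool" where
  "simple_process F K \<longleftrightarrow>
     (\<forall>(s, t, \<xi>) \<in> set K. 0 \<le> s \<and> s < t \<and> \<xi> \<in> borel_measurable (F s) \<and>
        (\<exists>C. \<forall>\<omega>\<in>space (F s). \<bar>\<xi> \<omega>\<bar> \<le> C))"

definition simple_value :: "'a simple_process \<Rightarrow> real \<Rightarrow> 'a \<Rightarrow> real" where
  "simple_value K u \<omega> = (\<Sum>(s, t, \<xi>)\<leftarrow>K. \<xi> \<omega> * indicator {s<..t} u)"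

definition simple_integral ::
  "(real \<Rightarrow> 'a \<Rightarrow> real) \<Rightarrow> 'a simple_process \<Rightarrow> real \<Rightarrow> 'a \<Rightarrow> real" where
  "simple_integral W K u \<omega> = (\<Sum>(s, t, \<xi>)\<leftarrow>K. \<xi> \<omega> * (W (min t u) \<omega> - W (min s u) \<omega>))"

text \<open>
  \<open>ito_integral M F W H X\<close>: the continuous adapted process \<open>X\<close> is (a version of) the Ito
  integral process \<open>\<integral>\<^sub>0\<^sup>t H dW\<close> of the measurable adapted integrand \<open>H\<close> with
  \<open>\<integral>\<^sub>0\<^sup>t H\<^sup>2 ds < \<infinity>\<close> almost surely.  Such an \<open>X\<close> is unique up to indistinguishability.
\<close>
definition ito_integral ::
  "'a measure \<Rightarrow> (real \<Rightarrow> 'a measure) \<Rightarrow> (real \<Rightarrow> 'a \<Rightarrow> real) \<Rightarrow>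
   (real \<Rightarrow> 'a \<Rightarrow> real) \<Rightarrow> (real \<Rightarrow> 'a \<Rightarrow> real) \<Rightarrow> bool" where
  "ito_integral M F W H X \<longleftrightarrow>
     (\<lambda>(t, \<omega>). H t \<omega>) \<in> borel_measurable (restrict_space borel {0..} \<Otimes>\<^sub>M M) \<and>
     adapted_process F H \<and>
     (AE \<omega> in M. \<forall>t\<ge>0. set_integrable lborel {0..t} (\<lambda>s. (H s \<omega>)\<^sup>2)) \<and>
     adapted_process F X \<and>
     (AE \<omega> in M. continuous_on {0..} (\<lambda>t. X t \<omega>)) \<and>
     (\<exists>K. (\<forall>n. simple_process F (K n)) \<and>
        (\<forall>t\<ge>0.
           tendsto_in_probability M
             (\<lambda>n \<omega>. LINT s:{0..t}|lborel. (simple_value (K n) s \<omega> - H s \<omega>)\<^sup>2) (\<lambda>_. 0) \<and>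
           tendsto_in_probability M (\<lambda>n. simple_integral W (K n) t) (X t)))"

text \<open>
  Strong solution of \<open>dr\<^sub>t = f(r\<^sub>t) dt + g(r\<^sub>t) dW\<^sub>t\<close>, \<open>r\<^sub>0 = x\<close>, with deterministic
  initial value: \<open>r\<close> is adapted to the augmented filtration generated by \<open>W\<close>.
\<close>
definition strong_solution ::
  "'a measure \<Rightarrow> (real \<Rightarrow> 'a \<Rightarrow> real) \<Rightarrow> (real \<Rightarrow> real) \<Rightarrow> (real \<Rightarrow> real) \<Rightarrow> real \<Rightarrow>
   (real \<Rightarrow> 'a \<Rightarrow> real) \<Rightarrow> bool" where
  "strong_solution M W f g x r \<longleftrightarrow>
     adapted_process (brownian_filtration M W) r \<and>
     (AE \<omega> in M. continuous_on {0..} (\<lambda>t. r t \<omega>)) \<and>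
     (AE \<omega> in M. \<forall>t\<ge>0. set_integrable lborel {0..t} (\<lambda>s. f (r s \<omega>))) \<and>
     (\<exists>X. ito_integral M (brownian_filtration M W) W (\<lambda>t \<omega>. g (r t \<omega>)) X \<and>
        (AE \<omega> in M. \<forall>t\<ge>0. r t \<omega> = x + (LINT s:{0..t}|lborel. f (r s \<omega>)) + X t \<omega>))"

text \<open>
  The quadratic variation \<open>[r]\<close> is a continuous process, determined up to
  indistinguishability: the almost sure limit at each fixed time leaves the exceptional null
  set free to depend on the time, and continuity of the paths ties these limits together.
\<close>
definition quadratic_variation ::
  "'a measure \<Rightarrow> (real \<Rightarrow> 'a \<Rightarrow> real) \<Rightarrow> (real \<Rightarrow> 'a \<Rightarrow> real) \<Rightarrow> bool" where
  "quadratic_variation M r Q \<longleftrightarrow>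
     (\<forall>t\<ge>0. Q t \<in> borel_measurable M) \<and>
     (AE \<omega> in M. continuous_on {0..} (\<lambda>t. Q t \<omega>)) \<and>
     (\<forall>t\<ge>0. AE \<omega> in M.
        (\<lambda>n. \<Sum>k=1..2^n. (r (real k * t / 2^n) \<omega> - r ((real k - 1) * t / 2^n) \<omega>)\<^sup>2)
          \<longlonglongrightarrow> Q t \<omega>)"

end

theory Submission
  imports Defs
begin

text \<open>
  Write \<open>H t = \<sigma> r\<^sub>t powr \<beta>\<close> and \<open>X\<close> for the Ito integral of \<open>H\<close>.  The quadratic variation is
  \<open>\<integral>\<^sub>0\<^sup>t H\<^sup>2 ds\<close>, so its derivative at \<open>t\<close> is \<open>\<sigma>\<^sup>2 r\<^sub>t powr (2 \<beta>)\<close> and the formula follows by taking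
  logarithms, provided that \<open>r\<^sub>t \<noteq> 1\<close>.

  For the quadratic variation, truncate \<open>H\<close> at \<open>N\<close>: the dyadic square sums of the increments of \<open>X\<close>, minus
  \<open>\<integral>\<^sub>0\<^sup>t H\<^sup>2 ds\<close>, then have second moment at most \<open>4 N\<^sup>4 t\<^sup>2 / 2\<^sup>n\<close> by orthogonality of martingale
  differences.  This is summable in \<open>n\<close>, which gives almost sure convergence on the event that \<open>H\<close> is bounded by
  \<open>N\<close> on \<open>[0,t]\<close>.  The drift is Lipschitz along paths and contributes nothing.

  That \<open>r\<^sub>t\<close> has no atom at 1 for \<open>t > 0\<close> needs no density: given the past up to \<open>u = t - \<delta>\<close>, \<open>r\<^sub>t\<close> is
  \<open>r\<^sub>u + H u (W t - W u)\<close> up to an error \<open>o(sqrt \<delta>)\<close> in probability, and the Gaussian term hits an interval of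
  length \<open>o(sqrt \<delta>)\<close> with vanishing probability.

  Both arguments rest on the inequality \<open>P(\<bar>\<integral> G dW\<bar> > \<epsilon>, \<integral> G\<^sup>2 ds \<le> \<kappa>) \<le> \<kappa> / \<epsilon>\<^sup>2\<close>, which replaces
  localization by stopping times.
\<close>

section \<open>Brownian motion and its filtration\<close>

text \<open>\<open>ito_integral\<close> describes \<open>X\<close> only as a limit in probability of
  integrals of unspecified simple processes, \<open>H\<close> is unbounded, and no moments of
  \<open>r\<close> are at hand. Second moments are therefore computed for left-endpoint sums of
  \<open>H\<close> on grids refining each dyadic block, with a bound that does not depend on the
  refinement, and passed to \<open>X\<close> afterwards. Restricting to the event that
  \<open>H\<close> is bounded would destroy the orthogonality, since that event looks at the future
  of the path; so each value of \<open>H\<close> is cut off separately, which preserves adaptedness,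
  and the event enters only at the end.

  For the atom at 1, freezing \<open>H\<close> at \<open>u\<close> costs o(sqrt \<delta>) and the
  drift O(\<delta>), both below the spread sqrt \<delta> of the Gaussian increment. Position
  \<open>r u\<close> and slope \<open>H u\<close> are random but known at time \<open>u\<close>, so
  independence of the increment from the past gives the same interval estimate as for constants.

  The difference quotient at \<open>t\<close> involves uncountably many \<open>h\<close>. The almost
  sure limits at fixed times must therefore be tied together, on a single null set, before anything
  is differentiated.\<close>

lemma sorted_partition:
  fixes u v :: "'a::linorder"
  assumes "finite P" "P \<subseteq> {u..v}" "u \<le> v"
  shows "\<exists>(n::nat) \<tau>. \<tau> 0 = u \<and> \<tau> n = v \<and> (\<forall>i j. i < j \<longrightarrow> j \<le> n \<longrightarrow> \<tau> i < \<tau> j) \<and> P \<subseteq> \<tau> ` {..n}"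
proof -
  define Q where "Q = insert u (insert v P)"
  define L where "L = sorted_list_of_set Q"
  have set_L: "set L = Q" unfolding L_def Q_def using assms(1) by (intro set_sorted_list_of_set) auto
  have Q: "Q \<subseteq> {u..v}" "u \<in> Q" "v \<in> Q" using assms by (auto simp: Q_def)
  define n where "n = length L - 1"
  have len: "length L = Suc n"
    using set_L Q unfolding n_def by (cases L) auto
  have strict: "L ! i < L ! j" if "i < j" "j \<le> n" for i j
    using sorted_wrt_nth_less[OF strict_sorted_list_of_set, of i j Q] that len
    unfolding L_def by simp
  have ex: "\<exists>i\<le>n. L ! i = x" if "x \<in> Q" for x
    using that unfolding set_L[symmetric] in_set_conv_nth len less_Suc_eq_le by blast
  have in_Q: "L ! i \<in> Q" if "i \<le> n" for i
    using that set_L len nth_mem[of i L] by simp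
  show ?thesis
  proof (intro exI conjI)
    obtain i where i: "i \<le> n" "L ! i = u" using ex Q by blast
    have "u \<le> L ! 0" using in_Q[of 0] Q by auto
    with i show "L ! 0 = u" using strict[of 0 i] by (cases "i = 0") auto
    obtain j where j: "j \<le> n" "L ! j = v" using ex Q by blast
    have "L ! n \<le> v" using in_Q[of n] Q by auto
    with j show "L ! n = v" using strict[of j n] by (cases "j = n") auto
    show "P \<subseteq> (\<lambda>i. L ! i) ` {..n}" using ex by (force simp: Q_def image_iff)
  qed (use strict in blast)
qed

locale brownian = prob_space M for M :: "'a measure" +
  fixes W :: "real \<Rightarrow> 'a \<Rightarrow> real"
  assumes wiener: "wiener_process M W"
begin

abbreviation "F \<equiv> brownian_filtration M W"

lemma W_measurable [measurable]: "0 \<le> t \<Longrightarrow> W t \<in> borel_measurable M"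
  using wiener by (simp add: wiener_process_def)

lemma filtration_generators_subset:
  "(\<Union>s\<in>{0..t}. {W s -` A \<inter> space M | A. A \<in> sets borel}) \<union> null_sets M \<subseteq> events"
  by (auto intro!: measurable_sets[OF W_measurable])

lemma space_filtration [simp]: "space (F t) = space M"
  unfolding brownian_filtration_def by (rule space_measure_of_conv)

lemma sets_filtration:
  "sets (F t) = sigma_sets (space M)
     ((\<Union>s\<in>{0..t}. {W s -` A \<inter> space M | A. A \<in> sets borel}) \<union> null_sets M)"
  unfolding brownian_filtration_def
  using filtration_generators_subset[of t] sets.space_closed[of M] by (intro sets_measure_of) blast

lemma filtration_subset_events: "sets (F t) \<subseteq> events"
  unfolding sets_filtration by (rule sets.sigma_sets_subset[OF filtration_generators_subset])

lemma filtration_mono: "s \<le> t \<Longrightarrow> sets (F s) \<subseteq> sets (F t)"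
  unfolding sets_filtration by (intro sigma_sets_mono') force

lemma measurable_filtration_mono:
  "f \<in> borel_measurable (F s) \<Longrightarrow> s \<le> t \<Longrightarrow> f \<in> borel_measurable (F t)"
  using filtration_mono[of s t] by (auto simp: measurable_def)

lemma measurable_filtration: "f \<in> borel_measurable (F s) \<Longrightarrow> f \<in> borel_measurable M"
  using filtration_subset_events[of s] by (auto simp: measurable_def)

lemma W_measurable_filtration:
  assumes "0 \<le> s" "s \<le> t"
  shows "W s \<in> borel_measurable (F t)"
proof (rule measurableI)
  fix A :: "real set" assume "A \<in> sets borel"
  then show "W s -` A \<inter> space (F t) \<in> sets (F t)"
    unfolding sets_filtration space_filtration using assms by (intro sigma_sets.Basic) auto
qed simp

lemma increment_measurable_filtration:
  assumes "0 \<le> s" "s \<le> t"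
  shows "(\<lambda>\<omega>. W t \<omega> - W s \<omega>) \<in> borel_measurable (F t)"
  using assms by (intro borel_measurable_diff W_measurable_filtration) auto

lemma increment_measurable:
  "0 \<le> s \<Longrightarrow> s \<le> t \<Longrightarrow> (\<lambda>\<omega>. W t \<omega> - W s \<omega>) \<in> borel_measurable M"
  by (rule measurable_filtration[OF increment_measurable_filtration])

text \<open>The Wiener axioms give independence only for increments along one chain of times. A
  chain in \<open>{0..s}\<close> through all points of \<open>J\<close>, prolonged by
  \<open>t\<close>, exhibits the values on \<open>J\<close> as partial sums of the first increments
  and \<open>W t - W s\<close> as the last increment.\<close>

lemma indep_past_cylinder:
  assumes "finite J" "J \<subseteq> {0..s}" "0 \<le> s" "s < t"
    and B: "B \<in> sigma_sets (space M) (\<Union>u\<in>J. {(\<lambda>\<omega>. W u \<omega> - W 0 \<omega>) -` A \<inter> space M | A. A \<in> sets borel})"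
    and "A \<in> sets borel"
  shows "prob (B \<inter> ((\<lambda>\<omega>. W t \<omega> - W s \<omega>) -` A \<inter> space M)) = prob B * prob ((\<lambda>\<omega>. W t \<omega> - W s \<omega>) -` A \<inter> space M)"
proof -
  define part where "part n \<tau> \<longleftrightarrow> \<tau> 0 = 0 \<and> \<tau> n = s \<and> (\<forall>i j. i < j \<longrightarrow> j \<le> n \<longrightarrow> \<tau> i < \<tau> j) \<and> J \<subseteq> \<tau> ` {..n}" for n :: nat and \<tau>
  have "\<exists>n \<tau>. part n \<tau>" unfolding part_def by (rule sorted_partition[OF assms(1,2,3)])
  then obtain n \<tau>' where part: "part n \<tau>'" by blast
  then have \<tau>': "\<tau>' 0 = 0" "\<tau>' n = s" "\<forall>i j. i < j \<longrightarrow> j \<le> n \<longrightarrow> \<tau>' i < \<tau>' j" "J \<subseteq> \<tau>' ` {..n}"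
    unfolding part_def by auto
  \<comment> \<open>The chain continues with \<open>t\<close> after index \<open>n\<close>, so
    increment number \<open>n\<close> is exactly \<open>W t - W s\<close>.\<close>
  define \<tau> where "\<tau> i = (if i \<le> n then \<tau>' i else t)" for i
  have \<tau>: "\<tau> i < \<tau> (Suc i)" if "i < Suc n" for i
    using that \<tau>'(3)[rule_format, of i "Suc i"] \<tau>'(2) \<open>s < t\<close> by (cases "i = n") (auto simp: \<tau>_def)
  have \<tau>0: "\<tau> 0 = 0" using \<tau>'(1) by (simp add: \<tau>_def)
  let ?D = "\<lambda>i \<omega>. W (\<tau> (Suc i)) \<omega> - W (\<tau> i) \<omega>"
  have ind: "indep_vars (\<lambda>_. borel) ?D {..<Suc n}"
    using wiener \<tau> \<tau>0 by (auto simp: wiener_process_def)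
  let ?R = "\<lambda>\<omega>. restrict (\<lambda>i. ?D i \<omega>) {..<n}"
  let ?S = "\<lambda>\<omega>. restrict (\<lambda>i. ?D i \<omega>) {n}"
  have "indep_var (PiM {..<n} (\<lambda>_. borel)) ?R (PiM {n} (\<lambda>_. borel)) ?S"
    by (rule indep_var_restrict[OF ind]) auto
  then have iset: "indep_set (sigma_sets (space M) { ?R -` A \<inter> space M | A. A \<in> sets (PiM {..<n} (\<lambda>_. borel))})
      (sigma_sets (space M) { ?S -` A \<inter> space M | A. A \<in> sets (PiM {n} (\<lambda>_. borel))})"
    by (simp add: indep_var_eq)
  \<comment> \<open>\<open>?V\<close> is the sigma-algebra generated by the first \<open>n\<close>
    increments. By telescoping it makes every \<open>W u - W 0\<close> with \<open>u\<close> in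
    \<open>J\<close> measurable, hence contains \<open>B\<close>.\<close>
  let ?V = "vimage_algebra (space M) ?R (PiM {..<n} (\<lambda>_. borel :: real measure))"
  have Rmeas: "?R \<in> measurable ?V (PiM {..<n} (\<lambda>_. borel))"
    by (rule measurable_vimage_algebra1) (auto simp: space_PiM)
  have Dmeas: "?D i \<in> borel_measurable ?V" if "i < n" for i
  proof -
    have "(\<lambda>x. x i) \<circ> ?R \<in> borel_measurable ?V"
      using that by (intro measurable_comp[OF Rmeas] measurable_component_singleton) auto
    also have "(\<lambda>x. x i) \<circ> ?R = ?D i" using that by (auto simp: fun_eq_iff)
    finally show ?thesis .
  qed
  have Wmeas: "(\<lambda>\<omega>. W u \<omega> - W 0 \<omega>) \<in> borel_measurable ?V" if u: "u \<in> J" for u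
  proof -
    obtain i where i: "i \<le> n" "\<tau>' i = u" using u \<tau>'(4) by blast
    have "(\<Sum>j<i. ?D j \<omega>) = W u \<omega> - W 0 \<omega>" for \<omega>
      using sum_lessThan_telescope[of "\<lambda>j. W (\<tau> j) \<omega>" i] i \<tau>0 by (simp add: \<tau>_def)
    moreover have "(\<lambda>\<omega>. \<Sum>j<i. ?D j \<omega>) \<in> borel_measurable ?V"
      using i by (intro borel_measurable_sum Dmeas) auto
    ultimately show ?thesis by simp
  qed
  have "sigma_sets (space M) (\<Union>u\<in>J. {(\<lambda>\<omega>. W u \<omega> - W 0 \<omega>) -` A \<inter> space M | A. A \<in> sets borel}) \<subseteq> sets ?V"
    using measurable_sets[OF Wmeas]
    by (intro sets.sigma_sets_subset[where M="?V", simplified space_vimage_algebra]) auto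
  with B have "B \<in> sigma_sets (space M) { ?R -` A \<inter> space M | A. A \<in> sets (PiM {..<n} (\<lambda>_. borel))}"
    by (auto simp: sets_vimage_algebra)
  moreover have "(\<lambda>\<omega>. W t \<omega> - W s \<omega>) -` A \<inter> space M
      \<in> sigma_sets (space M) { ?S -` A \<inter> space M | A. A \<in> sets (PiM {n} (\<lambda>_. borel))}"
  proof (intro sigma_sets.Basic CollectI exI conjI)
    show "{x \<in> space (PiM {n} (\<lambda>_. borel)). x n \<in> A} \<in> sets (PiM {n} (\<lambda>_. borel :: real measure))"
      using \<open>A \<in> sets borel\<close> by measurable
    show "(\<lambda>\<omega>. W t \<omega> - W s \<omega>) -` A \<inter> space M = ?S -` {x \<in> space (PiM {n} (\<lambda>_. borel)). x n \<in> A} \<inter> space M"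
      using \<tau>'(2) by (auto simp: \<tau>_def space_PiM)
  qed
  ultimately show ?thesis using indep_setD[OF iset] by blast
qed

text \<open>The pi-system used here consists of all events that agree almost surely with a
  finite-dimensional cylinder of the increments from time 0; this absorbs the null sets of the augmented
  filtration and the initial value, which is only almost surely 0.\<close>
lemma indep_set_filtration_increment:
  assumes st: "0 \<le> s" "s < t"
  shows "indep_set (sets (F s))
    (sigma_sets (space M) {(\<lambda>\<omega>. W t \<omega> - W s \<omega>) -` A \<inter> space M | A. A \<in> sets borel})"
proof -
  define G where "G J = sigma_sets (space M) (\<Union>u\<in>J. {(\<lambda>\<omega>. W u \<omega> - W 0 \<omega>) -` A \<inter> space M | A. A \<in> sets borel})" for J
  define P where "P = {B \<in> events. \<exists>J B'. finite J \<and> J \<subseteq> {0..s} \<and> B' \<in> G J \<and> (AE x in M. x \<in> B \<longleftrightarrow> x \<in> B')}"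
  have G_events: "G J \<subseteq> events" if "J \<subseteq> {0..s}" for J
    unfolding G_def
  proof (rule sets.sigma_sets_subset, safe)
    fix u and A :: "real set" assume "u \<in> J" and [measurable]: "A \<in> sets borel"
    then have "0 \<le> u" using that by auto
    then show "(\<lambda>\<omega>. W u \<omega> - W 0 \<omega>) -` A \<inter> space M \<in> events" by measurable
  qed
  have G_mono: "G J \<subseteq> G J'" if "J \<subseteq> J'" for J J'
    unfolding G_def using that by (intro sigma_sets_mono') auto
  have W0: "AE \<omega> in M. W 0 \<omega> = 0" using wiener by (simp add: wiener_process_def)
  have "Int_stable P"
  proof (rule Int_stableI)
    fix B C assume "B \<in> P" "C \<in> P"
    then obtain J B' K C' where *: "B \<in> events" "finite J" "J \<subseteq> {0..s}" "B' \<in> G J" "AE x in M. x \<in> B \<longleftrightarrow> x \<in> B'"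
      "C \<in> events" "finite K" "K \<subseteq> {0..s}" "C' \<in> G K" "AE x in M. x \<in> C \<longleftrightarrow> x \<in> C'"
      unfolding P_def by blast
    have sa: "sigma_algebra (space M) (G (J \<union> K))"
      unfolding G_def by (rule sigma_algebra_sigma_sets) auto
    interpret sa: sigma_algebra "space M" "G (J \<union> K)" by (rule sa)
    have "B' \<in> G (J \<union> K)" using *(4) G_mono[of J "J \<union> K"] by blast
    moreover have "C' \<in> G (J \<union> K)" using *(9) G_mono[of K "J \<union> K"] by blast
    ultimately have "B' \<inter> C' \<in> G (J \<union> K)" by blast
    moreover have "AE x in M. x \<in> B \<inter> C \<longleftrightarrow> x \<in> B' \<inter> C'" using *(5,10) by eventually_elim auto
    ultimately show "B \<inter> C \<in> P" unfolding P_def using *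
      by (intro CollectI conjI exI[of _ "J \<union> K"] exI[of _ "B' \<inter> C'"]) auto
  qed
  have D: "(\<lambda>\<omega>. W t \<omega> - W s \<omega>) -` A \<inter> space M \<in> events" if "A \<in> sets borel" for A
    using st that by (intro measurable_sets[OF increment_measurable]) auto
  have "indep_set P {(\<lambda>\<omega>. W t \<omega> - W s \<omega>) -` A \<inter> space M | A. A \<in> sets borel}"
    unfolding indep_sets2_eq
  proof (intro conjI ballI)
    show "P \<subseteq> events" by (auto simp: P_def)
    show "{(\<lambda>\<omega>. W t \<omega> - W s \<omega>) -` A \<inter> space M | A. A \<in> sets borel} \<subseteq> events" using D by auto
    fix B C assume "B \<in> P" "C \<in> {(\<lambda>\<omega>. W t \<omega> - W s \<omega>) -` A \<inter> space M | A. A \<in> sets borel}"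
    then obtain J B' A where *: "B \<in> events" "finite J" "J \<subseteq> {0..s}" "B' \<in> G J" "AE x in M. x \<in> B \<longleftrightarrow> x \<in> B'"
      "A \<in> sets borel" "C = (\<lambda>\<omega>. W t \<omega> - W s \<omega>) -` A \<inter> space M"
      unfolding P_def by blast
    have B': "B' \<in> events" using * G_events by blast
    have C: "C \<in> events" using * D by blast
    have "prob B = prob B'" using * B' by (intro measure_eq_AE) auto
    moreover have "prob (B \<inter> C) = prob (B' \<inter> C)" using * B' C by (intro measure_eq_AE) auto
    ultimately show "prob (B \<inter> C) = prob B * prob C"
      using indep_past_cylinder[OF *(2,3) st *(4)[unfolded G_def] *(6)] *(7) by simp
  qed
  moreover have "Int_stable {(\<lambda>\<omega>. W t \<omega> - W s \<omega>) -` A \<inter> space M | A. A \<in> sets borel}"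
  proof (rule Int_stableI, safe)
    fix A B :: "real set" assume "A \<in> sets borel" "B \<in> sets borel"
    then show "\<exists>C. (\<lambda>\<omega>. W t \<omega> - W s \<omega>) -` A \<inter> space M \<inter> ((\<lambda>\<omega>. W t \<omega> - W s \<omega>) -` B \<inter> space M) =
        (\<lambda>\<omega>. W t \<omega> - W s \<omega>) -` C \<inter> space M \<and> C \<in> sets borel"
      by (intro exI[of _ "A \<inter> B"]) auto
  qed
  ultimately have ind: "indep_set (sigma_sets (space M) P)
    (sigma_sets (space M) {(\<lambda>\<omega>. W t \<omega> - W s \<omega>) -` A \<inter> space M | A. A \<in> sets borel})"
    using \<open>Int_stable P\<close> by (intro indep_set_sigma_sets)
  have "(\<Union>s\<in>{0..s}. {W s -` A \<inter> space M | A. A \<in> sets borel}) \<union> null_sets M \<subseteq> P"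
  proof safe
    fix u and A :: "real set" assume u: "u \<in> {0..s}" and A[measurable]: "A \<in> sets borel"
    then have [measurable]: "W u \<in> borel_measurable M" by auto
    show "W u -` A \<inter> space M \<in> P" unfolding P_def
    proof (intro CollectI conjI exI[of _ "{u}"] exI[of _ "(\<lambda>\<omega>. W u \<omega> - W 0 \<omega>) -` A \<inter> space M"])
      show "W u -` A \<inter> space M \<in> events" by measurable
      show "AE x in M. x \<in> W u -` A \<inter> space M \<longleftrightarrow> x \<in> (\<lambda>\<omega>. W u \<omega> - W 0 \<omega>) -` A \<inter> space M"
        using W0 by eventually_elim auto
    qed (use u A in \<open>auto simp: G_def intro!: sigma_sets.Basic\<close>)
  next
    \<comment> \<open>A null set agrees almost surely with the empty cylinder, so no observation
      times are needed.\<close>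
    fix N assume "N \<in> null_sets M"
    then show "N \<in> P" unfolding P_def
      by (intro CollectI conjI exI[of _ "{}"]) (auto simp: G_def AE_not_in intro: sigma_sets.Empty)
  qed
  then have "sets (F s) \<subseteq> sigma_sets (space M) P"
    unfolding sets_filtration by (rule sigma_sets_mono')
  with ind show ?thesis unfolding indep_sets2_eq by blast
qed

lemma indep_var_filtration_increment:
  assumes "0 \<le> s" "s < t" "Z \<in> borel_measurable (F s)"
  shows "indep_var borel Z borel (\<lambda>\<omega>. W t \<omega> - W s \<omega>)"
  unfolding indep_var_eq
proof (intro conjI)
  show "random_variable borel Z" using assms measurable_filtration by blast
  show "random_variable borel (\<lambda>\<omega>. W t \<omega> - W s \<omega>)" using assms by (intro increment_measurable) auto
  have "sigma_sets (space M) {Z -` A \<inter> space M |A. A \<in> sets borel} \<subseteq> sets (F s)"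
  proof (rule sets.sigma_sets_subset[where M="F s", unfolded space_filtration], safe)
    fix A :: "real set" assume "A \<in> sets borel"
    then show "Z -` A \<inter> space M \<in> sets (F s)"
      using measurable_sets[OF assms(3)] unfolding space_filtration by blast
  qed
  then show "indep_set (sigma_sets (space M) {Z -` A \<inter> space M |A. A \<in> sets borel})
     (sigma_sets (space M) {(\<lambda>\<omega>. W t \<omega> - W s \<omega>) -` A \<inter> space M |A. A \<in> sets borel})"
    using indep_set_filtration_increment[OF assms(1,2)] unfolding indep_sets2_eq by blast
qed

end

section \<open>Discrete stochastic integrals\<close>

lemma partition_mono:
  fixes \<tau> :: "nat \<Rightarrow> 'a::preorder"
  assumes "\<And>i. i < n \<Longrightarrow> \<tau> i \<le> \<tau> (Suc i)" "j \<le> k" "k \<le> n"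
  shows "\<tau> j \<le> \<tau> k"
  using assms(2,3)
proof (induction k rule: dec_induct)
  case (step m)
  then show ?case using assms(1)[of m] order_trans[of "\<tau> j" "\<tau> m"] by simp
qed simp

lemma step_function_integral:
  fixes f :: "real \<Rightarrow> real"
  assumes "\<And>i. i < n \<Longrightarrow> \<tau> i \<le> \<tau> (Suc i)"
    and "\<And>i x. i < n \<Longrightarrow> \<tau> i < x \<Longrightarrow> x \<le> \<tau> (Suc i) \<Longrightarrow> f x = c i"
  shows "set_integrable lborel {\<tau> 0..\<tau> n} f \<and>
    (LINT x:{\<tau> 0..\<tau> n}|lborel. f x) = (\<Sum>i<n. c i * (\<tau> (Suc i) - \<tau> i))"
  using assms
proof (induction n)
  case 0
  \<comment> \<open>Nothing is assumed about \<open>f\<close> at the left end; for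
    \<open>n = 0\<close> that single point is the whole interval and has measure 0. Integrals over
    \<open>{0..0}\<close> are evaluated this way later.\<close>
  have eq: "(\<lambda>x. indicator {\<tau> 0..\<tau> 0} x *\<^sub>R f x) = (\<lambda>x. indicator {\<tau> 0} x *\<^sub>R f (\<tau> 0))"
    by (auto simp: fun_eq_iff indicator_def)
  show ?case unfolding set_integrable_def set_lebesgue_integral_def eq by simp
next
  case (Suc n)
  have IH: "set_integrable lborel {\<tau> 0..\<tau> n} f"
    "(LINT x:{\<tau> 0..\<tau> n}|lborel. f x) = (\<Sum>i<n. c i * (\<tau> (Suc i) - \<tau> i))"
    using Suc by auto
  have "\<tau> 0 \<le> \<tau> n" using Suc.prems(1) by (rule partition_mono[where n=n and \<tau>=\<tau>]) auto
  moreover have le: "\<tau> n \<le> \<tau> (Suc n)" using Suc.prems(1) by simp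
  ultimately have un: "{\<tau> 0..\<tau> (Suc n)} = {\<tau> 0..\<tau> n} \<union> {\<tau> n<..\<tau> (Suc n)}" by auto
  have const: "set_integrable lborel {\<tau> n<..\<tau> (Suc n)} (\<lambda>_. c n)"
    unfolding set_integrable_def by (simp add: emeasure_lborel_Ioc le)
  have "set_integrable lborel {\<tau> n<..\<tau> (Suc n)} f \<longleftrightarrow> set_integrable lborel {\<tau> n<..\<tau> (Suc n)} (\<lambda>_. c n)"
    by (rule set_integrable_cong) (use Suc.prems(2)[of n] in auto)
  with const have int: "set_integrable lborel {\<tau> n<..\<tau> (Suc n)} f" by simp
  have "(LINT x:{\<tau> n<..\<tau> (Suc n)}|lborel. f x) = (LINT x:{\<tau> n<..\<tau> (Suc n)}|lborel. c n)"
    by (rule set_lebesgue_integral_cong) (use Suc.prems(2)[of n] in auto)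
  also have "\<dots> = c n * (\<tau> (Suc n) - \<tau> n)" using le by (simp add: set_integral_const)
  finally show ?case
    unfolding un using IH int by (subst set_integral_Un) (auto intro!: set_integrable_Un)
qed

lemma square_integrable_mult:
  fixes f g :: "'a \<Rightarrow> real"
  assumes "f \<in> borel_measurable M" "g \<in> borel_measurable M"
    and "integrable M (\<lambda>x. (f x)\<^sup>2)" "integrable M (\<lambda>x. (g x)\<^sup>2)"
  shows "integrable M (\<lambda>x. f x * g x)"
proof (rule Bochner_Integration.integrable_bound)
  show "integrable M (\<lambda>x. (f x)\<^sup>2 + (g x)\<^sup>2)" using assms by simp
  have "\<bar>f x * g x\<bar> \<le> (f x)\<^sup>2 + (g x)\<^sup>2" for x
    using zero_le_power2[of "\<bar>f x\<bar> - \<bar>g x\<bar>"] zero_le_power2[of "f x"] zero_le_power2[of "g x"]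
    unfolding power2_diff abs_mult power2_abs by linarith
  then show "AE x in M. norm (f x * g x) \<le> norm ((f x)\<^sup>2 + (g x)\<^sup>2)" by simp
qed (use assms in measurable)

context brownian
begin

text \<open>The definition of a Wiener process gives densities only for \<open>s < t\<close>, so the
  zero increment is treated apart. The fourth moment enters through the square of
  \<open>D\<^sup>2 - (t - s)\<close>, for an increment \<open>D\<close>, in
  \<open>variation_step\<close>.\<close>

lemma increment_moments:
  assumes "0 \<le> s" "s \<le> t"
  shows "integrable M (\<lambda>\<omega>. (W t \<omega> - W s \<omega>) ^ k)"
    and "expectation (\<lambda>\<omega>. W t \<omega> - W s \<omega>) = 0"
    and "expectation (\<lambda>\<omega>. (W t \<omega> - W s \<omega>)\<^sup>2) = t - s"
    and "expectation (\<lambda>\<omega>. (W t \<omega> - W s \<omega>) ^ 4) = 3 * (t - s)\<^sup>2"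
proof -
  have "integrable M (\<lambda>\<omega>. (W t \<omega> - W s \<omega>) ^ k) \<and> expectation (\<lambda>\<omega>. W t \<omega> - W s \<omega>) = 0 \<and>
    expectation (\<lambda>\<omega>. (W t \<omega> - W s \<omega>)\<^sup>2) = t - s \<and> expectation (\<lambda>\<omega>. (W t \<omega> - W s \<omega>) ^ 4) = 3 * (t - s)\<^sup>2"
  proof (cases "s = t")
    case False
    then have pos: "sqrt (t - s) > 0" using assms by simp
    have D: "distributed M lborel (\<lambda>\<omega>. W t \<omega> - W s \<omega>) (\<lambda>x. ennreal (normal_density 0 (sqrt (t - s)) x))"
      using wiener False assms by (simp add: wiener_process_def)
    have int: "expectation (\<lambda>\<omega>. (W t \<omega> - W s \<omega>) ^ j) = integral\<^sup>L lborel (\<lambda>x. normal_density 0 (sqrt (t - s)) x * x ^ j)" for j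
      using distributed_integral[OF D, of "\<lambda>x. x ^ j"] by simp
    have "integrable M (\<lambda>\<omega>. (W t \<omega> - W s \<omega>) ^ k)"
      using distributed_integrable[OF D, of "\<lambda>x. x ^ k"] integrable_normal_moment[OF pos, of 0 k] by simp
    moreover have "expectation (\<lambda>\<omega>. W t \<omega> - W s \<omega>) = 0"
      using int[of 1] integral_normal_moment_odd[OF pos, of 0 0] by simp
    moreover have "expectation (\<lambda>\<omega>. (W t \<omega> - W s \<omega>)\<^sup>2) = t - s"
      using int[of 2] integral_normal_moment_even[OF pos, of 0 1] pos by (simp add: fact_numeral)
    moreover have "expectation (\<lambda>\<omega>. (W t \<omega> - W s \<omega>) ^ 4) = 3 * (t - s)\<^sup>2"
      using int[of 4] integral_normal_moment_even[OF pos, of 0 2] pos power_mult[of "sqrt (t - s)" 2 2] by (simp add: fact_numeral field_simps)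
    ultimately show ?thesis by simp
  qed (simp add: zero_power)
  then show "integrable M (\<lambda>\<omega>. (W t \<omega> - W s \<omega>) ^ k)"
    "expectation (\<lambda>\<omega>. W t \<omega> - W s \<omega>) = 0"
    "expectation (\<lambda>\<omega>. (W t \<omega> - W s \<omega>)\<^sup>2) = t - s"
    "expectation (\<lambda>\<omega>. (W t \<omega> - W s \<omega>) ^ 4) = 3 * (t - s)\<^sup>2" by auto
qed

text \<open>Takes the place of conditional expectation given \<open>F s\<close>: a factor known at
  time \<open>s\<close> is independent of the later increment, so the moments of the increment can
  be inserted under the expectation.\<close>

lemma past_times_increment:
  assumes st: "0 \<le> s" "s \<le> t" and Z: "Z \<in> borel_measurable (F s)" "integrable M Z"
  shows "integrable M (\<lambda>\<omega>. Z \<omega> * (W t \<omega> - W s \<omega>) ^ k)"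
    and "expectation (\<lambda>\<omega>. Z \<omega> * (W t \<omega> - W s \<omega>) ^ k) = expectation Z * expectation (\<lambda>\<omega>. (W t \<omega> - W s \<omega>) ^ k)"
proof -
  have "integrable M (\<lambda>\<omega>. Z \<omega> * (W t \<omega> - W s \<omega>) ^ k) \<and>
    expectation (\<lambda>\<omega>. Z \<omega> * (W t \<omega> - W s \<omega>) ^ k) = expectation Z * expectation (\<lambda>\<omega>. (W t \<omega> - W s \<omega>) ^ k)"
  proof (cases "s = t")
    case True
    then show ?thesis using Z by (cases k) (auto simp: prob_space)
  next
    case False
    then have ind: "indep_var borel ((\<lambda>x. x) \<circ> Z) borel ((\<lambda>x. x ^ k) \<circ> (\<lambda>\<omega>. W t \<omega> - W s \<omega>))"
      using st by (intro indep_var_compose[OF indep_var_filtration_increment[OF _ _ Z(1)]]) auto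
    have ind: "indep_var borel Z borel (\<lambda>\<omega>. (W t \<omega> - W s \<omega>) ^ k)"
      using ind by (simp add: comp_def)
    show ?thesis
      using indep_var_integrable[OF ind Z(2) increment_moments(1)[OF st]]
        indep_var_lebesgue_integral[OF ind Z(2) increment_moments(1)[OF st]] by simp
  qed
  then show "integrable M (\<lambda>\<omega>. Z \<omega> * (W t \<omega> - W s \<omega>) ^ k)"
    "expectation (\<lambda>\<omega>. Z \<omega> * (W t \<omega> - W s \<omega>) ^ k) = expectation Z * expectation (\<lambda>\<omega>. (W t \<omega> - W s \<omega>) ^ k)" by auto
qed

text \<open>One step of the Ito isometry: the cross term has mean zero because \<open>Y\<close> and
  \<open>Z\<close> are both known at time \<open>s\<close> and the increment is centred.\<close>

lemma isometry_step:
  assumes st: "0 \<le> s" "s \<le> t" and YZ: "Y \<in> borel_measurable (F s)" "Z \<in> borel_measurable (F s)"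
    and int: "integrable M (\<lambda>\<omega>. (Y \<omega>)\<^sup>2)" "integrable M (\<lambda>\<omega>. (Z \<omega>)\<^sup>2)"
  shows "integrable M (\<lambda>\<omega>. (Y \<omega> + Z \<omega> * (W t \<omega> - W s \<omega>))\<^sup>2)"
    and "expectation (\<lambda>\<omega>. (Y \<omega> + Z \<omega> * (W t \<omega> - W s \<omega>))\<^sup>2)
      = expectation (\<lambda>\<omega>. (Y \<omega>)\<^sup>2) + expectation (\<lambda>\<omega>. (Z \<omega>)\<^sup>2) * (t - s)"
proof -
  have eq: "(\<lambda>\<omega>. (Y \<omega> + Z \<omega> * (W t \<omega> - W s \<omega>))\<^sup>2) =
    (\<lambda>\<omega>. (Y \<omega>)\<^sup>2 + (Z \<omega>)\<^sup>2 * (W t \<omega> - W s \<omega>)\<^sup>2 + 2 * (Y \<omega> * Z \<omega> * (W t \<omega> - W s \<omega>) ^ 1))"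
    by (simp add: fun_eq_iff power2_sum power_mult_distrib)
  have "integrable M (\<lambda>\<omega>. Y \<omega> * Z \<omega>)"
    using square_integrable_mult[OF YZ[THEN measurable_filtration] int] .
  note 1 = past_times_increment[OF st borel_measurable_times[OF YZ] this, of 1]
  have "(\<lambda>\<omega>. (Z \<omega>)\<^sup>2) \<in> borel_measurable (F s)" using YZ by measurable
  note 2 = past_times_increment[OF st this int(2), of 2]
  show "integrable M (\<lambda>\<omega>. (Y \<omega> + Z \<omega> * (W t \<omega> - W s \<omega>))\<^sup>2)"
    unfolding eq by (intro Bochner_Integration.integrable_add integrable_mult_right int 1 2)
  show "expectation (\<lambda>\<omega>. (Y \<omega> + Z \<omega> * (W t \<omega> - W s \<omega>))\<^sup>2)
      = expectation (\<lambda>\<omega>. (Y \<omega>)\<^sup>2) + expectation (\<lambda>\<omega>. (Z \<omega>)\<^sup>2) * (t - s)"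
    unfolding eq using 1 2 int increment_moments[OF st] by simp
qed

lemma discrete_integral_measurable:
  assumes "0 \<le> \<tau> 0" "\<And>i. i < n \<Longrightarrow> \<tau> i \<le> \<tau> (Suc i)" "\<And>i. i < n \<Longrightarrow> \<xi> i \<in> borel_measurable (F (\<tau> i))"
  shows "(\<lambda>\<omega>. \<Sum>i<n. \<xi> i \<omega> * (W (\<tau> (Suc i)) \<omega> - W (\<tau> i) \<omega>)) \<in> borel_measurable (F (\<tau> n))"
proof (intro borel_measurable_sum borel_measurable_times)
  fix i assume i: "i \<in> {..<n}"
  have mono: "\<tau> j \<le> \<tau> k" if "j \<le> k" "k \<le> n" for j k
    by (rule partition_mono[where n=n and \<tau>=\<tau>, OF assms(2) that])
  show "\<xi> i \<in> borel_measurable (F (\<tau> n))"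
    using i by (auto intro: measurable_filtration_mono[OF assms(3)[of i] mono[of i n]])
  show "(\<lambda>\<omega>. W (\<tau> (Suc i)) \<omega> - W (\<tau> i) \<omega>) \<in> borel_measurable (F (\<tau> n))"
    using i mono[of "Suc i" n] mono[of 0 i] mono[of i "Suc i"] assms(1)
    by (auto intro: measurable_filtration_mono[OF increment_measurable_filtration, of "\<tau> i" "\<tau> (Suc i)" "\<tau> n"])
qed

lemma discrete_isometry:
  assumes "0 \<le> \<tau> 0" "\<And>i. i < n \<Longrightarrow> \<tau> i \<le> \<tau> (Suc i)" "\<And>i. i < n \<Longrightarrow> \<xi> i \<in> borel_measurable (F (\<tau> i))"
    and "\<And>i. i < n \<Longrightarrow> integrable M (\<lambda>\<omega>. (\<xi> i \<omega>)\<^sup>2)"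
  shows "integrable M (\<lambda>\<omega>. (\<Sum>i<n. \<xi> i \<omega> * (W (\<tau> (Suc i)) \<omega> - W (\<tau> i) \<omega>))\<^sup>2) \<and>
    expectation (\<lambda>\<omega>. (\<Sum>i<n. \<xi> i \<omega> * (W (\<tau> (Suc i)) \<omega> - W (\<tau> i) \<omega>))\<^sup>2)
      = (\<Sum>i<n. expectation (\<lambda>\<omega>. (\<xi> i \<omega>)\<^sup>2) * (\<tau> (Suc i) - \<tau> i))"
  using assms
proof (induction n)
  case (Suc n)
  have IH: "integrable M (\<lambda>\<omega>. (\<Sum>i<n. \<xi> i \<omega> * (W (\<tau> (Suc i)) \<omega> - W (\<tau> i) \<omega>))\<^sup>2)"
    "expectation (\<lambda>\<omega>. (\<Sum>i<n. \<xi> i \<omega> * (W (\<tau> (Suc i)) \<omega> - W (\<tau> i) \<omega>))\<^sup>2)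
      = (\<Sum>i<n. expectation (\<lambda>\<omega>. (\<xi> i \<omega>)\<^sup>2) * (\<tau> (Suc i) - \<tau> i))" using Suc by auto
  have "\<tau> 0 \<le> \<tau> n" using Suc.prems(2) by (rule partition_mono[where n=n and \<tau>=\<tau>]) auto
  with Suc.prems have \<tau>: "0 \<le> \<tau> n" "\<tau> n \<le> \<tau> (Suc n)" by (auto intro: order_trans)
  have meas: "(\<lambda>\<omega>. \<Sum>i<n. \<xi> i \<omega> * (W (\<tau> (Suc i)) \<omega> - W (\<tau> i) \<omega>)) \<in> borel_measurable (F (\<tau> n))"
    using Suc.prems by (intro discrete_integral_measurable) auto
  from isometry_step[OF \<tau> meas Suc.prems(3)[of n] IH(1) Suc.prems(4)[of n]] IH(2)
  show ?case by simp
qed simp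

text \<open>The integrand is switched off once the accumulated quadratic variation would exceed \<open>\<kappa>\<close>; the
  truncated integral has second moment at most \<open>\<kappa>\<close>.\<close>
lemma discrete_lenglart:
  assumes \<tau>: "0 \<le> \<tau> 0" "\<And>i. i < n \<Longrightarrow> \<tau> i < \<tau> (Suc i)" and \<xi>: "\<And>i. i < n \<Longrightarrow> \<xi> i \<in> borel_measurable (F (\<tau> i))"
    and pos: "0 \<le> \<kappa>" "0 < \<epsilon>"
  shows "prob {\<omega>\<in>space M. \<bar>\<Sum>i<n. \<xi> i \<omega> * (W (\<tau> (Suc i)) \<omega> - W (\<tau> i) \<omega>)\<bar> > \<epsilon> \<and>
      (\<Sum>i<n. (\<xi> i \<omega>)\<^sup>2 * (\<tau> (Suc i) - \<tau> i)) \<le> \<kappa>} \<le> \<kappa> / \<epsilon>\<^sup>2"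
proof -
  \<comment> \<open>The sum includes the index \<open>i\<close> itself: \<open>\<xi> i\<close> is
    already known at time \<open>\<tau> i\<close>, so the cutoff stays adapted and the accumulated
    sum never overshoots \<open>\<kappa>\<close>.\<close>
  define A where "A i \<omega> = (\<Sum>j\<le>i. (\<xi> j \<omega>)\<^sup>2 * (\<tau> (Suc j) - \<tau> j))" for i \<omega>
  define \<eta> where "\<eta> i \<omega> = (if A i \<omega> \<le> \<kappa> then \<xi> i \<omega> else 0)" for i \<omega>
  have mono: "\<tau> j \<le> \<tau> k" if "j \<le> k" "k \<le> n" for j k
    by (rule partition_mono[where n=n and \<tau>=\<tau>, OF less_imp_le[OF \<tau>(2)] that])
  have \<eta>: "\<eta> i \<in> borel_measurable (F (\<tau> i))" if "i < n" for i
  proof -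
    have [measurable]: "\<xi> j \<in> borel_measurable (F (\<tau> i))" if "j \<le> i" for j
      using that \<open>i < n\<close> by (auto intro: measurable_filtration_mono[OF \<xi>[of j] mono[of j i]])
    have [measurable]: "A i \<in> borel_measurable (F (\<tau> i))"
      unfolding A_def by (intro borel_measurable_sum borel_measurable_times borel_measurable_power) auto
    have [measurable]: "\<xi> i \<in> borel_measurable (F (\<tau> i))" using \<xi>[OF that] .
    show ?thesis unfolding \<eta>_def by measurable
  qed
  have term_nonneg: "0 \<le> (\<xi> i \<omega>)\<^sup>2 * (\<tau> (Suc i) - \<tau> i)" if "i < n" for i \<omega>
    using \<tau>(2)[OF that] by simp
  have \<eta>_le: "(\<eta> i \<omega>)\<^sup>2 * (\<tau> (Suc i) - \<tau> i) \<le> (\<xi> i \<omega>)\<^sup>2 * (\<tau> (Suc i) - \<tau> i)" if "i < n" for i \<omega>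
    using term_nonneg[OF that] by (simp add: \<eta>_def)
  have \<eta>_bound: "(\<eta> i \<omega>)\<^sup>2 * (\<tau> (Suc i) - \<tau> i) \<le> \<kappa>" if "i < n" for i \<omega>
  proof (cases "A i \<omega> \<le> \<kappa>")
    case True
    have "(\<xi> i \<omega>)\<^sup>2 * (\<tau> (Suc i) - \<tau> i) \<le> A i \<omega>"
      unfolding A_def using that by (intro member_le_sum term_nonneg) auto
    with True show ?thesis by (simp add: \<eta>_def)
  qed (use pos in \<open>simp add: \<eta>_def\<close>)
  have int: "integrable M (\<lambda>\<omega>. (\<eta> i \<omega>)\<^sup>2)" if "i < n" for i
  proof (rule integrable_const_bound)
    \<comment> \<open>Strictness of the partition makes the cut off coefficient bounded, so the
      isometry applies without any moment assumption on \<open>\<xi>\<close>.\<close>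
    show "AE \<omega> in M. norm ((\<eta> i \<omega>)\<^sup>2) \<le> \<kappa> / (\<tau> (Suc i) - \<tau> i)"
      using \<eta>_bound[OF that] \<tau>(2)[OF that] by (simp add: field_simps)
    show "(\<lambda>\<omega>. (\<eta> i \<omega>)\<^sup>2) \<in> borel_measurable M"
      using measurable_filtration[OF \<eta>[OF that]] by measurable
  qed
  have sum_le: "(\<Sum>i<m. (\<eta> i \<omega>)\<^sup>2 * (\<tau> (Suc i) - \<tau> i)) \<le> \<kappa>" if "m \<le> n" for m \<omega>
    using that
  proof (induction m)
    case (Suc m)
    \<comment> \<open>Either the accumulation up to \<open>m\<close> stays below
      \<open>\<kappa>\<close> and dominates the whole sum, or the last term is 0 and the induction
      hypothesis suffices.\<close>
    show ?case
    proof (cases "A m \<omega> \<le> \<kappa>")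
      case True
      have "(\<Sum>i<Suc m. (\<eta> i \<omega>)\<^sup>2 * (\<tau> (Suc i) - \<tau> i)) \<le> A m \<omega>"
        unfolding A_def lessThan_Suc_atMost using Suc.prems by (intro sum_mono \<eta>_le) auto
      with True show ?thesis by simp
    qed (use Suc in \<open>simp add: \<eta>_def\<close>)
  qed (use pos in simp)
  let ?S = "\<lambda>\<omega>. \<Sum>i<n. \<eta> i \<omega> * (W (\<tau> (Suc i)) \<omega> - W (\<tau> i) \<omega>)"
  have iso: "integrable M (\<lambda>\<omega>. (?S \<omega>)\<^sup>2)"
    "expectation (\<lambda>\<omega>. (?S \<omega>)\<^sup>2) = (\<Sum>i<n. expectation (\<lambda>\<omega>. (\<eta> i \<omega>)\<^sup>2) * (\<tau> (Suc i) - \<tau> i))"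
    using discrete_isometry[of \<tau> n \<eta>] \<tau> \<eta> int by (auto simp: less_imp_le)
  have "(\<Sum>i<n. expectation (\<lambda>\<omega>. (\<eta> i \<omega>)\<^sup>2) * (\<tau> (Suc i) - \<tau> i)) =
      expectation (\<lambda>\<omega>. \<Sum>i<n. (\<eta> i \<omega>)\<^sup>2 * (\<tau> (Suc i) - \<tau> i))"
    using int by (subst Bochner_Integration.integral_sum) auto
  also have "\<dots> \<le> expectation (\<lambda>_. \<kappa>)"
    using int sum_le by (intro integral_mono) auto
  finally have E: "expectation (\<lambda>\<omega>. (?S \<omega>)\<^sup>2) \<le> \<kappa>" unfolding iso by (simp add: prob_space)
  have Smeas: "?S \<in> borel_measurable M"
    using \<tau> \<eta> by (intro measurable_filtration[OF discrete_integral_measurable]) (auto simp: less_imp_le)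
  have sub: "{\<omega>\<in>space M. \<bar>\<Sum>i<n. \<xi> i \<omega> * (W (\<tau> (Suc i)) \<omega> - W (\<tau> i) \<omega>)\<bar> > \<epsilon> \<and>
      (\<Sum>i<n. (\<xi> i \<omega>)\<^sup>2 * (\<tau> (Suc i) - \<tau> i)) \<le> \<kappa>} \<subseteq> {\<omega>\<in>space M. \<epsilon>\<^sup>2 \<le> (?S \<omega>)\<^sup>2}"
  proof safe
    fix \<omega> assume *: "\<bar>\<Sum>i<n. \<xi> i \<omega> * (W (\<tau> (Suc i)) \<omega> - W (\<tau> i) \<omega>)\<bar> > \<epsilon>"
      "(\<Sum>i<n. (\<xi> i \<omega>)\<^sup>2 * (\<tau> (Suc i) - \<tau> i)) \<le> \<kappa>"
    have "A i \<omega> \<le> \<kappa>" if "i < n" for i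
    proof -
      have "A i \<omega> \<le> (\<Sum>i<n. (\<xi> i \<omega>)\<^sup>2 * (\<tau> (Suc i) - \<tau> i))"
        unfolding A_def using that by (intro sum_mono2 term_nonneg) auto
      with * show ?thesis by simp
    qed
    then have "?S \<omega> = (\<Sum>i<n. \<xi> i \<omega> * (W (\<tau> (Suc i)) \<omega> - W (\<tau> i) \<omega>))"
      by (intro sum.cong) (auto simp: \<eta>_def)
    then have "\<bar>\<epsilon>\<bar> \<le> \<bar>?S \<omega>\<bar>" using * pos by simp
    then show "\<epsilon>\<^sup>2 \<le> (?S \<omega>)\<^sup>2" by (simp add: abs_le_square_iff)
  qed
  have "prob {\<omega>\<in>space M. \<epsilon>\<^sup>2 \<le> (?S \<omega>)\<^sup>2} \<le> expectation (\<lambda>\<omega>. (?S \<omega>)\<^sup>2) / \<epsilon>\<^sup>2"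
    using pos iso by (intro integral_Markov_inequality_measure[where A="{}"]) auto
  also have "\<dots> \<le> \<kappa> / \<epsilon>\<^sup>2" using E by (intro divide_right_mono) auto
  finally show ?thesis
    using finite_measure_mono[OF sub] Smeas by fastforce
qed

end

section \<open>Simple processes and the Ito integral\<close>

lemma simple_value_Nil [simp]: "simple_value [] x \<omega> = 0"
  and simple_value_Cons [simp]:
    "simple_value ((s, t, \<xi>) # K) x \<omega> = \<xi> \<omega> * indicator {s<..t} x + simple_value K x \<omega>"
  by (simp_all add: simple_value_def)

lemma simple_integral_Nil [simp]: "simple_integral W [] x \<omega> = 0"
  and simple_integral_Cons [simp]:
    "simple_integral W ((s, t, \<xi>) # K) x \<omega> = \<xi> \<omega> * (W (min t x) \<omega> - W (min s x) \<omega>) + simple_integral W K x \<omega>"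
  by (simp_all add: simple_integral_def)

lemma simple_value_append: "simple_value (K @ L) x \<omega> = simple_value K x \<omega> + simple_value L x \<omega>"
  by (simp add: simple_value_def)

lemma simple_integral_append:
  "simple_integral W (K @ L) x \<omega> = simple_integral W K x \<omega> + simple_integral W L x \<omega>"
  by (simp add: simple_integral_def)

definition simple_uminus :: "'a simple_process \<Rightarrow> 'a simple_process" where
  "simple_uminus K = map (\<lambda>(s, t, \<xi>). (s, t, \<lambda>\<omega>. - \<xi> \<omega>)) K"

lemma simple_value_uminus: "simple_value (simple_uminus K) x \<omega> = - simple_value K x \<omega>"
  by (induction K) (auto simp: simple_uminus_def)

lemma simple_integral_uminus: "simple_integral W (simple_uminus K) x \<omega> = - simple_integral W K x \<omega>"
  by (induction K) (auto simp: simple_uminus_def)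

text \<open>Boundedness is dropped: Riemann sums of an unbounded integrand are of this form, and the truncation in
  \<open>discrete_lenglart\<close> makes it superfluous.\<close>
definition elementary :: "(real \<Rightarrow> 'a measure) \<Rightarrow> 'a simple_process \<Rightarrow> bool" where
  "elementary F K \<longleftrightarrow> (\<forall>(s, t, \<xi>) \<in> set K. 0 \<le> s \<and> s < t \<and> \<xi> \<in> borel_measurable (F s))"

lemma elementary_Nil [simp]: "elementary F []"
  and elementary_Cons [simp]:
    "elementary F ((s, t, \<xi>) # K) \<longleftrightarrow> 0 \<le> s \<and> s < t \<and> \<xi> \<in> borel_measurable (F s) \<and> elementary F K"
  by (auto simp: elementary_def)

lemma elementary_append [simp]: "elementary F (K @ L) \<longleftrightarrow> elementary F K \<and> elementary F L"
  unfolding elementary_def set_append by (rule ball_Un)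

lemma elementary_uminus: "elementary F K \<Longrightarrow> elementary F (simple_uminus K)"
  by (auto simp: elementary_def simple_uminus_def)

lemma simple_process_elementary: "simple_process F K \<Longrightarrow> elementary F K"
  by (auto simp: elementary_def simple_process_def)

definition simple_endpoints :: "'a simple_process \<Rightarrow> real set" where
  "simple_endpoints K = fst ` set K \<union> (fst \<circ> snd) ` set K"

lemma simple_endpoints_Cons: "simple_endpoints ((s, t, \<xi>) # K) = insert s (insert t (simple_endpoints K))"
  by (auto simp: simple_endpoints_def)

lemma finite_simple_endpoints: "finite (simple_endpoints K)"
  by (simp add: simple_endpoints_def)

text \<open>The intervals are left-open and right-closed, so the value is constant on
  \<open>{y<..z}\<close> when no endpoint lies strictly between; the representative has to be taken
  at \<open>z\<close>, not at \<open>y\<close>.\<close>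

lemma simple_value_between:
  assumes "\<And>p. p \<in> simple_endpoints K \<Longrightarrow> p \<le> y \<or> z \<le> p" "y < x" "x \<le> z"
  shows "simple_value K x \<omega> = simple_value K z \<omega>"
  using assms(1)
proof (induction K)
  case (Cons k K)
  obtain s t \<xi> where k: "k = (s, t, \<xi>)" by (cases k)
  have "s \<le> y \<or> z \<le> s" "t \<le> y \<or> z \<le> t"
    using Cons.prems[of s] Cons.prems[of t] by (auto simp: k simple_endpoints_Cons)
  then have "indicator {s<..t} x = (indicator {s<..t} z :: real)"
    using assms(2,3) by (auto simp: indicator_def)
  moreover have "simple_value K x \<omega> = simple_value K z \<omega>"
    using Cons.prems by (intro Cons.IH) (auto simp: k simple_endpoints_Cons)
  ultimately show ?case by (simp add: k)
qed simp

lemma simple_integral_between: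
  assumes "\<And>p. p \<in> simple_endpoints K \<Longrightarrow> p \<le> y \<or> z \<le> p" "y < z" "elementary F K"
  shows "simple_integral W K z \<omega> - simple_integral W K y \<omega> = simple_value K z \<omega> * (W z \<omega> - W y \<omega>)"
  using assms(1,3)
proof (induction K)
  case (Cons k K)
  obtain s t \<xi> where k: "k = (s, t, \<xi>)" by (cases k)
  have "s \<le> y \<or> z \<le> s" "t \<le> y \<or> z \<le> t" "s < t"
    using Cons.prems(1)[of s] Cons.prems(1)[of t] Cons.prems(2) by (auto simp: k simple_endpoints_Cons)
  then have "W (min t z) \<omega> - W (min s z) \<omega> - (W (min t y) \<omega> - W (min s y) \<omega>)
      = indicator {s<..t} z * (W z \<omega> - W y \<omega>)"
    using assms(2) by (auto simp: indicator_def min_def)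
  from arg_cong[OF this, of "\<lambda>x. \<xi> \<omega> * x"]
  have "\<xi> \<omega> * (W (min t z) \<omega> - W (min s z) \<omega>) - \<xi> \<omega> * (W (min t y) \<omega> - W (min s y) \<omega>)
      = \<xi> \<omega> * indicator {s<..t} z * (W z \<omega> - W y \<omega>)"
    by (simp add: right_diff_distrib mult.assoc)
  moreover have "simple_integral W K z \<omega> - simple_integral W K y \<omega> = simple_value K z \<omega> * (W z \<omega> - W y \<omega>)"
    using Cons.prems by (intro Cons.IH) (auto simp: k simple_endpoints_Cons)
  ultimately show ?case by (simp add: k distrib_right)
qed simp

text \<open>Overlapping intervals of \<open>K\<close> are resolved into a chain from
  \<open>u\<close> to \<open>v\<close> with no endpoint strictly inside a cell. Endpoints outside
  \<open>{u..v}\<close> lie before every cell or after every cell.\<close>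

lemma simple_value_partition:
  fixes K :: "'a simple_process"
  assumes "u \<le> v"
  shows "\<exists>(n::nat) \<tau>. \<tau> 0 = u \<and> \<tau> n = v \<and> (\<forall>i<n. \<tau> i < \<tau> (Suc i)) \<and>
    (\<forall>i<n. \<forall>p\<in>simple_endpoints K. p \<le> \<tau> i \<or> \<tau> (Suc i) \<le> p)"
proof -
  obtain n :: nat and \<tau> where part: "\<tau> 0 = u" "\<tau> n = v" "\<forall>i j. i < j \<longrightarrow> j \<le> n \<longrightarrow> \<tau> i < \<tau> j"
      and sub: "simple_endpoints K \<inter> {u..v} \<subseteq> \<tau> ` {..n}"
    using sorted_partition[of "simple_endpoints K \<inter> {u..v}" u v] finite_simple_endpoints[of K] assms
    by (auto simp del: atMost_iff)
  have mono: "\<tau> i \<le> \<tau> j" if "i \<le> j" "j \<le> n" for i j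
    using that part(3) by (cases "i = j") (auto intro: less_imp_le)
  have "p \<le> \<tau> i \<or> \<tau> (Suc i) \<le> p" if i: "i < n" and p: "p \<in> simple_endpoints K" for i p
  proof (cases "p \<in> {u..v}")
    case True
    with sub p obtain k where k: "k \<le> n" "\<tau> k = p" by auto
    then show ?thesis using mono[of k i] mono[of "Suc i" k] i by (cases "k \<le> i") auto
  next
    case False
    then show ?thesis using mono[of 0 i] mono[of "Suc i" n] i part(1,2) by auto
  qed
  with part show ?thesis by (intro exI[of _ n] exI[of _ \<tau>]) auto
qed

lemma simple_value_square_integrable: "set_integrable lborel {u..v} (\<lambda>x. (simple_value K x \<omega>)\<^sup>2)"
proof (cases "u \<le> v")
  case True
  then obtain n :: nat and \<tau> where \<tau>: "\<tau> 0 = u" "\<tau> n = v" "\<forall>i<n. \<tau> i < \<tau> (Suc i)"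
    and sep: "\<forall>i<n. \<forall>p\<in>simple_endpoints K. p \<le> \<tau> i \<or> \<tau> (Suc i) \<le> p"
    using simple_value_partition[of u v K] by blast
  have btw: "(simple_value K x \<omega>)\<^sup>2 = (simple_value K (\<tau> (Suc i)) \<omega>)\<^sup>2" if "i < n" "\<tau> i < x" "x \<le> \<tau> (Suc i)" for i x
    by (rule arg_cong[where f="power2"], rule simple_value_between[of K "\<tau> i"]) (use sep that in auto)
  have "set_integrable lborel {\<tau> 0..\<tau> n} (\<lambda>x. (simple_value K x \<omega>)\<^sup>2)"
    by (rule step_function_integral[where n=n and \<tau>=\<tau> and f="\<lambda>x. (simple_value K x \<omega>)\<^sup>2"
          and c="\<lambda>i. (simple_value K (\<tau> (Suc i)) \<omega>)\<^sup>2", THEN conjunct1])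
      (use btw \<tau>(3) less_imp_le in blast)+
  then show ?thesis using \<tau> by simp
qed (simp add: set_integrable_def)

context brownian
begin

text \<open>Predictability: with no endpoint between \<open>y\<close> and \<open>z\<close>, a
  summand that is active at \<open>z\<close> starts at \<open>y\<close> or earlier, so its
  coefficient is known at \<open>y\<close>.\<close>

lemma simple_value_measurable_filtration:
  assumes "elementary F K" "\<And>p. p \<in> simple_endpoints K \<Longrightarrow> p \<le> y \<or> z \<le> p" "y < z"
  shows "simple_value K z \<in> borel_measurable (F y)"
  using assms(1,2)
proof (induction K)
  case (Cons k K)
  obtain s t \<xi> where k: "k = (s, t, \<xi>)" by (cases k)
  have IH: "simple_value K z \<in> borel_measurable (F y)"
    using Cons.prems by (intro Cons.IH) (auto simp: k simple_endpoints_Cons)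
  have s: "s \<le> y \<or> z \<le> s" using Cons.prems(2)[of s] by (auto simp: k simple_endpoints_Cons)
  have "(\<lambda>\<omega>. \<xi> \<omega> * indicator {s<..t} z) \<in> borel_measurable (F y)"
  proof (cases "s < z")
    case True
    with s have "s \<le> y" by simp
    moreover have "\<xi> \<in> borel_measurable (F s)" using Cons.prems(1) by (simp add: k)
    ultimately have "\<xi> \<in> borel_measurable (F y)" by (rule measurable_filtration_mono[rotated])
    then show ?thesis by measurable
  qed simp
  from borel_measurable_add[OF this IH]
  show ?case by (simp add: k)
qed (simp add: simple_value_def[abs_def])

text \<open>On a chain fitted to \<open>K\<close>, the increment of the integral and the energy are
  the two sums in \<open>discrete_lenglart\<close>; the value at the right end of a cell serves as
  the coefficient known at its left end.\<close>

lemma simple_lenglart: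
  assumes K: "elementary F K" and uv: "0 \<le> u" "u \<le> v" and pos: "0 \<le> \<kappa>" "0 < \<epsilon>"
  shows "prob {\<omega>\<in>space M. \<bar>simple_integral W K v \<omega> - simple_integral W K u \<omega>\<bar> > \<epsilon> \<and>
      (LINT x:{u..v}|lborel. (simple_value K x \<omega>)\<^sup>2) \<le> \<kappa>} \<le> \<kappa> / \<epsilon>\<^sup>2"
proof -
  obtain n :: nat and \<tau> where \<tau>: "\<tau> 0 = u" "\<tau> n = v" "\<forall>i<n. \<tau> i < \<tau> (Suc i)"
    and sep: "\<forall>i<n. \<forall>p\<in>simple_endpoints K. p \<le> \<tau> i \<or> \<tau> (Suc i) \<le> p"
    using simple_value_partition[of u v K] uv by blast
  have btw: "(simple_value K x \<omega>)\<^sup>2 = (simple_value K (\<tau> (Suc i)) \<omega>)\<^sup>2" if "i < n" "\<tau> i < x" "x \<le> \<tau> (Suc i)" for i x \<omega>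
    by (rule arg_cong[where f="power2"], rule simple_value_between[of K "\<tau> i"]) (use sep that in auto)
  have "simple_integral W K v \<omega> - simple_integral W K u \<omega>
      = (\<Sum>i<n. simple_value K (\<tau> (Suc i)) \<omega> * (W (\<tau> (Suc i)) \<omega> - W (\<tau> i) \<omega>))" for \<omega>
  proof -
    have "simple_integral W K v \<omega> - simple_integral W K u \<omega>
      = (\<Sum>i<n. simple_integral W K (\<tau> (Suc i)) \<omega> - simple_integral W K (\<tau> i) \<omega>)"
      using sum_lessThan_telescope[of "\<lambda>i. simple_integral W K (\<tau> i) \<omega>" n] \<tau> by simp
    also have "\<dots> = (\<Sum>i<n. simple_value K (\<tau> (Suc i)) \<omega> * (W (\<tau> (Suc i)) \<omega> - W (\<tau> i) \<omega>))"
      using \<tau> sep K by (intro sum.cong simple_integral_between) auto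
    finally show ?thesis .
  qed
  moreover have "(LINT x:{\<tau> 0..\<tau> n}|lborel. (simple_value K x \<omega>)\<^sup>2)
      = (\<Sum>i<n. (simple_value K (\<tau> (Suc i)) \<omega>)\<^sup>2 * (\<tau> (Suc i) - \<tau> i))" for \<omega>
    by (rule step_function_integral[where n=n and \<tau>=\<tau> and f="\<lambda>x. (simple_value K x \<omega>)\<^sup>2"
          and c="\<lambda>i. (simple_value K (\<tau> (Suc i)) \<omega>)\<^sup>2", THEN conjunct2])
      (use btw \<tau>(3) less_imp_le in blast)+
  moreover have "simple_value K (\<tau> (Suc i)) \<in> borel_measurable (F (\<tau> i))" if "i < n" for i
    using \<tau>(3) sep that by (intro simple_value_measurable_filtration[OF K]) auto
  ultimately show ?thesis
    using discrete_lenglart[of \<tau> n "\<lambda>i. simple_value K (\<tau> (Suc i))" \<kappa> \<epsilon>] \<tau> uv pos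
    by (simp only: \<tau>)
qed

end

section \<open>Measurability and integrability of the energy of an approximation error\<close>

lemma simple_value_joint_measurable:
  assumes "elementary F K" "\<And>s (\<xi> :: 'a \<Rightarrow> real). \<xi> \<in> borel_measurable (F s) \<Longrightarrow> \<xi> \<in> borel_measurable M"
  shows "(\<lambda>x. simple_value K (snd x) (fst x)) \<in> borel_measurable (M \<Otimes>\<^sub>M borel)"
  using assms(1)
proof (induction K)
  case (Cons k K)
  obtain s t \<xi> where k: "k = (s, t, \<xi>)" by (cases k)
  have [measurable]: "\<xi> \<in> borel_measurable M" using Cons.prems by (intro assms(2)[of \<xi> s]) (simp add: k)
  have [measurable]: "(\<lambda>x. simple_value K (snd x) (fst x)) \<in> borel_measurable (M \<Otimes>\<^sub>M borel)"
    using Cons by (auto simp: k)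
  show ?case unfolding k simple_value_Cons by measurable
qed simp

text \<open>The definition of the Ito integral controls \<open>H\<close> only at times in
  \<open>{0..}\<close>. Composition with \<open>max 0\<close> extends it to the whole line, where
  the product with \<open>lborel\<close> is available.\<close>

lemma ito_integrand_joint_measurable:
  assumes "ito_integral M F W H X"
  shows "(\<lambda>x. H (max 0 (snd x)) (fst x)) \<in> borel_measurable (M \<Otimes>\<^sub>M borel)"
proof -
  have "(\<lambda>(t, \<omega>). H t \<omega>) \<in> borel_measurable (restrict_space borel {0..} \<Otimes>\<^sub>M M)"
    using assms by (simp add: ito_integral_def)
  moreover have "(\<lambda>x. (max 0 (snd x :: real), fst x)) \<in> measurable (M \<Otimes>\<^sub>M borel) (restrict_space borel {0..} \<Otimes>\<^sub>M M)"
  proof (intro measurable_Pair measurable_restrict_space2)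
    show "(\<lambda>x. max 0 (snd x :: real)) \<in> borel_measurable (M \<Otimes>\<^sub>M borel)" by measurable
  qed auto
  ultimately have "(\<lambda>(t, \<omega>). H t \<omega>) \<circ> (\<lambda>x. (max 0 (snd x), fst x)) \<in> borel_measurable (M \<Otimes>\<^sub>M borel)"
    by (rule measurable_comp[rotated])
  then show ?thesis by (simp add: comp_def)
qed

lemma ito_integrand_section_measurable:
  assumes "ito_integral M F W H X" "\<omega> \<in> space M"
  shows "(\<lambda>s. H (max 0 s) \<omega>) \<in> borel_measurable borel"
proof -
  have "(\<lambda>s. (\<omega>, s)) \<in> measurable borel (M \<Otimes>\<^sub>M borel)"
    using assms(2) by measurable
  from measurable_comp[OF this ito_integrand_joint_measurable[OF assms(1)]]
  show ?thesis by (simp add: comp_def)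
qed

lemma set_integral_measurable:
  fixes f :: "'a \<times> real \<Rightarrow> real"
  assumes [measurable]: "f \<in> borel_measurable (M \<Otimes>\<^sub>M borel)" "A \<in> sets borel"
  shows "(\<lambda>\<omega>. LINT s:A|lborel. f (\<omega>, s)) \<in> borel_measurable M"
proof -
  have "(\<lambda>(\<omega>, s). indicator A s *\<^sub>R f (\<omega>, s)) \<in> borel_measurable (M \<Otimes>\<^sub>M borel)"
    by measurable
  then have "(\<lambda>(\<omega>, s). indicator A s *\<^sub>R f (\<omega>, s)) \<in> borel_measurable (M \<Otimes>\<^sub>M lborel)"
    by (simp cong: measurable_cong_sets sets_pair_measure_cong)
  then show ?thesis
    unfolding set_lebesgue_integral_def by (rule lborel.borel_measurable_lebesgue_integral)
qed

lemma energy_measurable: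
  assumes ito: "ito_integral M F W H X" and K: "elementary F K"
    and sub: "\<And>s (\<xi> :: 'a \<Rightarrow> real). \<xi> \<in> borel_measurable (F s) \<Longrightarrow> \<xi> \<in> borel_measurable M" and "0 \<le> u"
  shows "(\<lambda>\<omega>. LINT s:{u..v}|lborel. (simple_value K s \<omega> - H s \<omega>)\<^sup>2) \<in> borel_measurable M"
proof -
  have "(\<lambda>x. (simple_value K (snd x) (fst x) - H (max 0 (snd x)) (fst x))\<^sup>2) \<in> borel_measurable (M \<Otimes>\<^sub>M borel)"
    by (intro borel_measurable_power borel_measurable_diff simple_value_joint_measurable[OF K sub]
        ito_integrand_joint_measurable[OF ito])
  from set_integral_measurable[OF this, of "{u..v}"]
  have "(\<lambda>\<omega>. LINT s:{u..v}|lborel. (simple_value K s \<omega> - H (max 0 s) \<omega>)\<^sup>2) \<in> borel_measurable M"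
    by simp
  moreover have "(LINT s:{u..v}|lborel. (simple_value K s \<omega> - H s \<omega>)\<^sup>2)
    = (LINT s:{u..v}|lborel. (simple_value K s \<omega> - H (max 0 s) \<omega>)\<^sup>2)" for \<omega>
    using \<open>0 \<le> u\<close> by (intro set_lebesgue_integral_cong) (auto simp: max_def)
  ultimately show ?thesis by simp
qed

lemma square_diff_le: "(x - y)\<^sup>2 \<le> 2 * x\<^sup>2 + 2 * (y::real)\<^sup>2"
  using zero_le_power2[of "x + y"] by (simp add: power2_sum power2_diff)

text \<open>The Bochner integral of a non-integrable function is 0, so a bound on the energy is
  informative only once integrability is known.\<close>

lemma energy_integrable:
  assumes ito: "ito_integral M F W H X" and "\<omega> \<in> space M" "0 \<le> u"
    and H: "set_integrable lborel {0..v} (\<lambda>s. (H s \<omega>)\<^sup>2)"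
  shows "set_integrable lborel {u..v} (\<lambda>s. (simple_value K s \<omega> - H s \<omega>)\<^sup>2)"
proof -
  have H': "set_integrable lborel {u..v} (\<lambda>s. (H s \<omega>)\<^sup>2)"
    using \<open>0 \<le> u\<close> by (intro set_integrable_subset[OF H]) auto
  have K: "(\<lambda>s. simple_value K s \<omega>) \<in> borel_measurable borel"
    unfolding simple_value_def
    by (induction K) auto
  note [measurable] = K ito_integrand_section_measurable[OF assms(1,2)]
  have "set_integrable lborel {u..v} (\<lambda>s. (simple_value K s \<omega> - H (max 0 s) \<omega>)\<^sup>2)"
    unfolding set_integrable_def
  proof (rule Bochner_Integration.integrable_bound)
    show "integrable lborel (\<lambda>s. 2 * (indicator {u..v} s *\<^sub>R (simple_value K s \<omega>)\<^sup>2) + 2 * (indicator {u..v} s *\<^sub>R (H s \<omega>)\<^sup>2))"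
      using simple_value_square_integrable[of u v K \<omega>] H' unfolding set_integrable_def
      by (intro Bochner_Integration.integrable_add integrable_mult_right)
    show "AE s in lborel. norm (indicator {u..v} s *\<^sub>R (simple_value K s \<omega> - H (max 0 s) \<omega>)\<^sup>2)
      \<le> norm (2 * (indicator {u..v} s *\<^sub>R (simple_value K s \<omega>)\<^sup>2) + 2 * (indicator {u..v} s *\<^sub>R (H s \<omega>)\<^sup>2))"
      using \<open>0 \<le> u\<close> square_diff_le by (intro AE_I2) (auto simp: indicator_def max_def)
  qed measurable
  also have "?this \<longleftrightarrow> ?thesis"
    using \<open>0 \<le> u\<close> by (intro set_integrable_cong) (auto simp: max_def)
  finally show ?thesis .
qed

context brownian
begin

lemma simple_integral_measurable:
  assumes "elementary F K" "0 \<le> t"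
  shows "simple_integral W K t \<in> borel_measurable M"
  using assms(1)
proof (induction K)
  case (Cons k K)
  obtain s u \<xi> where k: "k = (s, u, \<xi>)" by (cases k)
  have "\<xi> \<in> borel_measurable M" using Cons.prems by (auto simp: k intro: measurable_filtration)
  moreover have "simple_integral W K t \<in> borel_measurable M" using Cons by (auto simp: k)
  moreover have "W (min u t) \<in> borel_measurable M" "W (min s t) \<in> borel_measurable M"
    using assms(2) Cons.prems by (auto simp: k)
  ultimately have "(\<lambda>\<omega>. \<xi> \<omega> * (W (min u t) \<omega> - W (min s t) \<omega>) + simple_integral W K t \<omega>) \<in> borel_measurable M"
    by measurable
  then show ?case by (simp add: k)
qed (simp add: simple_integral_def[abs_def])

lemma ito_integral_measurable:
  assumes "ito_integral M F W H X" "0 \<le> t"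
  shows "X t \<in> borel_measurable M"
  using assms measurable_filtration unfolding ito_integral_def adapted_process_def by blast

text \<open>Splitting \<open>G - H\<close> at an approximating simple process \<open>K\<close> of the Ito integral reduces this to the
  inequality for elementary integrands.\<close>
lemma ito_estimate:
  assumes ito: "ito_integral M F W H X" and G: "elementary F G" and uv: "0 \<le> u" "u \<le> v"
    and pos: "0 < \<kappa>" "0 < \<epsilon>"
  shows "prob {\<omega>\<in>space M. \<bar>X v \<omega> - X u \<omega> - (simple_integral W G v \<omega> - simple_integral W G u \<omega>)\<bar> > 2 * \<epsilon>}
    \<le> prob {\<omega>\<in>space M. (LINT s:{u..v}|lborel. (simple_value G s \<omega> - H s \<omega>)\<^sup>2) > \<kappa>} + 4 * \<kappa> / \<epsilon>\<^sup>2"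
proof -
  obtain K where K: "\<And>n. simple_process F (K n)"
    and conv: "\<And>t. 0 \<le> t \<Longrightarrow> tendsto_in_probability M
             (\<lambda>n \<omega>. LINT s:{0..t}|lborel. (simple_value (K n) s \<omega> - H s \<omega>)\<^sup>2) (\<lambda>_. 0)"
      "\<And>t. 0 \<le> t \<Longrightarrow> tendsto_in_probability M (\<lambda>n. simple_integral W (K n) t) (X t)"
    using ito unfolding ito_integral_def by blast
  have elK: "elementary F (K n)" for n using K simple_process_elementary by blast
  have "0 \<le> v" using uv by simp
  have AE_int: "AE \<omega> in M. set_integrable lborel {0..v} (\<lambda>s. (H s \<omega>)\<^sup>2)"
  proof -
    have "AE \<omega> in M. \<forall>t\<ge>0. set_integrable lborel {0..t} (\<lambda>s. (H s \<omega>)\<^sup>2)"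
      using ito by (simp add: ito_integral_def)
    then show ?thesis by eventually_elim (use \<open>0 \<le> v\<close> in auto)
  qed
  define E where "E = {\<omega>\<in>space M. \<bar>X v \<omega> - X u \<omega> - (simple_integral W G v \<omega> - simple_integral W G u \<omega>)\<bar> > 2 * \<epsilon>}"
  define B where "B = {\<omega>\<in>space M. (LINT s:{u..v}|lborel. (simple_value G s \<omega> - H s \<omega>)\<^sup>2) > \<kappa>}"
  define C where "C n = {\<omega>\<in>space M. \<bar>(LINT s:{0..v}|lborel. (simple_value (K n) s \<omega> - H s \<omega>)\<^sup>2) - 0\<bar> > \<kappa>}" for n
  define D where "D n t = {\<omega>\<in>space M. \<bar>simple_integral W (K n) t \<omega> - X t \<omega>\<bar> > \<epsilon> / 2}" for n t
  define L where "L n = G @ simple_uminus (K n)" for n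
  \<comment> \<open>The energy of \<open>G - K n\<close> is at most twice that of
    \<open>G - H\<close> plus twice that of \<open>K n - H\<close>, hence the threshold
    \<open>4 * \<kappa>\<close>. The allowance \<open>2 * \<epsilon>\<close> splits into
    \<open>\<epsilon>\<close> for \<open>L n\<close> and \<open>\<epsilon> / 2\<close> for the
    approximation of \<open>X\<close> at each end.\<close>
  define A where "A n = {\<omega>\<in>space M. \<bar>simple_integral W (L n) v \<omega> - simple_integral W (L n) u \<omega>\<bar> > \<epsilon> \<and>
      (LINT x:{u..v}|lborel. (simple_value (L n) x \<omega>)\<^sup>2) \<le> 4 * \<kappa>}" for n
  have elL: "elementary F (L n)" for n
    unfolding L_def using G elK elementary_uminus by auto
  have Lval: "simple_value (L n) s \<omega> = simple_value G s \<omega> - simple_value (K n) s \<omega>" for n s \<omega>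
    by (simp add: L_def simple_value_append simple_value_uminus)
  have Lint: "simple_integral W (L n) s \<omega> = simple_integral W G s \<omega> - simple_integral W (K n) s \<omega>" for n s \<omega>
    by (simp add: L_def simple_integral_append simple_integral_uminus)
  have A_le: "prob (A n) \<le> 4 * \<kappa> / \<epsilon>\<^sup>2" for n
    unfolding A_def using simple_lenglart[OF elL uv, of "4 * \<kappa>" \<epsilon> n] pos by simp
  have B_ev: "B \<in> events"
  proof -
    note [measurable] = energy_measurable[OF ito G measurable_filtration uv(1)]
    show ?thesis unfolding B_def by measurable
  qed
  have C_ev: "C n \<in> events" for n
  proof -
    note [measurable] = energy_measurable[OF ito elK measurable_filtration order_refl]
    show ?thesis unfolding C_def by measurable
  qed
  have D_ev: "D n t \<in> events" if "0 \<le> t" for n t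
  proof -
    note [measurable] = simple_integral_measurable[OF elK that] ito_integral_measurable[OF ito that]
    show ?thesis unfolding D_def by measurable
  qed
  have A_ev: "A n \<in> events" for n
  proof -
    have "0 \<le> v" using uv by simp
    note [measurable] = simple_integral_measurable[OF elL \<open>0 \<le> v\<close>] simple_integral_measurable[OF elL uv(1)]
      simple_value_joint_measurable[OF elL measurable_filtration]
    have "(\<lambda>x. (simple_value (L n) (snd x) (fst x))\<^sup>2) \<in> borel_measurable (M \<Otimes>\<^sub>M borel)" by measurable
    from set_integral_measurable[OF this, of "{u..v}"]
    have [measurable]: "(\<lambda>\<omega>. LINT s:{u..v}|lborel. (simple_value (L n) s \<omega>)\<^sup>2) \<in> borel_measurable M" by simp
    show ?thesis unfolding A_def by measurable
  qed
  have bound: "prob E \<le> prob B + 4 * \<kappa> / \<epsilon>\<^sup>2 + (prob (C n) + prob (D n v) + prob (D n u))" for n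
  proof -
    have "AE \<omega> in M. \<omega> \<in> E \<longrightarrow> \<omega> \<in> A n \<union> B \<union> C n \<union> D n v \<union> D n u"
      using AE_int AE_space
    proof eventually_elim
      case (elim \<omega>)
      show ?case
      proof (rule impI, rule ccontr)
        assume E: "\<omega> \<in> E" and not: "\<omega> \<notin> A n \<union> B \<union> C n \<union> D n v \<union> D n u"
        let ?g = "\<lambda>s. (simple_value G s \<omega> - H s \<omega>)\<^sup>2" and ?k = "\<lambda>s. (simple_value (K n) s \<omega> - H s \<omega>)\<^sup>2"
        have int: "set_integrable lborel {u..v} ?g" "set_integrable lborel {u..v} ?k" "set_integrable lborel {0..v} ?k"
          using energy_integrable[OF ito elim(2) uv(1) elim(1)] energy_integrable[OF ito elim(2) order_refl elim(1)] by auto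
        have "(LINT s:{u..v}|lborel. (simple_value (L n) s \<omega>)\<^sup>2) \<le> (LINT s:{u..v}|lborel. 2 * ?g s + 2 * ?k s)"
        proof (rule set_integral_mono)
          show "set_integrable lborel {u..v} (\<lambda>s. (simple_value (L n) s \<omega>)\<^sup>2)"
            by (rule simple_value_square_integrable)
          show "set_integrable lborel {u..v} (\<lambda>s. 2 * ?g s + 2 * ?k s)"
            using int by (intro set_integral_add set_integrable_mult_right) auto
          fix s assume "s \<in> {u..v}"
          show "(simple_value (L n) s \<omega>)\<^sup>2 \<le> 2 * ?g s + 2 * ?k s"
            using square_diff_le[of "simple_value G s \<omega> - H s \<omega>" "simple_value (K n) s \<omega> - H s \<omega>"] by (simp add: Lval)
        qed
        also have "\<dots> = 2 * (LINT s:{u..v}|lborel. ?g s) + 2 * (LINT s:{u..v}|lborel. ?k s)"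
          using int by (simp add: set_integral_add set_integrable_mult_right)
        \<comment> \<open>The energies of the approximating processes are known to converge only on
          intervals that start at 0.\<close>
        also have "(LINT s:{u..v}|lborel. ?k s) \<le> (LINT s:{0..v}|lborel. ?k s)"
          using int uv unfolding set_integrable_def set_lebesgue_integral_def
          by (intro integral_mono) (auto simp: indicator_def)
        also have "(LINT s:{u..v}|lborel. ?g s) \<le> \<kappa>" using not elim by (simp add: B_def)
        also have "(LINT s:{0..v}|lborel. ?k s) \<le> \<kappa>" using not elim by (auto simp: C_def not_less abs_le_iff)
        finally have "(LINT s:{u..v}|lborel. (simple_value (L n) s \<omega>)\<^sup>2) \<le> 4 * \<kappa>" by simp
        then have "\<bar>simple_integral W (L n) v \<omega> - simple_integral W (L n) u \<omega>\<bar> \<le> \<epsilon>"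
          using not elim by (auto simp: A_def)
        moreover have "\<bar>simple_integral W (K n) v \<omega> - X v \<omega>\<bar> \<le> \<epsilon> / 2" "\<bar>simple_integral W (K n) u \<omega> - X u \<omega>\<bar> \<le> \<epsilon> / 2"
          using not elim by (auto simp: D_def)
        ultimately have "\<bar>X v \<omega> - X u \<omega> - (simple_integral W G v \<omega> - simple_integral W G u \<omega>)\<bar> \<le> 2 * \<epsilon>"
          unfolding Lint by linarith
        then show False using E by (simp add: E_def)
      qed
    qed
    then have "prob E \<le> prob (A n \<union> B \<union> C n \<union> D n v \<union> D n u)"
      using A_ev B_ev C_ev D_ev[OF uv(1)] D_ev[OF \<open>0 \<le> v\<close>] by (intro finite_measure_mono_AE) auto
    also have "\<dots> \<le> prob (A n) + prob B + prob (C n) + prob (D n v) + prob (D n u)"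
      using A_ev[of n] B_ev C_ev[of n] D_ev[OF uv(1), of n] D_ev[OF \<open>0 \<le> v\<close>, of n]
      by (intro order_trans[OF measure_Un_le] add_mono order_refl) auto
    also have "\<dots> \<le> prob B + 4 * \<kappa> / \<epsilon>\<^sup>2 + (prob (C n) + prob (D n v) + prob (D n u))"
      using A_le[of n] by simp
    finally show ?thesis .
  qed
  have "(\<lambda>n. prob (C n)) \<longlonglongrightarrow> 0"
    using conv(1)[OF \<open>0 \<le> v\<close>] pos unfolding tendsto_in_probability_def C_def by blast
  moreover have "(\<lambda>n. prob (D n t)) \<longlonglongrightarrow> 0" if "0 \<le> t" for t
    using conv(2)[OF that] pos half_gt_zero[of \<epsilon>] unfolding tendsto_in_probability_def D_def by blast
  ultimately have "(\<lambda>n. prob B + 4 * \<kappa> / \<epsilon>\<^sup>2 + (prob (C n) + prob (D n v) + prob (D n u))) \<longlonglongrightarrow> prob B + 4 * \<kappa> / \<epsilon>\<^sup>2 + (0 + 0 + 0)"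
    using uv by (intro tendsto_intros) auto
  then have "prob E \<le> prob B + 4 * \<kappa> / \<epsilon>\<^sup>2 + (0 + 0 + 0)"
    by (rule LIMSEQ_le_const) (use bound in auto)
  then show ?thesis by (simp add: E_def B_def)
qed

end

section \<open>Absence of atoms\<close>

context brownian
begin

text \<open>Dominated convergence of the indicators. It turns pathwise arguments, where continuity
  can be used, into statements on probabilities.\<close>

lemma prob_tendsto_0:
  assumes "\<And>n. A n \<in> events" "AE \<omega> in M. \<forall>\<^sub>F n in sequentially. \<omega> \<notin> A n"
  shows "(\<lambda>n. prob (A n)) \<longlonglongrightarrow> 0"
proof -
  have "(\<lambda>n. expectation (indicator (A n) :: 'a \<Rightarrow> real)) \<longlonglongrightarrow> expectation (\<lambda>_. 0)"
  proof (rule integral_dominated_convergence[where w="\<lambda>_. 1"])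
    show "AE \<omega> in M. (\<lambda>n. indicator (A n) \<omega> :: real) \<longlonglongrightarrow> 0"
      using assms(2)
    proof eventually_elim
      case (elim \<omega>)
      then have "\<forall>\<^sub>F n in sequentially. (indicator (A n) \<omega> :: real) = 0"
        by eventually_elim simp
      then show ?case by (rule tendsto_eventually)
    qed
  qed (use assms(1) in \<open>auto simp: indicator_def\<close>)
  then show ?thesis using assms(1) by simp
qed

text \<open>Given \<open>Y\<close>, the event asks the Gaussian increment to lie in an interval of
  length \<open>2 * \<rho>\<close>, and its density is at most
  \<open>1 / (2 * sqrt (t - s))\<close>.\<close>

lemma increment_anticoncentration:
  assumes st: "0 \<le> s" "s < t" and Y: "Y \<in> borel_measurable (F s)" and "0 \<le> \<rho>"
  shows "prob {\<omega>\<in>space M. \<bar>W t \<omega> - W s \<omega> + Y \<omega>\<bar> \<le> \<rho>} \<le> \<rho> / sqrt (t - s)"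
proof -
  let ?D = "\<lambda>\<omega>. W t \<omega> - W s \<omega>"
  have [measurable]: "Y \<in> borel_measurable M" "?D \<in> borel_measurable M"
    using measurable_filtration[OF Y] increment_measurable[of s t] st by auto
  have D: "distributed M lborel ?D (\<lambda>x. ennreal (normal_density 0 (sqrt (t - s)) x))"
    using wiener st by (simp add: wiener_process_def)
  have dens: "normal_density 0 (sqrt (t - s)) x \<le> 1 / (2 * sqrt (t - s))" for x
  proof -
    \<comment> \<open>Since \<open>2 * pi \<ge> 4\<close>, the factor \<open>sqrt (2 * pi)\<close>
      can be traded for 2, which later cancels against the length \<open>2 * \<rho>\<close>.\<close>
    have "2 * sqrt (t - s) \<le> sqrt (2 * pi * (t - s))"
      using mult_right_mono[OF pi_ge_two, of "2 * (t - s)"] st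
      by (intro real_le_rsqrt) (simp add: power_mult_distrib algebra_simps)
    then have "1 / sqrt (2 * pi * (t - s)) \<le> 1 / (2 * sqrt (t - s))"
      using st by (intro divide_left_mono) auto
    moreover have "normal_density 0 (sqrt (t - s)) x \<le> 1 / sqrt (2 * pi * (t - s))"
      using st by (simp add: normal_density_def divide_right_mono)
    ultimately show ?thesis by simp
  qed
  have ball: "emeasure (distr M borel ?D) {-y - \<rho>..-y + \<rho>} \<le> ennreal (\<rho> / sqrt (t - s))" for y
  proof -
    have "emeasure (distr M borel ?D) {-y - \<rho>..-y + \<rho>} = emeasure (distr M lborel ?D) {-y - \<rho>..-y + \<rho>}"
      by (simp cong: distr_cong)
    also have "\<dots> = (\<integral>\<^sup>+x. ennreal (normal_density 0 (sqrt (t - s)) x) * indicator {-y - \<rho>..-y + \<rho>} x \<partial>lborel)"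
      unfolding distributed_distr_eq_density[OF D] by (simp add: emeasure_density)
    also have "\<dots> \<le> (\<integral>\<^sup>+x. ennreal (1 / (2 * sqrt (t - s))) * indicator {-y - \<rho>..-y + \<rho>} x \<partial>lborel)"
      using dens by (intro nn_integral_mono mult_right_mono ennreal_leI) auto
    also have "\<dots> = ennreal (1 / (2 * sqrt (t - s))) * ennreal (2 * \<rho>)"
      using \<open>0 \<le> \<rho>\<close> by (simp add: nn_integral_cmult_indicator)
    also have "\<dots> = ennreal (\<rho> / sqrt (t - s))"
      using \<open>0 \<le> \<rho>\<close> st by (simp add: ennreal_mult[symmetric])
    finally show ?thesis .
  qed
  have indep: "distr M borel Y \<Otimes>\<^sub>M distr M borel ?D = distr M (borel \<Otimes>\<^sub>M borel) (\<lambda>x. (Y x, ?D x))"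
    using indep_var_filtration_increment[OF st Y] by (simp add: indep_var_distribution_eq)
  interpret dD: prob_space "distr M borel ?D" by (rule prob_space_distr) measurable
  interpret dY: prob_space "distr M borel Y" by (rule prob_space_distr) measurable
  let ?S = "{p :: real \<times> real. \<bar>snd p + fst p\<bar> \<le> \<rho>}"
  have "{p \<in> space (borel \<Otimes>\<^sub>M borel). \<bar>snd p + fst p\<bar> \<le> \<rho>} \<in> sets (borel \<Otimes>\<^sub>M borel)"
    by measurable
  then have S: "?S \<in> sets (borel \<Otimes>\<^sub>M borel)" by (simp add: space_pair_measure)
  have "emeasure M {\<omega>\<in>space M. \<bar>?D \<omega> + Y \<omega>\<bar> \<le> \<rho>} = emeasure (distr M (borel \<Otimes>\<^sub>M borel) (\<lambda>x. (Y x, ?D x))) ?S"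
    using S by (subst emeasure_distr) (auto intro!: arg_cong[where f="emeasure M"])
  also have "\<dots> = emeasure (distr M borel Y \<Otimes>\<^sub>M distr M borel ?D) ?S" by (simp add: indep)
  \<comment> \<open>Fubini over the law of \<open>Y\<close>: each slice is an interval centred at
    \<open>-y\<close>, and its bound is uniform in \<open>y\<close>.\<close>
  also have "\<dots> = (\<integral>\<^sup>+y. emeasure (distr M borel ?D) (Pair y -` ?S) \<partial>distr M borel Y)"
    using S by (intro dD.emeasure_pair_measure_alt) (simp cong: sets_pair_measure_cong)
  also have "\<dots> \<le> (\<integral>\<^sup>+y. ennreal (\<rho> / sqrt (t - s)) \<partial>distr M borel Y)"
  proof (rule nn_integral_mono)
    fix y :: real
    have "Pair y -` ?S = {-y - \<rho>..-y + \<rho>}" by auto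
    then show "emeasure (distr M borel ?D) (Pair y -` ?S) \<le> ennreal (\<rho> / sqrt (t - s))" using ball by simp
  qed
  also have "\<dots> = ennreal (\<rho> / sqrt (t - s))" using dY.emeasure_space_1 by simp
  finally show ?thesis
    using \<open>0 \<le> \<rho>\<close> st by (simp add: emeasure_eq_measure)
qed

text \<open>Over a short interval \<open>[u,t]\<close> the solution is \<open>r u + H u (W t - W u)\<close> up to an error that is
  \<open>o(sqrt (t - u))\<close> in probability, and the Gaussian increment spreads mass at the scale \<open>sqrt (t - u)\<close>.\<close>
lemma no_atom:
  assumes ito: "ito_integral M F W H X" and adapted: "adapted_process F r"
    and cont: "AE \<omega> in M. continuous_on {0..} (\<lambda>s. H s \<omega>)"
    and drift: "AE \<omega> in M. \<exists>C. \<forall>s\<in>{0..t}. \<bar>(r t \<omega> - X t \<omega>) - (r s \<omega> - X s \<omega>)\<bar> \<le> C * (t - s)"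
    and nondeg: "AE \<omega> in M. r t \<omega> = x \<longrightarrow> c < H t \<omega>"
    and "0 < t" "0 < c"
  shows "AE \<omega> in M. r t \<omega> \<noteq> x"
proof -
  define \<delta> where "\<delta> j = t / real (Suc j)" for j
  define u where "u j = t - \<delta> j" for j
  have \<delta>: "0 < \<delta> j" "\<delta> j \<le> t" for j
    using \<open>0 < t\<close> by (auto simp: \<delta>_def field_simps)
  have u: "0 \<le> u j" "u j < t" for j using \<delta>[of j] by (auto simp: u_def)
  have \<delta>0: "\<delta> \<longlonglongrightarrow> 0"
    unfolding \<delta>_def using LIMSEQ_Suc[OF lim_const_over_n[of t]] by simp
  have u_lim: "u \<longlonglongrightarrow> t" unfolding u_def using tendsto_diff[OF tendsto_const \<delta>0, of t] by simp
  have H_adapted: "H s \<in> borel_measurable (F s)" if "0 \<le> s" for s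
    using ito that by (simp add: ito_integral_def adapted_process_def)
  have rF: "r s \<in> borel_measurable (F s)" if "0 \<le> s" for s
    using adapted that by (simp add: adapted_process_def)
  have [measurable]: "r t \<in> borel_measurable M" "X t \<in> borel_measurable M"
    "r (u j) \<in> borel_measurable M" "X (u j) \<in> borel_measurable M" "H (u j) \<in> borel_measurable M" for j
    using \<open>0 < t\<close> u[of j] ito_integral_measurable[OF ito] measurable_filtration[OF H_adapted] measurable_filtration[OF rF] by auto
  define E where "E = {\<omega>\<in>space M. r t \<omega> = x}"
  have E_ev: "E \<in> events" unfolding E_def by measurable
  have main: "prob E \<le> \<eta> * (4 + 3 / c)" if "0 < \<eta>" for \<eta>
  proof -
    \<comment> \<open>The allowance is a small multiple of the Gaussian scale. With the energy
      threshold \<open>\<eta> ^ 3 * \<delta> j\<close> in \<open>A'\<close>, the quotient in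
      \<open>ito_estimate\<close> becomes \<open>4 * \<eta>\<close>.\<close>
    define \<epsilon> where "\<epsilon> j = \<eta> * sqrt (\<delta> j)" for j
    have \<epsilon>: "0 < \<epsilon> j" for j unfolding \<epsilon>_def by (intro mult_pos_pos \<open>0 < \<eta>\<close>) (simp add: \<delta>)
    define G where "G j = [(u j, t, H (u j))]" for j
    have elG: "elementary F (G j)" for j using u[of j] H_adapted[of "u j"] by (simp add: G_def)
    define A where "A j = {\<omega>\<in>space M. \<bar>X t \<omega> - X (u j) \<omega> - (simple_integral W (G j) t \<omega> - simple_integral W (G j) (u j) \<omega>)\<bar> > 2 * \<epsilon> j}" for j
    define A' where "A' j = {\<omega>\<in>space M. (LINT s:{u j..t}|lborel. (simple_value (G j) s \<omega> - H s \<omega>)\<^sup>2) > \<eta> ^ 3 * \<delta> j}" for j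
    define B where "B j = {\<omega>\<in>space M. \<bar>(r t \<omega> - X t \<omega>) - (r (u j) \<omega> - X (u j) \<omega>)\<bar> > \<epsilon> j}" for j
    define C where "C j = {\<omega>\<in>space M. r t \<omega> = x \<and> H (u j) \<omega> \<le> c}" for j
    \<comment> \<open>Dividing by the slope leaves the increment with coefficient 1, as
      \<open>increment_anticoncentration\<close> requires. The default 0 occurs only for a slope of
      at most \<open>c\<close>, a case that \<open>C j\<close> covers on \<open>E\<close>.\<close>
    define Y where "Y j \<omega> = (if c < H (u j) \<omega> then (r (u j) \<omega> - x) / H (u j) \<omega> else 0)" for j \<omega>
    define D where "D j = {\<omega>\<in>space M. \<bar>W t \<omega> - W (u j) \<omega> + Y j \<omega>\<bar> \<le> 3 * \<epsilon> j / c}" for j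
    have Gint: "simple_integral W (G j) t \<omega> - simple_integral W (G j) (u j) \<omega> = H (u j) \<omega> * (W t \<omega> - W (u j) \<omega>)" for j \<omega>
      using u[of j] by (simp add: G_def)
    have YF: "Y j \<in> borel_measurable (F (u j))" for j
    proof -
      note [measurable] = H_adapted[OF u(1)[of j]] rF[OF u(1)[of j]]
      show ?thesis unfolding Y_def by measurable
    qed
    have ev: "A j \<in> events" "A' j \<in> events" "B j \<in> events" "C j \<in> events" "D j \<in> events" for j
    proof -
      note [measurable] = measurable_filtration[OF YF[of j]] increment_measurable[OF u(1)[of j] less_imp_le[OF u(2)[of j]]]
      show "A j \<in> events" unfolding A_def Gint by measurable
      show "B j \<in> events" unfolding B_def by measurable
      show "C j \<in> events" unfolding C_def by measurable
      show "D j \<in> events" unfolding D_def by measurable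
      have "(\<lambda>\<omega>. LINT s:{u j..t}|lborel. (simple_value (G j) s \<omega> - H s \<omega>)\<^sup>2) \<in> borel_measurable M"
        by (rule energy_measurable[OF ito elG measurable_filtration u(1)])
      then show "A' j \<in> events" unfolding A'_def by measurable
    qed
    have pA: "prob (A j) \<le> prob (A' j) + 4 * \<eta>" for j
    proof -
      have "4 * (\<eta> ^ 3 * \<delta> j) / (\<epsilon> j)\<^sup>2 = 4 * \<eta>"
        using \<delta>[of j] \<open>0 < \<eta>\<close> by (simp add: \<epsilon>_def power_mult_distrib field_simps power3_eq_cube power2_eq_square)
      moreover have "0 < \<eta> ^ 3 * \<delta> j" using \<delta>[of j] \<open>0 < \<eta>\<close> by simp
      ultimately show ?thesis
        using ito_estimate[OF ito elG[of j] u(1)[of j] less_imp_le[OF u(2)[of j]] _ \<epsilon>[of j], of "\<eta> ^ 3 * \<delta> j"]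
        unfolding A_def A'_def by simp
    qed
    have pD: "prob (D j) \<le> 3 * \<eta> / c" for j
    proof -
      have "prob (D j) \<le> 3 * \<epsilon> j / c / sqrt (t - u j)"
        unfolding D_def using \<epsilon>[of j] \<open>0 < c\<close> by (intro increment_anticoncentration u YF) simp
      also have "\<dots> = 3 * \<eta> / c" using \<delta>[of j] by (simp add: \<epsilon>_def u_def)
      finally show ?thesis .
    qed
    have bound: "prob E \<le> 4 * \<eta> + 3 * \<eta> / c + (prob (A' j) + prob (B j) + prob (C j))" for j
    proof -
      \<comment> \<open>Outside \<open>A j\<close> and \<open>B j\<close> the errors add up to
        \<open>2 * \<epsilon> j + \<epsilon> j\<close>; outside \<open>C j\<close> the slope exceeds
        \<open>c\<close> on \<open>E\<close>, so division leaves the radius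
        \<open>3 * \<epsilon> j / c\<close> of \<open>D j\<close>.\<close>
      have "E \<subseteq> A j \<union> B j \<union> C j \<union> D j"
      proof (rule subsetI, rule ccontr)
        fix \<omega> assume E: "\<omega> \<in> E" and not: "\<omega> \<notin> A j \<union> B j \<union> C j \<union> D j"
        have \<omega>: "\<omega> \<in> space M" "r t \<omega> = x" using E by (auto simp: E_def)
        have h: "c < H (u j) \<omega>" using not \<omega> by (auto simp: C_def)
        have "\<bar>X t \<omega> - X (u j) \<omega> - H (u j) \<omega> * (W t \<omega> - W (u j) \<omega>)\<bar> \<le> 2 * \<epsilon> j"
          using not \<omega> by (auto simp: A_def Gint)
        moreover have "\<bar>(r t \<omega> - X t \<omega>) - (r (u j) \<omega> - X (u j) \<omega>)\<bar> \<le> \<epsilon> j"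
          using not \<omega> by (auto simp: B_def)
        ultimately have "\<bar>H (u j) \<omega> * (W t \<omega> - W (u j) \<omega>) + (r (u j) \<omega> - x)\<bar> \<le> 3 * \<epsilon> j"
          using \<omega>(2) by linarith
        moreover have "H (u j) \<omega> * (W t \<omega> - W (u j) \<omega>) + (r (u j) \<omega> - x) = H (u j) \<omega> * (W t \<omega> - W (u j) \<omega> + Y j \<omega>)"
          using h \<open>0 < c\<close> by (simp add: Y_def field_simps)
        ultimately have "H (u j) \<omega> * \<bar>W t \<omega> - W (u j) \<omega> + Y j \<omega>\<bar> \<le> 3 * \<epsilon> j"
          using h \<open>0 < c\<close> by (simp add: abs_mult)
        moreover have "c * \<bar>W t \<omega> - W (u j) \<omega> + Y j \<omega>\<bar> \<le> H (u j) \<omega> * \<bar>W t \<omega> - W (u j) \<omega> + Y j \<omega>\<bar>"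
          using h by (intro mult_right_mono) auto
        ultimately have "\<bar>W t \<omega> - W (u j) \<omega> + Y j \<omega>\<bar> \<le> 3 * \<epsilon> j / c"
          using \<open>0 < c\<close> by (simp add: field_simps)
        then show False using not \<omega> by (auto simp: D_def)
      qed
      then have "prob E \<le> prob (A j \<union> B j \<union> C j \<union> D j)"
        using ev[of j] by (intro finite_measure_mono) auto
      also have "\<dots> \<le> prob (A j) + prob (B j) + prob (C j) + prob (D j)"
        using ev[of j] by (intro order_trans[OF measure_Un_le] add_mono order_refl) auto
      finally show ?thesis using pA[of j] pD[of j] by linarith
    qed
    have "(\<lambda>j. prob (A' j)) \<longlonglongrightarrow> 0"
    proof (rule prob_tendsto_0[OF ev(2)])
      have "AE \<omega> in M. set_integrable lborel {0..t} (\<lambda>s. (H s \<omega>)\<^sup>2)"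
        using ito \<open>0 < t\<close> unfolding ito_integral_def by (auto elim!: AE_mp)
      with cont AE_space show "AE \<omega> in M. \<forall>\<^sub>F j in sequentially. \<omega> \<notin> A' j"
      proof eventually_elim
        case (elim \<omega>)
        \<comment> \<open>\<open>H (u j)\<close> and \<open>H s\<close> are both within
          \<open>e\<close> of \<open>H t\<close>, so their squared gap is at most
          \<open>(2 * e)\<^sup>2\<close>, which is the threshold \<open>\<eta> ^ 3\<close>.\<close>
        define e where "e = sqrt (\<eta> ^ 3) / 2"
        have "0 < e" using \<open>0 < \<eta>\<close> by (simp add: e_def)
        then obtain d where d: "0 < d" "\<And>s. 0 \<le> s \<Longrightarrow> dist s t < d \<Longrightarrow> dist (H s \<omega>) (H t \<omega>) < e"
          using elim(1) \<open>0 < t\<close> unfolding continuous_on_iff by (metis atLeast_iff less_imp_le)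
        have "\<forall>\<^sub>F j in sequentially. dist (u j) t < d" using u_lim d(1) by (rule tendstoD)
        then show ?case
        proof eventually_elim
          case (elim j)
          have close: "(H (u j) \<omega> - H s \<omega>)\<^sup>2 \<le> \<eta> ^ 3" if "u j \<le> s" "s \<le> t" for s
          proof -
            have "dist s t < d" using elim that u[of j] by (simp add: dist_real_def)
            with d(2)[of s] d(2)[of "u j"] elim u[of j] that
            have "\<bar>H (u j) \<omega> - H s \<omega>\<bar> \<le> 2 * e" by (simp add: dist_real_def)
            then have "(H (u j) \<omega> - H s \<omega>)\<^sup>2 \<le> (2 * e)\<^sup>2"
              by (rule abs_le_square_iff[THEN iffD1, OF order_trans]) simp
            also have "\<dots> = \<eta> ^ 3" using \<open>0 < \<eta>\<close> by (simp add: e_def)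
            finally show ?thesis .
          qed
          have int: "set_integrable lborel {u j..t} (\<lambda>s. (simple_value (G j) s \<omega> - H s \<omega>)\<^sup>2)"
            using energy_integrable[OF ito _ u(1)] \<open>\<omega> \<in> space M\<close> \<open>set_integrable lborel {0..t} (\<lambda>s. (H s \<omega>)\<^sup>2)\<close> by blast
          have "(LINT s:{u j..t}|lborel. (simple_value (G j) s \<omega> - H s \<omega>)\<^sup>2) \<le> (LINT s:{u j..t}|lborel. \<eta> ^ 3)"
            unfolding set_lebesgue_integral_def
          proof (rule integral_mono_AE)
            \<comment> \<open>The interval of \<open>G j\<close> is left-open, so its value at
              \<open>u j\<close> is 0 instead of \<open>H (u j)\<close>; this one point is
              discarded.\<close>
            show "AE s in lborel. indicator {u j..t} s *\<^sub>R (simple_value (G j) s \<omega> - H s \<omega>)\<^sup>2 \<le> indicator {u j..t} s *\<^sub>R \<eta> ^ 3"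
              using AE_lborel_singleton[of "u j"]
            proof eventually_elim
              case (elim s)
              then show ?case using close[of s] by (auto simp: G_def indicator_def)
            qed
          qed (use int in \<open>auto simp: set_integrable_def emeasure_lborel_Icc_eq\<close>)
          also have "\<dots> = \<eta> ^ 3 * \<delta> j" using u[of j] by (simp add: set_integral_const u_def)
          finally show ?case by (simp add: A'_def)
        qed
      qed
    qed
    moreover have "(\<lambda>j. prob (B j)) \<longlonglongrightarrow> 0"
    proof (rule prob_tendsto_0[OF ev(3)])
      show "AE \<omega> in M. \<forall>\<^sub>F j in sequentially. \<omega> \<notin> B j"
        using drift
      proof eventually_elim
        case (elim \<omega>)
        then obtain C where C: "\<And>s. s \<in> {0..t} \<Longrightarrow> \<bar>(r t \<omega> - X t \<omega>) - (r s \<omega> - X s \<omega>)\<bar> \<le> C * (t - s)" by blast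
        \<comment> \<open>The drift moves by at most \<open>C * \<delta> j\<close>. After division
          by the Gaussian scale a factor \<open>sqrt (\<delta> j)\<close> remains to beat
          \<open>C\<close>, which depends on the path.\<close>
        have "(\<lambda>j. C * sqrt (\<delta> j)) \<longlonglongrightarrow> C * sqrt 0" by (intro tendsto_intros \<delta>0)
        then have "\<forall>\<^sub>F j in sequentially. C * sqrt (\<delta> j) < \<eta>"
          using order_tendstoD(2)[of _ "C * sqrt 0" _ \<eta>] \<open>0 < \<eta>\<close> by simp
        then show ?case
        proof eventually_elim
          case (elim j)
          have "\<bar>(r t \<omega> - X t \<omega>) - (r (u j) \<omega> - X (u j) \<omega>)\<bar> \<le> C * (t - u j)"
            using C[of "u j"] u[of j] by simp
          also have "\<dots> = C * sqrt (\<delta> j) * sqrt (\<delta> j)" using \<delta>[of j] by (simp add: u_def)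
          also have "\<dots> \<le> \<epsilon> j" unfolding \<epsilon>_def using elim \<delta>[of j] by (intro mult_right_mono) auto
          finally show ?case by (simp add: B_def)
        qed
      qed
    qed
    moreover have "(\<lambda>j. prob (C j)) \<longlonglongrightarrow> 0"
    proof (rule prob_tendsto_0[OF ev(4)])
      show "AE \<omega> in M. \<forall>\<^sub>F j in sequentially. \<omega> \<notin> C j"
        using nondeg cont
      proof eventually_elim
        case (elim \<omega>)
        show ?case
        proof (cases "r t \<omega> = x")
          case True
          have "(\<lambda>j. H (u j) \<omega>) \<longlonglongrightarrow> H t \<omega>"
            using continuous_on_tendsto_compose[OF elim(2) u_lim] u \<open>0 < t\<close> by simp
          then have "\<forall>\<^sub>F j in sequentially. c < H (u j) \<omega>" using True elim(1) by (auto dest: order_tendstoD)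
          then show ?thesis by eventually_elim (auto simp: C_def)
        qed (simp add: C_def)
      qed
    qed
    ultimately have "(\<lambda>j. 4 * \<eta> + 3 * \<eta> / c + (prob (A' j) + prob (B j) + prob (C j))) \<longlonglongrightarrow> 4 * \<eta> + 3 * \<eta> / c + (0 + 0 + 0)"
      by (intro tendsto_intros)
    then have "prob E \<le> 4 * \<eta> + 3 * \<eta> / c + (0 + 0 + 0)"
      by (rule LIMSEQ_le_const) (use bound in auto)
    then show ?thesis by (simp add: algebra_simps)
  qed
  have "prob E \<le> 0"
  proof (rule field_le_epsilon)
    fix e :: real assume "0 < e"
    have "0 < 4 + 3 / c" using \<open>0 < c\<close> by (simp add: add_pos_pos)
    with main[of "e / (4 + 3 / c)"] \<open>0 < e\<close> show "prob E \<le> 0 + e" by simp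
  qed
  then have "prob E = 0" using measure_nonneg[of M E] by linarith
  then have "E \<in> null_sets M" using E_ev by (simp add: emeasure_eq_measure null_setsI)
  then show ?thesis by (rule AE_I'[of E]) (auto simp: E_def)
qed

end

section \<open>Quadratic variation of the Ito integral\<close>

lemma bounded_times_square_integrable:
  fixes f g :: "'a \<Rightarrow> real"
  assumes "f \<in> borel_measurable M" "g \<in> borel_measurable M" "integrable M (\<lambda>x. (f x)\<^sup>2)"
    and "\<And>x. x \<in> space M \<Longrightarrow> \<bar>g x\<bar> \<le> C"
  shows "integrable M (\<lambda>x. (g x * f x)\<^sup>2)"
proof (rule Bochner_Integration.integrable_bound)
  show "integrable M (\<lambda>x. C\<^sup>2 * (f x)\<^sup>2)" using assms by simp
  have "(g x * f x)\<^sup>2 \<le> C\<^sup>2 * (f x)\<^sup>2" if "x \<in> space M" for x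
    using power_mono[OF assms(4)[OF that] abs_ge_zero, of 2] by (simp add: power_mult_distrib mult_right_mono)
  then show "AE x in M. norm ((g x * f x)\<^sup>2) \<le> norm (C\<^sup>2 * (f x)\<^sup>2)" by (intro AE_I2) simp
qed (use assms in measurable)

context brownian
begin

lemma square_integrable_bounded:
  fixes f :: "'a \<Rightarrow> real"
  assumes "f \<in> borel_measurable M" "\<And>x. x \<in> space M \<Longrightarrow> \<bar>f x\<bar> \<le> C"
  shows "integrable M (\<lambda>x. (f x)\<^sup>2)"
  using bounded_times_square_integrable[of "\<lambda>_. 1" M f C] assms by simp

text \<open>The added term is the martingale difference \<open>Z\<^sup>2 ((W t - W s)\<^sup>2 - (t - s)) + 2 S Z (W t - W s)\<close>.  The
  constant 4 is not optimal, but with it the bounds telescope in \<open>block_variation\<close>.\<close>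
lemma variation_step:
  assumes st: "0 \<le> s" "s \<le> t"
    and Y: "Y \<in> borel_measurable (F s)" "integrable M (\<lambda>\<omega>. (Y \<omega>)\<^sup>2)"
    and Z: "Z \<in> borel_measurable (F s)" "\<And>\<omega>. \<bar>Z \<omega>\<bar> \<le> N"
    and S: "S \<in> borel_measurable (F s)" "integrable M (\<lambda>\<omega>. (S \<omega>)\<^sup>2)" "expectation (\<lambda>\<omega>. (S \<omega>)\<^sup>2) \<le> N\<^sup>2 * x"
  shows "integrable M (\<lambda>\<omega>. (Y \<omega> + ((S \<omega> + Z \<omega> * (W t \<omega> - W s \<omega>))\<^sup>2 - (S \<omega>)\<^sup>2 - (Z \<omega>)\<^sup>2 * (t - s)))\<^sup>2)"
    and "expectation (\<lambda>\<omega>. (Y \<omega> + ((S \<omega> + Z \<omega> * (W t \<omega> - W s \<omega>))\<^sup>2 - (S \<omega>)\<^sup>2 - (Z \<omega>)\<^sup>2 * (t - s)))\<^sup>2)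
      \<le> expectation (\<lambda>\<omega>. (Y \<omega>)\<^sup>2) + 4 * N ^ 4 * ((t - s)\<^sup>2 + 2 * (t - s) * x)"
proof -
  let ?D = "\<lambda>\<omega>. W t \<omega> - W s \<omega>"
  let ?f = "\<lambda>\<omega>. (Y \<omega> + ((S \<omega> + Z \<omega> * ?D \<omega>)\<^sup>2 - (S \<omega>)\<^sup>2 - (Z \<omega>)\<^sup>2 * (t - s)))\<^sup>2"
  \<comment> \<open>These are the coefficients in the expansion by powers of the increment; all of
    them are known at time \<open>s\<close>.\<close>
  define A1 where "A1 \<omega> = Z \<omega> * (Z \<omega> * Y \<omega>)" for \<omega>
  define A2 where "A2 \<omega> = (Z \<omega> * Y \<omega>) * S \<omega>" for \<omega>
  define A3 where "A3 \<omega> = ((Z \<omega>)\<^sup>2)\<^sup>2" for \<omega>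
  define A4 where "A4 \<omega> = (Z \<omega> * S \<omega>)\<^sup>2" for \<omega>
  \<comment> \<open>The majorant obtained from
    \<open>(a + b)\<^sup>2 \<le> 2 * a\<^sup>2 + 2 * b\<^sup>2\<close> for the two parts of the
    martingale difference. Avoiding their product removes the third power of the increment.\<close>
  define R where "R \<omega> = (Y \<omega>)\<^sup>2 + 2 * (A1 \<omega> * ?D \<omega> ^ 2) - 2 * (t - s) * A1 \<omega> + 4 * (A2 \<omega> * ?D \<omega>)
    + 2 * (A3 \<omega> * ?D \<omega> ^ 4) - 4 * (t - s) * (A3 \<omega> * ?D \<omega> ^ 2) + 2 * (t - s)\<^sup>2 * A3 \<omega> + 8 * (A4 \<omega> * ?D \<omega> ^ 2)" for \<omega>
  have [measurable]: "Y \<in> borel_measurable M" "Z \<in> borel_measurable M" "S \<in> borel_measurable M" "?D \<in> borel_measurable M"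
    using Y Z S measurable_filtration increment_measurable[OF st] by blast+
  have F: "A1 \<in> borel_measurable (F s)" "A2 \<in> borel_measurable (F s)" "A3 \<in> borel_measurable (F s)" "A4 \<in> borel_measurable (F s)"
    unfolding A1_def A2_def A3_def A4_def using Y(1) Z(1) S(1) by measurable
  have Z2: "(Z \<omega>)\<^sup>2 \<le> N\<^sup>2" for \<omega> using power_mono[OF Z(2)[of \<omega>] abs_ge_zero, of 2] by simp
  have sq: "integrable M (\<lambda>\<omega>. (Z \<omega> * Y \<omega>)\<^sup>2)" "integrable M (\<lambda>\<omega>. (Z \<omega> * S \<omega>)\<^sup>2)" "integrable M (\<lambda>\<omega>. (Z \<omega>)\<^sup>2)"
    "integrable M (\<lambda>\<omega>. ((Z \<omega>)\<^sup>2)\<^sup>2)"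
    using bounded_times_square_integrable[of Y M Z N] bounded_times_square_integrable[of S M Z N]
      square_integrable_bounded[of Z N] square_integrable_bounded[of "\<lambda>\<omega>. (Z \<omega>)\<^sup>2" "N\<^sup>2"] Y S Z Z2 by auto
  have int: "integrable M A1" "integrable M A2" "integrable M A3" "integrable M A4"
    unfolding A1_def A2_def A3_def A4_def
    using square_integrable_mult[OF _ _ sq(3,1)] square_integrable_mult[OF _ _ sq(1) S(2)] sq by auto
  note P = past_times_increment(1)[OF st] and E = past_times_increment(2)[OF st]
  note m = increment_moments[OF st]
  have P2: "integrable M (\<lambda>\<omega>. A2 \<omega> * ?D \<omega>)" "expectation (\<lambda>\<omega>. A2 \<omega> * ?D \<omega>) = 0"
    using P[OF F(2) int(2), of 1] E[OF F(2) int(2), of 1] m by simp_all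
  note E2 = P2(2)
  have intR: "integrable M R"
    unfolding R_def using Y(2) int by (intro Bochner_Integration.integrable_add Bochner_Integration.integrable_diff integrable_mult_right P P2 F) auto
  have le: "?f \<omega> \<le> R \<omega>" for \<omega>
  proof -
    let ?a = "(Z \<omega>)\<^sup>2 * ((?D \<omega>)\<^sup>2 - (t - s))" and ?b = "2 * (Z \<omega> * S \<omega> * ?D \<omega>)"
    have "?f \<omega> = (Y \<omega> + (?a + ?b))\<^sup>2"
      by (rule arg_cong[where f=power2]) (simp add: power2_eq_square algebra_simps)
    also have "\<dots> = (Y \<omega>)\<^sup>2 + 2 * Y \<omega> * (?a + ?b) + (?a + ?b)\<^sup>2" by (simp add: power2_sum)
    also have "(?a + ?b)\<^sup>2 \<le> 2 * ?a\<^sup>2 + 2 * ?b\<^sup>2" using square_diff_le[of ?a "- ?b"] by simp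
    also have "(Y \<omega>)\<^sup>2 + 2 * Y \<omega> * (?a + ?b) + (2 * ?a\<^sup>2 + 2 * ?b\<^sup>2) = R \<omega>"
      unfolding R_def A1_def A2_def A3_def A4_def by (simp add: power2_eq_square power4_eq_xxxx algebra_simps)
    finally show ?thesis by simp
  qed
  show int_f: "integrable M ?f"
  proof (rule Bochner_Integration.integrable_bound[OF intR])
    have "norm (?f \<omega>) \<le> norm (R \<omega>)" for \<omega> using le[of \<omega>] zero_le_power2[of "Y \<omega> + ((S \<omega> + Z \<omega> * ?D \<omega>)\<^sup>2 - (S \<omega>)\<^sup>2 - (Z \<omega>)\<^sup>2 * (t - s))"]
      by simp
    then show "AE \<omega> in M. norm (?f \<omega>) \<le> norm (R \<omega>)" by simp
  qed measurable
  have "expectation ?f \<le> expectation R" by (rule integral_mono[OF int_f intR le])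
  \<comment> \<open>The two \<open>A1\<close> terms cancel and the \<open>A2\<close> term vanishes,
    which is the orthogonality; the \<open>A3\<close> terms combine as 6 - 4 + 2 = 4.\<close>
  also have "expectation R = expectation (\<lambda>\<omega>. (Y \<omega>)\<^sup>2) + 2 * (expectation A1 * (t - s)) - 2 * (t - s) * expectation A1 + 4 * (expectation A2 * 0)
     + 2 * (expectation A3 * (3 * (t - s)\<^sup>2)) - 4 * (t - s) * (expectation A3 * (t - s)) + 2 * (t - s)\<^sup>2 * expectation A3
     + 8 * (expectation A4 * (t - s))"
    unfolding R_def using Y(2) int P[OF F(1) int(1), of 2] P2 P[OF F(3) int(3), of 2] P[OF F(3) int(3), of 4] P[OF F(4) int(4), of 2]
    by (simp add: E[OF F(1) int(1)] E2 E[OF F(3) int(3)] E[OF F(4) int(4)] m)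
  also have "\<dots> = expectation (\<lambda>\<omega>. (Y \<omega>)\<^sup>2) + 4 * (t - s)\<^sup>2 * expectation A3 + 8 * (t - s) * expectation A4"
    by (simp add: power2_eq_square algebra_simps)
  finally have E_le: "expectation ?f \<le> expectation (\<lambda>\<omega>. (Y \<omega>)\<^sup>2) + 4 * (t - s)\<^sup>2 * expectation A3 + 8 * (t - s) * expectation A4" .
  have "expectation A3 \<le> expectation (\<lambda>_. N ^ 4)"
  proof (rule integral_mono[OF int(3)])
    fix \<omega> show "A3 \<omega> \<le> N ^ 4" using power_mono[OF Z2[of \<omega>] zero_le_power2, of 2] by (simp add: A3_def flip: power_mult)
  qed simp
  then have a3: "expectation A3 \<le> N ^ 4" by (simp add: prob_space)
  have "expectation A4 \<le> expectation (\<lambda>\<omega>. N\<^sup>2 * (S \<omega>)\<^sup>2)"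
  proof (rule integral_mono[OF int(4)])
    fix \<omega> show "A4 \<omega> \<le> N\<^sup>2 * (S \<omega>)\<^sup>2" using Z2[of \<omega>] by (simp add: A4_def power_mult_distrib mult_right_mono)
  qed (use S in simp)
  also have "\<dots> \<le> N ^ 4 * x" using mult_left_mono[OF S(3) zero_le_power2[of N]] by simp
  finally have a4: "expectation A4 \<le> N ^ 4 * x" .
  have "4 * (t - s)\<^sup>2 * expectation A3 \<le> 4 * (t - s)\<^sup>2 * N ^ 4" by (intro mult_left_mono a3) simp
  moreover have "8 * (t - s) * expectation A4 \<le> 8 * (t - s) * (N ^ 4 * x)" using st by (intro mult_left_mono a4) simp
  ultimately show "expectation ?f \<le> expectation (\<lambda>\<omega>. (Y \<omega>)\<^sup>2) + 4 * N ^ 4 * ((t - s)\<^sup>2 + 2 * (t - s) * x)"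
    using E_le by (simp add: algebra_simps)
qed

text \<open>\<open>V\<close> carries the earlier blocks, and the sum starts afresh at
  \<open>\<tau> 0\<close>. After elapsed time \<open>x\<close> its second moment is at most
  \<open>N\<^sup>2 * x\<close> by the isometry, and a step of length \<open>d\<close> adds
  \<open>4 * N ^ 4 * (d\<^sup>2 + 2 * d * x)\<close>, which completes \<open>x\<^sup>2\<close> to
  \<open>(x + d)\<^sup>2\<close>.\<close>

lemma block_variation:
  assumes "0 \<le> \<tau> 0" "\<And>i. i < n \<Longrightarrow> \<tau> i \<le> \<tau> (Suc i)" "\<And>i. i < n \<Longrightarrow> \<xi> i \<in> borel_measurable (F (\<tau> i))"
    and N: "\<And>i \<omega>. \<bar>\<xi> i \<omega>\<bar> \<le> N"
    and V: "V \<in> borel_measurable (F (\<tau> 0))" "integrable M (\<lambda>\<omega>. (V \<omega>)\<^sup>2)"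
  defines "V' \<equiv> \<lambda>n \<omega>. V \<omega> + ((\<Sum>i<n. \<xi> i \<omega> * (W (\<tau> (Suc i)) \<omega> - W (\<tau> i) \<omega>))\<^sup>2 - (\<Sum>i<n. (\<xi> i \<omega>)\<^sup>2 * (\<tau> (Suc i) - \<tau> i)))"
  shows "V' n \<in> borel_measurable (F (\<tau> n)) \<and> integrable M (\<lambda>\<omega>. (V' n \<omega>)\<^sup>2) \<and>
    expectation (\<lambda>\<omega>. (V' n \<omega>)\<^sup>2) \<le> expectation (\<lambda>\<omega>. (V \<omega>)\<^sup>2) + 4 * N ^ 4 * (\<tau> n - \<tau> 0)\<^sup>2"
  using assms(1-3)
proof (induction n)
  case 0
  then show ?case using V by (simp add: V'_def)
next
  case (Suc n)
  let ?S = "\<lambda>\<omega>. \<Sum>i<n. \<xi> i \<omega> * (W (\<tau> (Suc i)) \<omega> - W (\<tau> i) \<omega>)"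
  have IH: "V' n \<in> borel_measurable (F (\<tau> n))" "integrable M (\<lambda>\<omega>. (V' n \<omega>)\<^sup>2)"
    "expectation (\<lambda>\<omega>. (V' n \<omega>)\<^sup>2) \<le> expectation (\<lambda>\<omega>. (V \<omega>)\<^sup>2) + 4 * N ^ 4 * (\<tau> n - \<tau> 0)\<^sup>2"
    using Suc by auto
  have mono: "\<tau> 0 \<le> \<tau> n" using Suc.prems(2) by (intro partition_mono[of n \<tau> 0 n]) auto
  have \<tau>: "0 \<le> \<tau> n" "\<tau> n \<le> \<tau> (Suc n)" using Suc.prems mono by auto
  have \<xi>_sq: "integrable M (\<lambda>\<omega>. (\<xi> i \<omega>)\<^sup>2)" if "i < Suc n" for i
    using square_integrable_bounded[OF measurable_filtration[OF Suc.prems(3)[OF that]] N] .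
  have S: "?S \<in> borel_measurable (F (\<tau> n))"
    using Suc.prems by (intro discrete_integral_measurable) auto
  have iso: "integrable M (\<lambda>\<omega>. (?S \<omega>)\<^sup>2)" "expectation (\<lambda>\<omega>. (?S \<omega>)\<^sup>2) = (\<Sum>i<n. expectation (\<lambda>\<omega>. (\<xi> i \<omega>)\<^sup>2) * (\<tau> (Suc i) - \<tau> i))"
    using discrete_isometry[of \<tau> n \<xi>] Suc.prems \<xi>_sq by auto
  have "(\<Sum>i<n. expectation (\<lambda>\<omega>. (\<xi> i \<omega>)\<^sup>2) * (\<tau> (Suc i) - \<tau> i)) \<le> (\<Sum>i<n. N\<^sup>2 * (\<tau> (Suc i) - \<tau> i))"
  proof (intro sum_mono mult_right_mono)
    fix i assume i: "i \<in> {..<n}"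
    have "expectation (\<lambda>\<omega>. (\<xi> i \<omega>)\<^sup>2) \<le> expectation (\<lambda>_. N\<^sup>2)"
    proof (rule integral_mono)
      fix \<omega> show "(\<xi> i \<omega>)\<^sup>2 \<le> N\<^sup>2" using power_mono[OF N[of i \<omega>] abs_ge_zero, of 2] by simp
    qed (use i \<xi>_sq in auto)
    then show "expectation (\<lambda>\<omega>. (\<xi> i \<omega>)\<^sup>2) \<le> N\<^sup>2" by (simp add: prob_space)
  qed (use Suc.prems(2) in auto)
  also have "\<dots> = N\<^sup>2 * (\<tau> n - \<tau> 0)"
    by (simp add: sum_lessThan_telescope flip: sum_distrib_left)
  finally have ES: "expectation (\<lambda>\<omega>. (?S \<omega>)\<^sup>2) \<le> N\<^sup>2 * (\<tau> n - \<tau> 0)" using iso by simp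
  note step = variation_step[OF \<tau> IH(1,2) Suc.prems(3)[OF lessI] N S iso(1) ES]
  have V'_Suc: "V' (Suc n) \<omega> = V' n \<omega> + ((?S \<omega> + \<xi> n \<omega> * (W (\<tau> (Suc n)) \<omega> - W (\<tau> n) \<omega>))\<^sup>2 - (?S \<omega>)\<^sup>2 - (\<xi> n \<omega>)\<^sup>2 * (\<tau> (Suc n) - \<tau> n))" for \<omega>
    unfolding V'_def by simp
  have "expectation (\<lambda>\<omega>. (V' (Suc n) \<omega>)\<^sup>2) \<le> expectation (\<lambda>\<omega>. (V \<omega>)\<^sup>2) + 4 * N ^ 4 * (\<tau> n - \<tau> 0)\<^sup>2
      + 4 * N ^ 4 * ((\<tau> (Suc n) - \<tau> n)\<^sup>2 + 2 * (\<tau> (Suc n) - \<tau> n) * (\<tau> n - \<tau> 0))"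
    unfolding V'_Suc using step(2) IH(3) by linarith
  also have "\<dots> = expectation (\<lambda>\<omega>. (V \<omega>)\<^sup>2) + 4 * N ^ 4 * (\<tau> (Suc n) - \<tau> 0)\<^sup>2"
    by (simp add: power2_eq_square algebra_simps)
  finally have "expectation (\<lambda>\<omega>. (V' (Suc n) \<omega>)\<^sup>2) \<le> expectation (\<lambda>\<omega>. (V \<omega>)\<^sup>2) + 4 * N ^ 4 * (\<tau> (Suc n) - \<tau> 0)\<^sup>2" .
  moreover have "V' (Suc n) \<in> borel_measurable (F (\<tau> (Suc n)))"
  proof -
    have m: "V' n \<in> borel_measurable (F (\<tau> (Suc n)))" "?S \<in> borel_measurable (F (\<tau> (Suc n)))" "\<xi> n \<in> borel_measurable (F (\<tau> (Suc n)))"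
      using measurable_filtration_mono[OF _ \<tau>(2)] IH(1) S Suc.prems(3)[OF lessI] by auto
    show ?thesis
      unfolding V'_Suc[abs_def]
      by (intro borel_measurable_add borel_measurable_diff borel_measurable_power borel_measurable_times borel_measurable_const m
          W_measurable_filtration \<tau> order_refl order_trans[OF \<tau>])
  qed
  moreover have "integrable M (\<lambda>\<omega>. (V' (Suc n) \<omega>)\<^sup>2)" using step(1) by (simp only: V'_Suc)
  ultimately show ?case by blast
qed

text \<open>Each block is cut into \<open>n\<close> steps, and the error of the earlier blocks is
  passed to \<open>block_variation\<close> as \<open>V\<close>. The bound does not contain
  \<open>n\<close>, so the inner cuts can be refined while the blocks stay fixed.\<close>

lemma discrete_variation:
  assumes "\<And>k. k < p \<Longrightarrow> \<tau> k 0 = \<rho> k" "\<And>k. k < p \<Longrightarrow> \<tau> k n = \<rho> (Suc k)" "0 \<le> \<rho> 0"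
    and "\<And>k i. k < p \<Longrightarrow> i < n \<Longrightarrow> \<tau> k i \<le> \<tau> k (Suc i)"
    and "\<And>k i. k < p \<Longrightarrow> i < n \<Longrightarrow> \<xi> k i \<in> borel_measurable (F (\<tau> k i))"
    and N: "\<And>k i \<omega>. \<bar>\<xi> k i \<omega>\<bar> \<le> N"
  defines "V \<equiv> \<lambda>p \<omega>. \<Sum>k<p. (\<Sum>i<n. \<xi> k i \<omega> * (W (\<tau> k (Suc i)) \<omega> - W (\<tau> k i) \<omega>))\<^sup>2 - (\<Sum>i<n. (\<xi> k i \<omega>)\<^sup>2 * (\<tau> k (Suc i) - \<tau> k i))"
  shows "V p \<in> borel_measurable (F (\<rho> p)) \<and> integrable M (\<lambda>\<omega>. (V p \<omega>)\<^sup>2) \<and> 0 \<le> \<rho> p \<and>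
    expectation (\<lambda>\<omega>. (V p \<omega>)\<^sup>2) \<le> (\<Sum>k<p. 4 * N ^ 4 * (\<rho> (Suc k) - \<rho> k)\<^sup>2)"
  using assms(1-5)
proof (induction p)
  case 0
  then show ?case by (simp add: V_def)
next
  case (Suc p)
  have IH: "V p \<in> borel_measurable (F (\<rho> p))" "integrable M (\<lambda>\<omega>. (V p \<omega>)\<^sup>2)" "0 \<le> \<rho> p"
    "expectation (\<lambda>\<omega>. (V p \<omega>)\<^sup>2) \<le> (\<Sum>k<p. 4 * N ^ 4 * (\<rho> (Suc k) - \<rho> k)\<^sup>2)"
    using Suc by auto
  have \<tau>: "\<tau> p 0 = \<rho> p" "\<tau> p n = \<rho> (Suc p)" using Suc.prems by auto
  have "\<tau> p 0 \<le> \<tau> p n" using Suc.prems(4) by (intro partition_mono[of n "\<tau> p" 0 n]) auto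
  then have "0 \<le> \<rho> (Suc p)" using \<tau> IH(3) by simp
  moreover have "V (Suc p) = (\<lambda>\<omega>. V p \<omega> + ((\<Sum>i<n. \<xi> p i \<omega> * (W (\<tau> p (Suc i)) \<omega> - W (\<tau> p i) \<omega>))\<^sup>2 - (\<Sum>i<n. (\<xi> p i \<omega>)\<^sup>2 * (\<tau> p (Suc i) - \<tau> p i))))"
    by (simp add: V_def fun_eq_iff)
  moreover note block_variation[of "\<tau> p" n "\<xi> p" N "V p"]
  ultimately show ?case
    using IH Suc.prems(4,5) \<tau> N by (simp add: fun_eq_iff)
qed

end

section \<open>Left-endpoint sums on uniform grids\<close>

definition partition_process :: "nat \<Rightarrow> (nat \<Rightarrow> real) \<Rightarrow> (nat \<Rightarrow> 'a \<Rightarrow> real) \<Rightarrow> 'a simple_process" where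
  "partition_process n \<tau> \<xi> = map (\<lambda>i. (\<tau> i, \<tau> (Suc i), \<xi> i)) [0..<n]"

lemma simple_value_partition_process:
  assumes "\<And>i. i < n \<Longrightarrow> \<tau> i \<le> \<tau> (Suc i)" "i < n" "\<tau> i < s" "s \<le> \<tau> (Suc i)"
  shows "simple_value (partition_process n \<tau> \<xi>) s \<omega> = \<xi> i \<omega>"
proof -
  have "simple_value (partition_process n \<tau> \<xi>) s \<omega> = (\<Sum>j<n. \<xi> j \<omega> * indicator {\<tau> j<..\<tau> (Suc j)} s)"
    by (simp add: simple_value_def partition_process_def comp_def interv_sum_list_conv_sum_set_nat atLeast0LessThan)
  also have "\<dots> = (\<Sum>j<n. if j = i then \<xi> i \<omega> else 0)"
  proof (intro sum.cong refl)
    fix j assume "j \<in> {..<n}"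
    then have "j < n" by simp
    have "\<tau> (Suc j) \<le> \<tau> i" if "j < i"
      by (rule partition_mono[where n=n and \<tau>=\<tau>]) (use assms that in auto)
    moreover have "\<tau> (Suc i) \<le> \<tau> j" if "i < j"
      by (rule partition_mono[where n=n and \<tau>=\<tau>]) (use assms that \<open>j < n\<close> in auto)
    ultimately show "\<xi> j \<omega> * indicator {\<tau> j<..\<tau> (Suc j)} s = (if j = i then \<xi> i \<omega> else 0)"
      using assms(3,4) by (cases j i rule: linorder_cases) auto
  qed
  also have "\<dots> = \<xi> i \<omega>" using assms(2) by simp
  finally show ?thesis .
qed

lemma simple_integral_partition_process:
  assumes "\<And>i. i < n \<Longrightarrow> \<tau> i \<le> \<tau> (Suc i)"
  shows "simple_integral W (partition_process n \<tau> \<xi>) (\<tau> n) \<omega> - simple_integral W (partition_process n \<tau> \<xi>) (\<tau> 0) \<omega>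
    = (\<Sum>i<n. \<xi> i \<omega> * (W (\<tau> (Suc i)) \<omega> - W (\<tau> i) \<omega>))"
proof -
  have eq: "simple_integral W (partition_process n \<tau> \<xi>) s \<omega> = (\<Sum>i<n. \<xi> i \<omega> * (W (min (\<tau> (Suc i)) s) \<omega> - W (min (\<tau> i) s) \<omega>))" for s
    by (simp add: simple_integral_def partition_process_def comp_def interv_sum_list_conv_sum_set_nat atLeast0LessThan)
  have mono: "\<tau> j \<le> \<tau> k" if "j \<le> k" "k \<le> n" for j k
    by (rule partition_mono[where n=n and \<tau>=\<tau>]) (use assms that in auto)
  have "(\<Sum>i<n. \<xi> i \<omega> * (W (min (\<tau> (Suc i)) (\<tau> n)) \<omega> - W (min (\<tau> i) (\<tau> n)) \<omega>)) = (\<Sum>i<n. \<xi> i \<omega> * (W (\<tau> (Suc i)) \<omega> - W (\<tau> i) \<omega>))"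
    using mono by (intro sum.cong refl) (simp add: min_absorb1)
  moreover have "(\<Sum>i<n. \<xi> i \<omega> * (W (min (\<tau> (Suc i)) (\<tau> 0)) \<omega> - W (min (\<tau> i) (\<tau> 0)) \<omega>)) = 0"
    using mono by (intro sum.neutral) (simp add: min_absorb2)
  ultimately show ?thesis by (simp add: eq)
qed

text \<open>With \<open>Suc n\<close> cells the grid is never empty, so limits in \<open>n\<close>
  need no side condition.\<close>

definition grid :: "real \<Rightarrow> real \<Rightarrow> nat \<Rightarrow> nat \<Rightarrow> real" where
  "grid u v n i = u + (v - u) * real i / real (Suc n)"

lemma grid_0 [simp]: "grid u v n 0 = u"
  by (simp add: grid_def)

lemma grid_last: "grid u v n (Suc n) = v"
  by (simp add: grid_def)

lemma grid_Suc: "grid u v n (Suc i) = grid u v n i + (v - u) / real (Suc n)"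
  by (simp only: grid_def of_nat_Suc[of i] distrib_left mult_1_right add_divide_distrib)

lemma grid_le_Suc: "u \<le> v \<Longrightarrow> grid u v n i \<le> grid u v n (Suc i)"
  by (simp add: grid_Suc)

lemma grid_less_Suc: "u < v \<Longrightarrow> grid u v n i < grid u v n (Suc i)"
  by (simp add: grid_Suc)

lemma grid_bounds: "u \<le> v \<Longrightarrow> i \<le> Suc n \<Longrightarrow> u \<le> grid u v n i \<and> grid u v n i \<le> v"
  using partition_mono[where n="Suc n" and \<tau>="grid u v n" and j=0 and k=i]
    partition_mono[where n="Suc n" and \<tau>="grid u v n" and j=i and k="Suc n"]
  by (simp add: grid_le_Suc grid_last)

lemma grid_oscillation:
  fixes f :: "real \<Rightarrow> real"
  assumes "continuous_on {u..v} f" "u \<le> v" "0 < e"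
  shows "\<forall>\<^sub>F n in sequentially. \<forall>i<Suc n. \<forall>s. grid u v n i \<le> s \<longrightarrow> s \<le> grid u v n (Suc i) \<longrightarrow> \<bar>f (grid u v n i) - f s\<bar> \<le> e"
proof -
  have "uniformly_continuous_on {u..v} f"
    by (rule compact_uniformly_continuous[OF assms(1)]) simp
  then obtain d where d: "0 < d" "\<And>x y. x \<in> {u..v} \<Longrightarrow> y \<in> {u..v} \<Longrightarrow> dist y x < d \<Longrightarrow> dist (f y) (f x) < e"
    using \<open>0 < e\<close> unfolding uniformly_continuous_on_def by metis
  have "(\<lambda>n. (v - u) / real (Suc n)) \<longlonglongrightarrow> 0"
    using LIMSEQ_Suc[OF lim_const_over_n[of "v - u"]] by simp
  then have "\<forall>\<^sub>F n in sequentially. (v - u) / real (Suc n) < d"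
    using d(1) by (rule order_tendstoD)
  then show ?thesis
  proof eventually_elim
    case (elim n)
    show ?case
    proof (intro allI impI)
      fix i s assume i: "i < Suc n" and s: "grid u v n i \<le> s" "s \<le> grid u v n (Suc i)"
      have "grid u v n i \<in> {u..v}" "s \<in> {u..v}"
        using grid_bounds[OF \<open>u \<le> v\<close>, of i n] grid_bounds[OF \<open>u \<le> v\<close>, of "Suc i" n] i s by auto
      moreover have "dist (grid u v n i) s < d" using s elim by (simp add: dist_real_def grid_Suc)
      ultimately show "\<bar>f (grid u v n i) - f s\<bar> \<le> e" using d(2)[of s "grid u v n i"] by (simp add: dist_real_def)
    qed
  qed
qed

text \<open>The least index whose grid point reaches \<open>s\<close> closes the cell. Cells are
  left-open, which is why \<open>s = u\<close> is excluded.\<close>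

lemma grid_exists:
  assumes "u < s" "s \<le> v"
  shows "\<exists>i<Suc n. grid u v n i < s \<and> s \<le> grid u v n (Suc i)"
proof -
  define i where "i = (LEAST i. s \<le> grid u v n i)"
  have ex: "s \<le> grid u v n (Suc n)" using assms by (simp add: grid_last)
  have i: "s \<le> grid u v n i" unfolding i_def using ex by (rule LeastI)
  have "i \<le> Suc n" unfolding i_def using ex by (rule Least_le)
  have "i \<noteq> 0" using i assms by (cases i) auto
  then obtain j where j: "i = Suc j" by (cases i) auto
  have "\<not> s \<le> grid u v n j" using not_less_Least[of j "\<lambda>i. s \<le> grid u v n i"] j unfolding i_def by simp
  then show ?thesis using i j \<open>i \<le> Suc n\<close> by (intro exI[of _ j]) auto
qed

text \<open>The sum is the exact integral of the step function with left-endpoint values, and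
  uniform continuity brings this function close to \<open>f\<close> everywhere except possibly at
  \<open>u\<close>.\<close>

lemma grid_sum_tendsto:
  fixes f :: "real \<Rightarrow> real"
  assumes f: "continuous_on {u..v} f" and uv: "u \<le> v"
  shows "(\<lambda>n. \<Sum>i<Suc n. f (grid u v n i) * (grid u v n (Suc i) - grid u v n i)) \<longlonglongrightarrow> (LINT s:{u..v}|lborel. f s)"
proof (rule tendstoI)
  fix e :: real assume "0 < e"
  \<comment> \<open>The summand 1 keeps the denominator positive when \<open>u = v\<close>.\<close>
  define e' where "e' = e / (2 * (v - u + 1))"
  have e': "0 < e'" "e' * (v - u) < e"
  proof -
    show "0 < e'" using \<open>0 < e\<close> uv by (simp add: e'_def)
    have "e * (v - u) < e * (2 * (v - u + 1))" using \<open>0 < e\<close> uv by (intro mult_strict_left_mono) auto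
    then show "e' * (v - u) < e" using uv by (simp add: e'_def pos_divide_less_eq)
  qed
  have int_f: "set_integrable lborel {u..v} f" by (rule borel_integrable_atLeastAtMost'[OF f])
  show "\<forall>\<^sub>F n in sequentially. dist (\<Sum>i<Suc n. f (grid u v n i) * (grid u v n (Suc i) - grid u v n i)) (LINT s:{u..v}|lborel. f s) < e"
    using grid_oscillation[OF f uv e'(1)]
  proof eventually_elim
    case (elim n)
    \<comment> \<open>The deterministic step function is written as a partition process over the
      one-point type, so that the evaluation on cells can be reused.\<close>
    define g where "g s = simple_value (partition_process (Suc n) (grid u v n) (\<lambda>i (_::unit). f (grid u v n i))) s ()" for s
    have g: "g s = f (grid u v n i)" if "i < Suc n" "grid u v n i < s" "s \<le> grid u v n (Suc i)" for i s
      unfolding g_def by (simp add: simple_value_partition_process[OF grid_le_Suc[OF uv] that])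
    have int_g: "set_integrable lborel {grid u v n 0..grid u v n (Suc n)} g \<and>
      (LINT s:{grid u v n 0..grid u v n (Suc n)}|lborel. g s) = (\<Sum>i<Suc n. f (grid u v n i) * (grid u v n (Suc i) - grid u v n i))"
      using g grid_le_Suc[OF uv] by (intro step_function_integral[of "Suc n" "grid u v n" g]) auto
    have int_d: "integrable lborel (\<lambda>s. indicator {u..v} s *\<^sub>R (g s - f s))"
      using set_integral_diff(1)[of lborel "{u..v}" g f] int_g int_f by (simp add: grid_last set_integrable_def)
    have "\<bar>LINT s:{u..v}|lborel. g s - f s\<bar> \<le> (\<integral>s. \<bar>indicator {u..v} s *\<^sub>R (g s - f s)\<bar> \<partial>lborel)"
      unfolding set_lebesgue_integral_def by (rule integral_abs_bound)
    also have "\<dots> \<le> (LINT s:{u..v}|lborel. e')"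
      unfolding set_lebesgue_integral_def
    proof (rule integral_mono_AE)
      show "AE s in lborel. \<bar>indicator {u..v} s *\<^sub>R (g s - f s)\<bar> \<le> indicator {u..v} s *\<^sub>R e'"
        using AE_lborel_singleton[of u]
      proof eventually_elim
        case (elim s)
        show ?case
        proof (cases "s \<in> {u..v}")
          case True
          then obtain i where i: "i < Suc n" "grid u v n i < s" "s \<le> grid u v n (Suc i)"
            using grid_exists[of u s v n] elim by auto
          then have "\<bar>f (grid u v n i) - f s\<bar> \<le> e'"
            using \<open>\<forall>i<Suc n. \<forall>s. _ i s\<close> by (auto intro: less_imp_le)
          with True g[OF i] show ?thesis by simp
        qed simp
      qed
    qed (use int_d in \<open>auto simp: emeasure_lborel_Icc_eq\<close>)
    also have "\<dots> = e' * (v - u)" using uv by (simp add: set_integral_const)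
    finally have "\<bar>LINT s:{u..v}|lborel. g s - f s\<bar> < e" using e'(2) by linarith
    moreover have "(LINT s:{u..v}|lborel. g s - f s) = (LINT s:{u..v}|lborel. g s) - (LINT s:{u..v}|lborel. f s)"
      using int_g int_f by (intro set_integral_diff(2)) (auto simp: grid_last)
    ultimately show ?case using int_g by (simp add: dist_real_def grid_last del: sum.lessThan_Suc)
  qed
qed

lemma set_integral_combine:
  fixes f :: "real \<Rightarrow> real"
  assumes f: "continuous_on {a..c} f" and abc: "a \<le> b" "b \<le> c"
  shows "(LINT s:{a..b}|lborel. f s) + (LINT s:{b..c}|lborel. f s) = (LINT s:{a..c}|lborel. f s)"
proof -
  have "set_integrable lborel {a..c} f" "set_integrable lborel {a..b} f" "set_integrable lborel {b..c} f"
    using abc by (auto intro!: borel_integrable_atLeastAtMost' continuous_on_subset[OF f])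
  from this[THEN set_borel_integral_eq_integral(2)] show ?thesis
    using Henstock_Kurzweil_Integration.integral_combine[OF abc integrable_continuous_real[OF f]] by simp
qed

lemma set_integral_sum_partition:
  fixes f :: "real \<Rightarrow> real"
  assumes "continuous_on {\<rho> 0..\<rho> p} f" "\<And>k. k < p \<Longrightarrow> \<rho> k \<le> \<rho> (Suc k)"
  shows "(\<Sum>k<p. LINT s:{\<rho> k..\<rho> (Suc k)}|lborel. f s) = (LINT s:{\<rho> 0..\<rho> p}|lborel. f s)"
  using assms
proof (induction p)
  case 0
  have "(LINT s:{\<rho> 0..\<rho> 0}|lborel. f s) = 0"
    using step_function_integral[of 0 \<rho> f] by simp
  then show ?case by simp
next
  case (Suc p)
  have le: "\<rho> 0 \<le> \<rho> p" "\<rho> p \<le> \<rho> (Suc p)"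
    using Suc.prems(2) by (auto intro: partition_mono[where n=p and \<tau>=\<rho>])
  have "continuous_on {\<rho> 0..\<rho> p} f"
    using le by (intro continuous_on_subset[OF Suc.prems(1)]) auto
  then have "(\<Sum>k<p. LINT s:{\<rho> k..\<rho> (Suc k)}|lborel. f s) = (LINT s:{\<rho> 0..\<rho> p}|lborel. f s)"
    using Suc by auto
  then show ?case using set_integral_combine[OF Suc.prems(1) le] by simp
qed

section \<open>From grid sums to the Ito integral\<close>

context brownian
begin

text \<open>Capping at 1 turns convergence in probability into convergence in mean without moment
  assumptions. An almost surely convergent subsequence then exists, and near 0 the cap has no
  effect.\<close>

lemma in_probability_AE_subseq:
  fixes Y :: "nat \<Rightarrow> 'a \<Rightarrow> real"
  assumes [measurable]: "\<And>n. Y n \<in> borel_measurable M"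
    and Y: "\<And>\<epsilon>. 0 < \<epsilon> \<Longrightarrow> (\<lambda>n. prob {\<omega>\<in>space M. \<bar>Y n \<omega>\<bar> > \<epsilon>}) \<longlonglongrightarrow> 0"
  shows "\<exists>\<phi>::nat\<Rightarrow>nat. strict_mono \<phi> \<and> (AE \<omega> in M. (\<lambda>n. Y (\<phi> n) \<omega>) \<longlonglongrightarrow> 0)"
proof -
  define u where "u n \<omega> = min 1 \<bar>Y n \<omega>\<bar>" for n \<omega>
  have [measurable]: "u n \<in> borel_measurable M" for n unfolding u_def by measurable
  have int: "integrable M (u n)" for n
    by (rule integrable_const_bound[where B=1]) (auto simp: u_def)
  have le: "expectation (u n) \<le> \<epsilon> + prob {\<omega>\<in>space M. \<bar>Y n \<omega>\<bar> > \<epsilon>}" if "0 < \<epsilon>" for \<epsilon> n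
  proof -
    define S where "S = {\<omega>\<in>space M. \<bar>Y n \<omega>\<bar> > \<epsilon>}"
    have S: "S \<in> events" unfolding S_def by measurable
    have intS: "integrable M (indicator S :: 'a \<Rightarrow> real)"
      using S by (intro integrable_real_indicator) (auto simp: emeasure_eq_measure)
    have "expectation (u n) \<le> expectation (\<lambda>\<omega>. \<epsilon> + indicator S \<omega>)"
    proof (rule integral_mono[OF int])
      show "integrable M (\<lambda>\<omega>. \<epsilon> + indicator S \<omega>)" using intS by simp
    qed (use that in \<open>auto simp: u_def S_def indicator_def\<close>)
    also have "\<dots> = \<epsilon> + prob S"
      using S intS by (subst Bochner_Integration.integral_add) (auto simp: prob_space)
    finally show ?thesis by (simp add: S_def)
  qed
  have "(\<lambda>n. expectation (\<lambda>\<omega>. norm (u n \<omega>))) \<longlonglongrightarrow> 0"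
  proof (rule tendstoI)
    fix e :: real assume "0 < e"
    then have "\<forall>\<^sub>F n in sequentially. prob {\<omega>\<in>space M. \<bar>Y n \<omega>\<bar> > e / 2} < e / 2"
      by (intro order_tendstoD(2)[OF Y]) auto
    then show "\<forall>\<^sub>F n in sequentially. dist (expectation (\<lambda>\<omega>. norm (u n \<omega>))) 0 < e"
    proof eventually_elim
      case (elim n)
      have "0 \<le> expectation (u n)" by (intro integral_nonneg_AE) (auto simp: u_def)
      moreover have "expectation (\<lambda>\<omega>. norm (u n \<omega>)) = expectation (u n)"
        by (intro Bochner_Integration.integral_cong) (auto simp: u_def)
      ultimately show ?case using le[of "e / 2" n] elim \<open>0 < e\<close> by simp
    qed
  qed
  from tendsto_L1_AE_subseq[OF int this]
  obtain \<phi> :: "nat \<Rightarrow> nat" where \<phi>: "strict_mono \<phi>" "AE \<omega> in M. (\<lambda>n. u (\<phi> n) \<omega>) \<longlonglongrightarrow> 0" by blast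
  from \<phi>(2) have "AE \<omega> in M. (\<lambda>n. Y (\<phi> n) \<omega>) \<longlonglongrightarrow> 0"
  proof eventually_elim
    case (elim \<omega>)
    then have "\<forall>\<^sub>F n in sequentially. u (\<phi> n) \<omega> < 1" by (rule order_tendstoD) simp
    then have "\<forall>\<^sub>F n in sequentially. u (\<phi> n) \<omega> = \<bar>Y (\<phi> n) \<omega>\<bar>"
      by eventually_elim (auto simp: u_def)
    from Lim_transform_eventually[OF elim this] show ?case by (simp add: tendsto_rabs_zero_iff)
  qed
  with \<phi>(1) show ?thesis by blast
qed

text \<open>The left-endpoint sum is the integral of an elementary process whose energy distance
  from \<open>H\<close> tends to 0 along continuous paths. As \<open>ito_estimate\<close> holds for
  every \<open>\<kappa>\<close>, convergence in probability follows without a bound on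
  \<open>H\<close>.\<close>

lemma ito_grid_converges:
  assumes ito: "ito_integral M F W H X" and cont: "AE \<omega> in M. continuous_on {0..} (\<lambda>s. H s \<omega>)"
    and uv: "0 \<le> u" "u < v" and "0 < \<epsilon>"
  shows "(\<lambda>n. prob {\<omega>\<in>space M. \<bar>(\<Sum>i<Suc n. H (grid u v n i) \<omega> * (W (grid u v n (Suc i)) \<omega> - W (grid u v n i) \<omega>)) - (X v \<omega> - X u \<omega>)\<bar> > \<epsilon>})
    \<longlonglongrightarrow> 0" (is "(\<lambda>n. prob (?E n)) \<longlonglongrightarrow> 0")
proof -
  have uv': "u \<le> v" using uv by simp
  define G where "G n = partition_process (Suc n) (grid u v n) (\<lambda>i. H (grid u v n i))" for n
  have el: "elementary F (G n)" for n
    unfolding elementary_def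
  proof (intro ballI, clarify)
    fix s t \<xi> assume "(s, t, \<xi>) \<in> set (G n)"
    then obtain i where i: "i < Suc n" "s = grid u v n i" "t = grid u v n (Suc i)" "\<xi> = H (grid u v n i)"
      by (auto simp: G_def partition_process_def simp del: upt_Suc)
    have "0 \<le> s" using grid_bounds[OF uv', of i n] i uv by auto
    moreover have "s < t" using i grid_less_Suc[OF uv(2)] by simp
    moreover have "\<xi> \<in> borel_measurable (F s)"
      using ito \<open>0 \<le> s\<close> i by (simp add: ito_integral_def adapted_process_def)
    ultimately show "0 \<le> s \<and> s < t \<and> \<xi> \<in> borel_measurable (F s)" by simp
  qed
  have Gint: "simple_integral W (G n) v \<omega> - simple_integral W (G n) u \<omega>
      = (\<Sum>i<Suc n. H (grid u v n i) \<omega> * (W (grid u v n (Suc i)) \<omega> - W (grid u v n i) \<omega>))" for n \<omega>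
    using simple_integral_partition_process[of "Suc n" "grid u v n" W "\<lambda>i. H (grid u v n i)" \<omega>, OF grid_le_Suc[OF uv']]
    unfolding G_def grid_last grid_0 .
  define B where "B \<kappa> n = {\<omega>\<in>space M. (LINT s:{u..v}|lborel. (simple_value (G n) s \<omega> - H s \<omega>)\<^sup>2) > \<kappa>}" for \<kappa> n
  have B: "(\<lambda>n. prob (B \<kappa> n)) \<longlonglongrightarrow> 0" if "0 < \<kappa>" for \<kappa>
  proof (rule prob_tendsto_0)
    fix n
    have [measurable]: "(\<lambda>\<omega>. LINT s:{u..v}|lborel. (simple_value (G n) s \<omega> - H s \<omega>)\<^sup>2) \<in> borel_measurable M"
      by (rule energy_measurable[OF ito el measurable_filtration uv(1)])
    show "B \<kappa> n \<in> events" unfolding B_def by measurable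
  next
    have AE_int: "AE \<omega> in M. set_integrable lborel {0..v} (\<lambda>s. (H s \<omega>)\<^sup>2)"
      using ito uv unfolding ito_integral_def by (auto elim!: AE_mp)
    \<comment> \<open>An oscillation of at most \<open>e\<close> on each cell gives an energy of at
      most \<open>e\<^sup>2 * (v - u)\<close>, which is \<open>\<kappa>\<close>.\<close>
    define e where "e = sqrt (\<kappa> / (v - u))"
    have e: "0 < e" "e\<^sup>2 * (v - u) = \<kappa>" using that uv by (auto simp: e_def)
    show "AE \<omega> in M. \<forall>\<^sub>F n in sequentially. \<omega> \<notin> B \<kappa> n"
      using cont AE_int AE_space
    proof eventually_elim
      case (elim \<omega>)
      have int: "set_integrable lborel {u..v} (\<lambda>s. (simple_value (G n) s \<omega> - H s \<omega>)\<^sup>2)" for n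
        by (rule energy_integrable[OF ito elim(3) uv(1) elim(2)])
      have "continuous_on {u..v} (\<lambda>s. H s \<omega>)" by (rule continuous_on_subset[OF elim(1)]) (use uv in auto)
      from grid_oscillation[OF this uv' e(1)] show ?case
      proof eventually_elim
        case (elim n)
        have "(LINT s:{u..v}|lborel. (simple_value (G n) s \<omega> - H s \<omega>)\<^sup>2) \<le> (LINT s:{u..v}|lborel. e\<^sup>2)"
          unfolding set_lebesgue_integral_def
        proof (rule integral_mono_AE)
          show "AE s in lborel. indicator {u..v} s *\<^sub>R (simple_value (G n) s \<omega> - H s \<omega>)\<^sup>2 \<le> indicator {u..v} s *\<^sub>R e\<^sup>2"
            using AE_lborel_singleton[of u]
          proof eventually_elim
            case (elim s)
            show ?case
            proof (cases "s \<in> {u..v}")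
              case True
              then obtain i where i: "i < Suc n" "grid u v n i < s" "s \<le> grid u v n (Suc i)"
                using grid_exists[of u s v n] elim by auto
              then have "\<bar>H (grid u v n i) \<omega> - H s \<omega>\<bar> \<le> e"
                using \<open>\<forall>i<Suc n. \<forall>s. _ i s\<close> by (auto intro: less_imp_le)
              then have "(H (grid u v n i) \<omega> - H s \<omega>)\<^sup>2 \<le> e\<^sup>2"
                using power_mono[OF _ abs_ge_zero, of "H (grid u v n i) \<omega> - H s \<omega>" e 2] by simp
              moreover have "simple_value (G n) s \<omega> = H (grid u v n i) \<omega>"
                unfolding G_def by (rule simple_value_partition_process[OF grid_le_Suc[OF uv'] i])
              ultimately show ?thesis using True by simp
            qed simp
          qed
        qed (use int in \<open>auto simp: set_integrable_def emeasure_lborel_Icc_eq\<close>)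
        also have "\<dots> = \<kappa>" using uv e by (simp add: set_integral_const mult.commute)
        finally show ?case by (simp add: B_def)
      qed
    qed
  qed
  have bound: "prob (?E n) \<le> prob (B \<kappa> n) + 4 * \<kappa> / (\<epsilon> / 2)\<^sup>2" if "0 < \<kappa>" for \<kappa> n
    using ito_estimate[OF ito el[of n] uv(1) uv' that half_gt_zero[OF \<open>0 < \<epsilon>\<close>]]
    unfolding Gint B_def abs_minus_commute[of "sum _ _"] by simp
  show ?thesis
  proof (rule tendstoI)
    fix e :: real assume "0 < e"
    define \<kappa> where "\<kappa> = e * \<epsilon>\<^sup>2 / 32"
    have \<kappa>: "0 < \<kappa>" "4 * \<kappa> / (\<epsilon> / 2)\<^sup>2 = e / 2" using \<open>0 < e\<close> \<open>0 < \<epsilon>\<close> by (auto simp: \<kappa>_def power2_eq_square)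
    have "\<forall>\<^sub>F n in sequentially. prob (B \<kappa> n) < e / 2"
      by (rule order_tendstoD(2)[OF B[OF \<kappa>(1)]]) (use \<open>0 < e\<close> in simp)
    then show "\<forall>\<^sub>F n in sequentially. dist (prob (?E n)) 0 < e"
    proof eventually_elim
      case (elim n)
      then show ?case using bound[OF \<kappa>(1), of n] \<kappa>(2) measure_nonneg[of M "?E n"] by simp
    qed
  qed
qed


lemma square_integral_measurable:
  assumes "ito_integral M F W H X"
  shows "(\<lambda>\<omega>. LINT s:{0..t}|lborel. (H s \<omega>)\<^sup>2) \<in> borel_measurable M"
proof -
  \<comment> \<open>The empty simple process has value 0, so its energy distance from
    \<open>H\<close> is the integral of the square of \<open>H\<close>.\<close>
  have "(\<lambda>\<omega>. LINT s:{0..t}|lborel. (simple_value [] s \<omega> - H s \<omega>)\<^sup>2) \<in> borel_measurable M"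
    by (rule energy_measurable[OF assms elementary_Nil measurable_filtration order_refl])
  then show ?thesis by simp
qed

text \<open>On \<open>A\<close> the truncated Riemann sums coincide with the untruncated ones, so Fatou's lemma along an almost
  surely convergent subsequence transfers the second moment bound to the Ito integral.\<close>
lemma ito_variation_bound:
  assumes ito: "ito_integral M F W H X" and cont: "AE \<omega> in M. continuous_on {0..} (\<lambda>s. H s \<omega>)"
    and "0 < t" "0 \<le> N" "0 < p" and A: "A \<in> events"
    and bdd: "\<And>\<omega> q. \<omega> \<in> A \<Longrightarrow> q \<in> \<rat> \<Longrightarrow> 0 \<le> q \<Longrightarrow> q \<le> 1 \<Longrightarrow> \<bar>H (q * t) \<omega>\<bar> \<le> N"
  shows "(\<integral>\<^sup>+\<omega>. ennreal (((\<Sum>k<p. (X (real (Suc k) * t / real p) \<omega> - X (real k * t / real p) \<omega>)\<^sup>2)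
      - (LINT s:{0..t}|lborel. (H s \<omega>)\<^sup>2))\<^sup>2) * indicator A \<omega> \<partial>M) \<le> ennreal (4 * N ^ 4 * t\<^sup>2 / real p)"
proof -
  define \<rho> where "\<rho> k = real k * t / real p" for k
  have \<rho>0: "\<rho> 0 = 0" and \<rho>p: "\<rho> p = t" using \<open>0 < p\<close> by (auto simp: \<rho>_def)
  have \<rho>_Suc: "\<rho> (Suc k) - \<rho> k = t / real p" for k by (simp add: \<rho>_def add_divide_distrib distrib_right)
  have \<rho>_less: "\<rho> k < \<rho> (Suc k)" for k
    using \<rho>_Suc[of k] divide_pos_pos[of t "real p"] \<open>0 < t\<close> \<open>0 < p\<close> by linarith
  have \<rho>_nonneg: "0 \<le> \<rho> k" for k using \<open>0 < t\<close> by (simp add: \<rho>_def)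
  define \<tau> where "\<tau> n k i = grid (\<rho> k) (\<rho> (Suc k)) n i" for n k i
  have \<tau>_nonneg: "0 \<le> \<tau> n k i" for n k i
    unfolding \<tau>_def grid_def \<rho>_Suc using \<rho>_nonneg[of k] \<open>0 < t\<close> by simp
  have \<tau>_le: "\<tau> n k i \<le> \<tau> n k (Suc i)" for n k i
    unfolding \<tau>_def using \<rho>_less[of k] by (intro grid_le_Suc) simp
  have \<tau>_ends: "\<tau> n k 0 = \<rho> k" "\<tau> n k (Suc n) = \<rho> (Suc k)" for n k
    by (simp_all add: \<tau>_def grid_last)
  \<comment> \<open>All grid points are rational multiples of \<open>t\<close>, so countably many
    conditions on \<open>H\<close> cover every grid at once; this lets the event \<open>A\<close> be
    chosen measurable.\<close>
  have \<tau>_rat: "\<exists>q\<in>\<rat>. 0 \<le> q \<and> q \<le> 1 \<and> \<tau> n k i = q * t" if "k < p" "i < Suc n" for n k i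
  proof (intro bexI conjI)
    let ?q = "(real k + real i / real (Suc n)) / real p"
    show "\<tau> n k i = ?q * t"
      unfolding \<tau>_def grid_def \<rho>_Suc by (simp only: \<rho>_def) (simp add: add_divide_distrib algebra_simps)
    show "?q \<in> \<rat>" by (intro Rats_divide Rats_add) auto
    show "0 \<le> ?q" by simp
    have "real i / real (Suc n) \<le> 1" using that by simp
    then have "real k + real i / real (Suc n) \<le> real p" using that by linarith
    then show "?q \<le> 1" using \<open>0 < p\<close> by simp
  qed
  have H_F: "H s \<in> borel_measurable (F s)" if "0 \<le> s" for s
    using ito that by (simp add: ito_integral_def adapted_process_def)
  define \<xi> where "\<xi> n k i \<omega> = max (- N) (min N (H (\<tau> n k i) \<omega>))" for n k i \<omega>
  have \<xi>_F: "\<xi> n k i \<in> borel_measurable (F (\<tau> n k i))" for n k i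
  proof -
    note [measurable] = H_F[OF \<tau>_nonneg[of n k i]]
    show ?thesis unfolding \<xi>_def by measurable
  qed
  have \<xi>_N: "\<bar>\<xi> n k i \<omega>\<bar> \<le> N" for n k i \<omega>
    using \<open>0 \<le> N\<close> by (auto simp: \<xi>_def)
  have \<xi>_eq: "\<xi> n k i \<omega> = H (\<tau> n k i) \<omega>" if "\<omega> \<in> A" and ki: "k < p" "i < Suc n" for n k i \<omega>
  proof -
    obtain q where "q \<in> \<rat>" "0 \<le> q" "q \<le> 1" "\<tau> n k i = q * t" using \<tau>_rat[OF ki] by blast
    then have "\<bar>H (\<tau> n k i) \<omega>\<bar> \<le> N" using bdd[OF \<open>\<omega> \<in> A\<close>, of q] by simp
    then show ?thesis by (simp add: \<xi>_def)
  qed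
  define V where "V n \<omega> = (\<Sum>k<p. (\<Sum>i<Suc n. \<xi> n k i \<omega> * (W (\<tau> n k (Suc i)) \<omega> - W (\<tau> n k i) \<omega>))\<^sup>2
      - (\<Sum>i<Suc n. (\<xi> n k i \<omega>)\<^sup>2 * (\<tau> n k (Suc i) - \<tau> n k i)))" for n \<omega>
  define S where "S n k \<omega> = (\<Sum>i<Suc n. H (\<tau> n k i) \<omega> * (W (\<tau> n k (Suc i)) \<omega> - W (\<tau> n k i) \<omega>))" for n k \<omega>
  \<comment> \<open>The errors of all \<open>p\<close> blocks are added, so that one subsequence
    serves every block.\<close>
  define T where "T n \<omega> = (\<Sum>k<p. \<bar>S n k \<omega> - (X (\<rho> (Suc k)) \<omega> - X (\<rho> k) \<omega>)\<bar>)" for n \<omega>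
  define D where "D \<omega> = (\<Sum>k<p. (X (\<rho> (Suc k)) \<omega> - X (\<rho> k) \<omega>)\<^sup>2) - (LINT s:{0..t}|lborel. (H s \<omega>)\<^sup>2)" for \<omega>
  have V: "V n \<in> borel_measurable (F t)" "integrable M (\<lambda>\<omega>. (V n \<omega>)\<^sup>2)"
    "expectation (\<lambda>\<omega>. (V n \<omega>)\<^sup>2) \<le> 4 * N ^ 4 * t\<^sup>2 / real p" for n
  proof -
    have "(\<Sum>k<p. 4 * N ^ 4 * (\<rho> (Suc k) - \<rho> k)\<^sup>2) = 4 * N ^ 4 * t\<^sup>2 / real p"
      using \<open>0 < p\<close> by (simp add: \<rho>_Suc power_divide power2_eq_square)
    then show "V n \<in> borel_measurable (F t)" "integrable M (\<lambda>\<omega>. (V n \<omega>)\<^sup>2)"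
      "expectation (\<lambda>\<omega>. (V n \<omega>)\<^sup>2) \<le> 4 * N ^ 4 * t\<^sup>2 / real p"
      using discrete_variation[of p "\<tau> n" \<rho> "Suc n" "\<xi> n" N, OF \<tau>_ends _ \<tau>_le \<xi>_F \<xi>_N] \<rho>0
      unfolding V_def \<rho>p by simp_all
  qed
  have S_meas: "S n k \<in> borel_measurable M" for n k
    unfolding S_def
    by (rule measurable_filtration[OF discrete_integral_measurable[where \<tau>="\<tau> n k" and n="Suc n"]])
      (auto intro: \<tau>_le H_F \<tau>_nonneg)
  have X_meas: "X (\<rho> k) \<in> borel_measurable M" for k
    by (rule ito_integral_measurable[OF ito \<rho>_nonneg])
  have T_meas: "T n \<in> borel_measurable M" for n
    unfolding T_def using S_meas X_meas by measurable
  have T_lim: "(\<lambda>n. prob {\<omega>\<in>space M. \<bar>T n \<omega>\<bar> > \<epsilon>}) \<longlonglongrightarrow> 0" if "0 < \<epsilon>" for \<epsilon>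
  proof -
    define B where "B n k = {\<omega>\<in>space M. \<bar>S n k \<omega> - (X (\<rho> (Suc k)) \<omega> - X (\<rho> k) \<omega>)\<bar> > \<epsilon> / real p}" for n k
    have B_ev: "B n k \<in> events" for n k
    proof -
      note [measurable] = S_meas[of n k] X_meas[of k] X_meas[of "Suc k"]
      show ?thesis unfolding B_def by measurable
    qed
    have "(\<lambda>n. prob (B n k)) \<longlonglongrightarrow> 0" for k
      unfolding B_def S_def \<tau>_def using that \<open>0 < p\<close>
      by (intro ito_grid_converges[OF ito cont \<rho>_nonneg \<rho>_less]) simp
    then have sum0: "(\<lambda>n. \<Sum>k<p. prob (B n k)) \<longlonglongrightarrow> (\<Sum>k<p. 0)" by (intro tendsto_sum)
    have le: "prob {\<omega>\<in>space M. \<bar>T n \<omega>\<bar> > \<epsilon>} \<le> (\<Sum>k<p. prob (B n k))" for n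
    proof -
      have "{\<omega>\<in>space M. \<bar>T n \<omega>\<bar> > \<epsilon>} \<subseteq> (\<Union>k<p. B n k)"
      proof (rule subsetI, rule ccontr)
        fix \<omega> assume \<omega>: "\<omega> \<in> {\<omega>\<in>space M. \<bar>T n \<omega>\<bar> > \<epsilon>}" and not: "\<omega> \<notin> (\<Union>k<p. B n k)"
        have "T n \<omega> \<le> (\<Sum>k<p. \<epsilon> / real p)"
          unfolding T_def using \<omega> not by (intro sum_mono) (auto simp: B_def not_less)
        moreover have "0 \<le> T n \<omega>" unfolding T_def by (intro sum_nonneg) simp
        ultimately show False using \<omega> \<open>0 < p\<close> by simp
      qed
      then have "prob {\<omega>\<in>space M. \<bar>T n \<omega>\<bar> > \<epsilon>} \<le> prob (\<Union>k<p. B n k)"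
        using B_ev by (intro finite_measure_mono) auto
      also have "\<dots> \<le> (\<Sum>k<p. prob (B n k))" using B_ev by (intro measure_UNION_le) auto
      finally show ?thesis .
    qed
    show ?thesis
      by (rule tendsto_sandwich[OF _ _ tendsto_const sum0[simplified]]) (use le in auto)
  qed
  obtain \<phi> where \<phi>: "strict_mono \<phi>" "AE \<omega> in M. (\<lambda>n. T (\<phi> n) \<omega>) \<longlonglongrightarrow> 0"
    using in_probability_AE_subseq[OF T_meas T_lim] by blast
  have lim: "AE \<omega> in M. \<omega> \<in> A \<longrightarrow> (\<lambda>n. V (\<phi> n) \<omega>) \<longlonglongrightarrow> D \<omega>"
    using \<phi>(2) cont
  proof eventually_elim
    case (elim \<omega>)
    show ?case
    proof
      assume \<omega>: "\<omega> \<in> A"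
      have cH: "continuous_on {u..v} (\<lambda>s. (H s \<omega>)\<^sup>2)" if "0 \<le> u" for u v
        using that by (intro continuous_intros continuous_on_subset[OF elim(2)]) auto
      have S_lim: "(\<lambda>n. S (\<phi> n) k \<omega>) \<longlonglongrightarrow> X (\<rho> (Suc k)) \<omega> - X (\<rho> k) \<omega>" if "k < p" for k
      proof -
        have "(\<lambda>n. \<bar>S (\<phi> n) k \<omega> - (X (\<rho> (Suc k)) \<omega> - X (\<rho> k) \<omega>)\<bar>) \<longlonglongrightarrow> 0"
        proof (rule tendsto_sandwich[OF _ _ tendsto_const elim(1)])
          show "\<forall>\<^sub>F n in sequentially. \<bar>S (\<phi> n) k \<omega> - (X (\<rho> (Suc k)) \<omega> - X (\<rho> k) \<omega>)\<bar> \<le> T (\<phi> n) \<omega>"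
            unfolding T_def using that
            by (intro always_eventually allI member_le_sum[where f="\<lambda>k. \<bar>S _ k \<omega> - (X (\<rho> (Suc k)) \<omega> - X (\<rho> k) \<omega>)\<bar>"]) auto
        qed simp
        then show ?thesis by (simp add: tendsto_rabs_zero_iff LIM_zero_iff)
      qed
      have Q_lim: "(\<lambda>n. \<Sum>i<Suc (\<phi> n). (H (\<tau> (\<phi> n) k i) \<omega>)\<^sup>2 * (\<tau> (\<phi> n) k (Suc i) - \<tau> (\<phi> n) k i))
          \<longlonglongrightarrow> (LINT s:{\<rho> k..\<rho> (Suc k)}|lborel. (H s \<omega>)\<^sup>2)" for k
        using LIMSEQ_subseq_LIMSEQ[OF grid_sum_tendsto[OF cH[OF \<rho>_nonneg] less_imp_le[OF \<rho>_less]] \<phi>(1)]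
        unfolding \<tau>_def comp_def .
      have "V (\<phi> n) \<omega> = (\<Sum>k<p. (S (\<phi> n) k \<omega>)\<^sup>2 - (\<Sum>i<Suc (\<phi> n). (H (\<tau> (\<phi> n) k i) \<omega>)\<^sup>2 * (\<tau> (\<phi> n) k (Suc i) - \<tau> (\<phi> n) k i)))" for n
        unfolding V_def S_def using \<xi>_eq[OF \<omega>] by (intro sum.cong arg_cong2[where f="(-)"] arg_cong[where f=power2] refl) auto
      moreover have "(\<lambda>n. \<Sum>k<p. (S (\<phi> n) k \<omega>)\<^sup>2 - (\<Sum>i<Suc (\<phi> n). (H (\<tau> (\<phi> n) k i) \<omega>)\<^sup>2 * (\<tau> (\<phi> n) k (Suc i) - \<tau> (\<phi> n) k i)))
        \<longlonglongrightarrow> (\<Sum>k<p. (X (\<rho> (Suc k)) \<omega> - X (\<rho> k) \<omega>)\<^sup>2 - (LINT s:{\<rho> k..\<rho> (Suc k)}|lborel. (H s \<omega>)\<^sup>2))"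
        by (intro tendsto_sum tendsto_diff tendsto_power S_lim Q_lim) auto
      moreover have "(\<Sum>k<p. LINT s:{\<rho> k..\<rho> (Suc k)}|lborel. (H s \<omega>)\<^sup>2) = (LINT s:{0..t}|lborel. (H s \<omega>)\<^sup>2)"
        using set_integral_sum_partition[of \<rho> p "\<lambda>s. (H s \<omega>)\<^sup>2"] cH[of 0 t] \<rho>_less \<rho>0 \<rho>p by (simp add: less_imp_le)
      ultimately show "(\<lambda>n. V (\<phi> n) \<omega>) \<longlonglongrightarrow> D \<omega>" by (simp add: D_def sum_subtractf)
    qed
  qed
  have "(\<integral>\<^sup>+\<omega>. ennreal ((D \<omega>)\<^sup>2) * indicator A \<omega> \<partial>M) \<le> (\<integral>\<^sup>+\<omega>. liminf (\<lambda>n. ennreal ((V (\<phi> n) \<omega>)\<^sup>2) * indicator A \<omega>) \<partial>M)"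
  proof (rule nn_integral_mono_AE)
    show "AE \<omega> in M. ennreal ((D \<omega>)\<^sup>2) * indicator A \<omega> \<le> liminf (\<lambda>n. ennreal ((V (\<phi> n) \<omega>)\<^sup>2) * indicator A \<omega>)"
      using lim
    proof eventually_elim
      case (elim \<omega>)
      show ?case
      proof (cases "\<omega> \<in> A")
        case True
        with elim have "(\<lambda>n. ennreal ((V (\<phi> n) \<omega>)\<^sup>2)) \<longlonglongrightarrow> ennreal ((D \<omega>)\<^sup>2)"
          by (intro tendsto_ennrealI tendsto_power) simp
        from lim_imp_Liminf[OF _ this] True show ?thesis by simp
      qed simp
    qed
  qed
  also have "\<dots> \<le> liminf (\<lambda>n. \<integral>\<^sup>+\<omega>. ennreal ((V (\<phi> n) \<omega>)\<^sup>2) * indicator A \<omega> \<partial>M)"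
  proof (rule nn_integral_liminf)
    fix n
    note [measurable] = measurable_filtration[OF V(1)[of "\<phi> n"]] A
    show "(\<lambda>\<omega>. ennreal ((V (\<phi> n) \<omega>)\<^sup>2) * indicator A \<omega>) \<in> borel_measurable M" by measurable
  qed
  also have "\<dots> \<le> liminf (\<lambda>n::nat. ennreal (4 * N ^ 4 * t\<^sup>2 / real p))"
  proof (intro Liminf_mono always_eventually allI)
    fix n
    have "(\<integral>\<^sup>+\<omega>. ennreal ((V (\<phi> n) \<omega>)\<^sup>2) * indicator A \<omega> \<partial>M) \<le> (\<integral>\<^sup>+\<omega>. ennreal ((V (\<phi> n) \<omega>)\<^sup>2) \<partial>M)"
      by (intro nn_integral_mono) (auto simp: indicator_def)
    also have "\<dots> = ennreal (expectation (\<lambda>\<omega>. (V (\<phi> n) \<omega>)\<^sup>2))"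
      using V(2) by (intro nn_integral_eq_integral) auto
    also have "\<dots> \<le> ennreal (4 * N ^ 4 * t\<^sup>2 / real p)" using V(3) by (rule ennreal_leI)
    finally show "(\<integral>\<^sup>+\<omega>. ennreal ((V (\<phi> n) \<omega>)\<^sup>2) * indicator A \<omega> \<partial>M) \<le> ennreal (4 * N ^ 4 * t\<^sup>2 / real p)" .
  qed
  also have "\<dots> = ennreal (4 * N ^ 4 * t\<^sup>2 / real p)" by (simp add: Liminf_const)
  finally show ?thesis unfolding D_def \<rho>_def .
qed

lemma ito_quadratic_variation:
  assumes ito: "ito_integral M F W H X" and cont: "AE \<omega> in M. continuous_on {0..} (\<lambda>s. H s \<omega>)" and "0 \<le> t"
  shows "AE \<omega> in M. (\<lambda>n. \<Sum>k<2^n. (X (real (Suc k) * t / 2 ^ n) \<omega> - X (real k * t / 2 ^ n) \<omega>)\<^sup>2)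
      \<longlonglongrightarrow> (LINT s:{0..t}|lborel. (H s \<omega>)\<^sup>2)"
proof (cases "t = 0")
  case True
  have "(LINT s:{0..0}|lborel. (H s \<omega>)\<^sup>2) = 0" for \<omega>
    using step_function_integral[of 0 "\<lambda>_. 0" "\<lambda>s. (H s \<omega>)\<^sup>2"] by simp
  with True show ?thesis by simp
next
  case False
  with \<open>0 \<le> t\<close> have "0 < t" by simp
  define A where "A N = {\<omega>\<in>space M. \<forall>q\<in>\<rat> \<inter> {0..1}. \<bar>H (q * t) \<omega>\<bar> \<le> real N}" for N :: nat
  define D where "D n \<omega> = (\<Sum>k<2^n. (X (real (Suc k) * t / 2 ^ n) \<omega> - X (real k * t / 2 ^ n) \<omega>)\<^sup>2)
      - (LINT s:{0..t}|lborel. (H s \<omega>)\<^sup>2)" for n \<omega>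
  have A_ev: "A N \<in> events" for N
    unfolding A_def
  proof (rule sets.sets_Collect_countable_All')
    show "countable (\<rat> \<inter> {0..1::real})" by (intro countable_Int1 countable_rat)
    fix q :: real assume "q \<in> \<rat> \<inter> {0..1}"
    then have "0 \<le> q * t" using \<open>0 < t\<close> by simp
    then have "H (q * t) \<in> borel_measurable (F (q * t))"
      using ito by (simp add: ito_integral_def adapted_process_def)
    then have [measurable]: "H (q * t) \<in> borel_measurable M" by (rule measurable_filtration)
    show "{\<omega>\<in>space M. \<bar>H (q * t) \<omega>\<bar> \<le> real N} \<in> events" by measurable
  qed
  have D_meas: "D n \<in> borel_measurable M" for n
  proof -
    have "X (real k * t / 2 ^ n) \<in> borel_measurable M" for k
      using \<open>0 < t\<close> by (intro ito_integral_measurable[OF ito]) simp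
    then show ?thesis
      unfolding D_def using square_integral_measurable[OF ito] by measurable
  qed
  have conv: "AE \<omega> in M. \<omega> \<in> A N \<longrightarrow> (\<lambda>n. D n \<omega>) \<longlonglongrightarrow> 0" for N
  proof -
    define C where "C = 4 * real N ^ 4 * t\<^sup>2"
    have g_meas: "(\<lambda>\<omega>. ennreal ((D n \<omega>)\<^sup>2) * indicator (A N) \<omega>) \<in> borel_measurable M" for n
      using D_meas A_ev by measurable
    have le: "(\<integral>\<^sup>+\<omega>. ennreal ((D n \<omega>)\<^sup>2) * indicator (A N) \<omega> \<partial>M) \<le> ennreal (C * (1 / 2) ^ n)" for n
    proof -
      have "\<bar>H (q * t) \<omega>\<bar> \<le> real N" if "\<omega> \<in> A N" "q \<in> \<rat>" "0 \<le> q" "q \<le> 1" for \<omega> q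
        using that by (auto simp: A_def)
      note bound = ito_variation_bound[OF ito cont \<open>0 < t\<close> of_nat_0_le_iff _ A_ev this, where p="2 ^ n"]
      have "C * (1 / 2) ^ n = 4 * real N ^ 4 * t\<^sup>2 / real (2 ^ n)" by (simp add: C_def power_one_over)
      then show ?thesis using bound[of N] unfolding D_def by simp
    qed
    have "(\<integral>\<^sup>+\<omega>. (\<Sum>n. ennreal ((D n \<omega>)\<^sup>2) * indicator (A N) \<omega>) \<partial>M) \<le> (\<Sum>n. ennreal (C * (1 / 2) ^ n))"
      unfolding nn_integral_suminf[OF g_meas] by (intro suminf_le le summableI)
    also have "\<dots> = ennreal (\<Sum>n. C * (1 / 2) ^ n)"
      by (intro suminf_ennreal2 summable_mult summable_geometric) (auto simp: C_def)
    also have "\<dots> < \<infinity>" by simp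
    finally have "(\<integral>\<^sup>+\<omega>. (\<Sum>n. ennreal ((D n \<omega>)\<^sup>2) * indicator (A N) \<omega>) \<partial>M) \<noteq> \<infinity>" by simp
    then have "AE \<omega> in M. (\<Sum>n. ennreal ((D n \<omega>)\<^sup>2) * indicator (A N) \<omega>) \<noteq> \<infinity>"
      by (rule nn_integral_PInf_AE[OF borel_measurable_suminf_order[OF g_meas]])
    then show ?thesis
    proof eventually_elim
      case (elim \<omega>)
      show ?case
      proof
        assume "\<omega> \<in> A N"
        with elim have "summable (\<lambda>n. (D n \<omega>)\<^sup>2)"
          by (intro summable_suminf_not_top) auto
        then have "(\<lambda>n. (D n \<omega>)\<^sup>2) \<longlonglongrightarrow> 0" by (rule summable_LIMSEQ_zero)
        then have "(\<lambda>n. sqrt ((D n \<omega>)\<^sup>2)) \<longlonglongrightarrow> sqrt 0" by (intro tendsto_real_sqrt)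
        then show "(\<lambda>n. D n \<omega>) \<longlonglongrightarrow> 0" by (simp add: tendsto_rabs_zero_iff)
      qed
    qed
  qed
  then have "AE \<omega> in M. \<forall>N. \<omega> \<in> A N \<longrightarrow> (\<lambda>n. D n \<omega>) \<longlonglongrightarrow> 0"
    unfolding AE_all_countable by blast
  with cont AE_space show ?thesis
  proof eventually_elim
    case (elim \<omega>)
    \<comment> \<open>A continuous path is bounded on \<open>{0..t}\<close>, so almost every outcome
      lies in some \<open>A N\<close>.\<close>
    have "compact ((\<lambda>s. H s \<omega>) ` {0..t})"
      by (intro compact_continuous_image continuous_on_subset[OF elim(1)]) auto
    then obtain B where B: "\<forall>s\<in>{0..t}. \<bar>H s \<omega>\<bar> \<le> B"
      by (auto dest!: compact_imp_bounded simp: bounded_iff)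
    obtain N :: nat where N: "B \<le> real N" using real_arch_simple by blast
    have "\<bar>H (q * t) \<omega>\<bar> \<le> real N" if "q \<in> \<rat> \<inter> {0..1}" for q
    proof -
      have "q * t \<in> {0..t}" using that \<open>0 < t\<close> by (auto simp: mult_le_cancel_right1)
      with B N show ?thesis by fastforce
    qed
    then have "\<omega> \<in> A N" using elim by (auto simp: A_def)
    then have "(\<lambda>n. D n \<omega>) \<longlonglongrightarrow> 0" using elim by blast
    then show ?case by (simp add: D_def LIM_zero_iff)
  qed
qed

lemma simple_integral_0: "elementary F K \<Longrightarrow> simple_integral W K 0 \<omega> = 0"
proof (induction K)
  case (Cons k K)
  obtain s t \<xi> where k: "k = (s, t, \<xi>)" by (cases k)
  then have "0 \<le> s" "s < t" "elementary F K" using Cons.prems by simp_all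
  then show ?case using Cons.IH by (simp add: k min_def)
qed simp

text \<open>The definition fixes \<open>X 0\<close> only as a limit in probability of simple
  integrals up to time 0. These vanish, and a constant sequence that tends to 0 in probability is 0
  almost surely.\<close>

lemma ito_integral_0:
  assumes "ito_integral M F W H X"
  shows "AE \<omega> in M. X 0 \<omega> = 0"
proof -
  obtain K where K: "\<And>n. simple_process F (K n)"
    and conv: "tendsto_in_probability M (\<lambda>n. simple_integral W (K n) 0) (X 0)"
    using assms unfolding ito_integral_def by blast
  have "simple_integral W (K n) 0 \<omega> = 0" for n \<omega>
    using K simple_process_elementary simple_integral_0 by blast
  with conv have "(\<lambda>n::nat. prob {\<omega>\<in>space M. \<bar>X 0 \<omega>\<bar> > \<epsilon>}) \<longlonglongrightarrow> 0" if "0 < \<epsilon>" for \<epsilon>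
    using that by (simp add: tendsto_in_probability_def)
  from in_probability_AE_subseq[OF _ this] ito_integral_measurable[OF assms order_refl]
  obtain \<phi> :: "nat \<Rightarrow> nat" where "AE \<omega> in M. (\<lambda>n. X 0 \<omega>) \<longlonglongrightarrow> 0" by blast
  then show ?thesis by eventually_elim (simp add: LIMSEQ_const_iff)
qed

end

section \<open>The logarithmic estimator\<close>

text \<open>Working within \<open>{0..}\<close> covers the right derivative at \<open>t = 0\<close>
  and the two-sided one at \<open>t > 0\<close> by a single statement.\<close>

lemma set_integral_has_derivative:
  fixes f :: "real \<Rightarrow> real"
  assumes f: "continuous_on {0..} f" and "0 \<le> t"
  shows "((\<lambda>u. LINT s:{0..u}|lborel. f s) has_real_derivative f t) (at t within {0..})"
proof -
  have c: "continuous_on {0..u} f" for u by (rule continuous_on_subset[OF f]) auto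
  have "((\<lambda>u. integral {0..u} f) has_real_derivative f t) (at t within {0..t + 1})"
    using \<open>0 \<le> t\<close> by (intro integral_has_real_derivative c) auto
  \<comment> \<open>The end \<open>t + 1\<close> only makes the interval compact; a neighbourhood of
    \<open>t\<close> does not see it.\<close>
  also have "at t within {0..t + 1} = at t within {0..}"
    by (rule at_within_nhd[of _ "{t - 1<..<t + 1}"]) auto
  also have "(\<lambda>u. integral {0..u} f) = (\<lambda>u. LINT s:{0..u}|lborel. f s)"
    using set_borel_integral_eq_integral(2)[OF borel_integrable_atLeastAtMost'[OF c]] by (simp add: fun_eq_iff)
  finally show ?thesis .
qed

lemma set_integral_continuous:
  fixes f :: "real \<Rightarrow> real"
  assumes "continuous_on {0..} f"
  shows "continuous_on {0..} (\<lambda>u. LINT s:{0..u}|lborel. f s)"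
  by (rule DERIV_continuous_on[OF set_integral_has_derivative[OF assms]]) simp

lemma set_integral_increment_bound:
  fixes f :: "real \<Rightarrow> real"
  assumes f: "continuous_on {0..v} f" and uv: "0 \<le> u" "u \<le> v" and C: "\<And>s. s \<in> {0..v} \<Longrightarrow> \<bar>f s\<bar> \<le> C"
  shows "\<bar>(LINT s:{0..v}|lborel. f s) - (LINT s:{0..u}|lborel. f s)\<bar> \<le> C * (v - u)"
proof -
  have c: "continuous_on {u..v} f" using uv by (intro continuous_on_subset[OF f]) auto
  have "(LINT s:{0..v}|lborel. f s) - (LINT s:{0..u}|lborel. f s) = (LINT s:{u..v}|lborel. f s)"
    using set_integral_combine[OF f uv] by simp
  also have "\<dots> = integral {u..v} f"
    by (rule set_borel_integral_eq_integral(2)[OF borel_integrable_atLeastAtMost'[OF c]])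
  finally show ?thesis
    using integral_bound[OF uv(2) c, of C] C uv by simp
qed

text \<open>By the Cauchy-Schwarz inequality the cross term is at most the square root of a product
  that tends to \<open>L * 0\<close>. This is how the drift leaves the quadratic variation of
  \<open>X\<close> unchanged.\<close>

lemma sum_square_perturbation:
  fixes x y :: "nat \<Rightarrow> nat \<Rightarrow> real"
  assumes x: "(\<lambda>n. \<Sum>k\<in>I n. (x n k)\<^sup>2) \<longlonglongrightarrow> L" and y: "(\<lambda>n. \<Sum>k\<in>I n. (y n k)\<^sup>2) \<longlonglongrightarrow> 0"
  shows "(\<lambda>n. \<Sum>k\<in>I n. (x n k + y n k)\<^sup>2) \<longlonglongrightarrow> L"
proof -
  have "(\<lambda>n. sqrt ((\<Sum>k\<in>I n. (x n k)\<^sup>2) * (\<Sum>k\<in>I n. (y n k)\<^sup>2))) \<longlonglongrightarrow> sqrt (L * 0)"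
    by (intro tendsto_intros x y)
  then have bound: "(\<lambda>n. sqrt ((\<Sum>k\<in>I n. (x n k)\<^sup>2) * (\<Sum>k\<in>I n. (y n k)\<^sup>2))) \<longlonglongrightarrow> 0" by simp
  have "(\<lambda>n. \<Sum>k\<in>I n. x n k * y n k) \<longlonglongrightarrow> 0"
  proof (rule Lim_null_comparison[OF always_eventually bound], rule allI)
    fix n
    have "\<bar>\<Sum>k\<in>I n. x n k * y n k\<bar> = sqrt ((\<Sum>k\<in>I n. x n k * y n k)\<^sup>2)" by simp
    also have "\<dots> \<le> sqrt ((\<Sum>k\<in>I n. (x n k)\<^sup>2) * (\<Sum>k\<in>I n. (y n k)\<^sup>2))"
      by (intro real_sqrt_le_mono Cauchy_Schwarz_ineq_sum)
    finally show "norm (\<Sum>k\<in>I n. x n k * y n k) \<le> sqrt ((\<Sum>k\<in>I n. (x n k)\<^sup>2) * (\<Sum>k\<in>I n. (y n k)\<^sup>2))" by simp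
  qed
  then have "(\<lambda>n. (\<Sum>k\<in>I n. (x n k)\<^sup>2) + (\<Sum>k\<in>I n. (y n k)\<^sup>2) + 2 * (\<Sum>k\<in>I n. x n k * y n k)) \<longlonglongrightarrow> L + 0 + 2 * 0"
    by (intro tendsto_intros x y)
  then show ?thesis by (simp add: power2_sum sum.distrib sum_distrib_left mult.assoc)
qed

text \<open>There are \<open>2 ^ n\<close> terms of size at most
  \<open>(C * t / 2 ^ n)\<^sup>2\<close>, so the sum decays like \<open>(1 / 2) ^ n\<close>.\<close>

lemma dyadic_square_sum_lipschitz:
  fixes g :: "real \<Rightarrow> real"
  assumes g: "\<And>u v. 0 \<le> u \<Longrightarrow> u \<le> v \<Longrightarrow> v \<le> t \<Longrightarrow> \<bar>g v - g u\<bar> \<le> C * (v - u)" and "0 \<le> t"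
  shows "(\<lambda>n. \<Sum>k<2^n. (g (real (Suc k) * t / 2 ^ n) - g (real k * t / 2 ^ n))\<^sup>2) \<longlonglongrightarrow> 0"
proof -
  have bound: "(\<Sum>k<2^n. (g (real (Suc k) * t / 2 ^ n) - g (real k * t / 2 ^ n))\<^sup>2) \<le> (C * t)\<^sup>2 * (1 / 2) ^ n" for n
  proof -
    have "(g (real (Suc k) * t / 2 ^ n) - g (real k * t / 2 ^ n))\<^sup>2 \<le> (C * t / 2 ^ n)\<^sup>2" if "k < 2 ^ n" for k
    proof -
      have "real (Suc k) \<le> 2 ^ n" using that by (metis Suc_leI of_nat_le_iff of_nat_numeral of_nat_power)
      then have "real (Suc k) * t / 2 ^ n \<le> t" using \<open>0 \<le> t\<close> by (simp add: pos_divide_le_eq mult.commute mult_left_mono)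
      moreover have "real k * t / 2 ^ n \<le> real (Suc k) * t / 2 ^ n"
        using \<open>0 \<le> t\<close> by (intro divide_right_mono mult_right_mono) auto
      ultimately have "\<bar>g (real (Suc k) * t / 2 ^ n) - g (real k * t / 2 ^ n)\<bar> \<le> C * (real (Suc k) * t / 2 ^ n - real k * t / 2 ^ n)"
        using \<open>0 \<le> t\<close> by (intro g) auto
      also have "\<dots> = C * t / 2 ^ n" by (simp add: distrib_right add_divide_distrib)
      finally show ?thesis by (metis abs_ge_zero power2_abs power_mono)
    qed
    then have "(\<Sum>k<2^n. (g (real (Suc k) * t / 2 ^ n) - g (real k * t / 2 ^ n))\<^sup>2) \<le> (\<Sum>k<2^n::nat. (C * t / 2 ^ n)\<^sup>2)"
      by (intro sum_mono) auto
    also have "\<dots> = (C * t)\<^sup>2 * (1 / 2) ^ n" by (simp add: power_divide power_one_over power2_eq_square)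
    finally show ?thesis .
  qed
  have "(\<lambda>n. (C * t)\<^sup>2 * (1 / 2) ^ n) \<longlonglongrightarrow> (C * t)\<^sup>2 * 0"
    by (intro tendsto_mult tendsto_const LIMSEQ_power_zero) simp
  then have "(\<lambda>n. (C * t)\<^sup>2 * (1 / 2) ^ n) \<longlonglongrightarrow> 0" by simp
  from tendsto_sandwich[OF _ _ tendsto_const this] bound show ?thesis
    by (simp add: sum_nonneg)
qed

lemma continuous_on_eq_Rats:
  fixes f g :: "real \<Rightarrow> real"
  assumes f: "continuous_on {0..} f" and g: "continuous_on {0..} g"
    and eq: "\<And>q. q \<in> \<rat> \<Longrightarrow> 0 \<le> q \<Longrightarrow> f q = g q" and "0 \<le> t"
  shows "f t = g t"
proof -
  \<comment> \<open>Approximation from the right keeps the rationals in \<open>{0..}\<close>, also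
    for \<open>t = 0\<close>.\<close>
  have "\<exists>q\<in>\<rat>. t < q \<and> q < t + 1 / real (Suc n)" for n
    by (intro Rats_dense_in_real) simp
  then obtain q where q: "\<And>n. q n \<in> \<rat>" "\<And>n. t < q n" "\<And>n. q n < t + 1 / real (Suc n)" by metis
  have q_lim: "q \<longlonglongrightarrow> t"
  proof (rule tendsto_sandwich[OF _ _ tendsto_const])
    have "(\<lambda>n. t + 1 / real (Suc n)) \<longlonglongrightarrow> t + 0"
      by (intro tendsto_add tendsto_const LIMSEQ_Suc[OF lim_const_over_n])
    then show "(\<lambda>n. t + 1 / real (Suc n)) \<longlonglongrightarrow> t" by simp
  qed (use q in \<open>simp_all add: less_imp_le del: of_nat_Suc\<close>)
  have q0: "0 \<le> q n" for n using q(2)[of n] \<open>0 \<le> t\<close> by simp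
  have "(\<lambda>n. f (q n)) \<longlonglongrightarrow> f t" "(\<lambda>n. g (q n)) \<longlonglongrightarrow> g t"
    using continuous_on_tendsto_compose[OF f q_lim] continuous_on_tendsto_compose[OF g q_lim] q0 \<open>0 \<le> t\<close> by auto
  with eq[OF q(1) q0] show ?thesis by (simp add: LIMSEQ_unique)
qed

text \<open>At each fixed time both processes are limits of the same sums. A common null set for the
  rational times, together with continuity, serves all times, so the limit in \<open>h\<close> need
  only be computed for one explicit version.\<close>

lemma quadratic_variation_indistinguishable:
  assumes Q: "quadratic_variation M r Q" "quadratic_variation M r Q'"
  shows "AE \<omega> in M. \<forall>t\<ge>0. Q t \<omega> = Q' t \<omega>"
proof -
  have "AE \<omega> in M. Q t \<omega> = Q' t \<omega>" if "0 \<le> t" for t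
    using Q[unfolded quadratic_variation_def, THEN conjunct2, THEN conjunct2, rule_format, OF that]
    by eventually_elim (rule LIMSEQ_unique)
  then have "AE \<omega> in M. \<forall>q\<in>\<rat> \<inter> {0..}. Q q \<omega> = Q' q \<omega>"
    by (subst AE_ball_countable) (auto intro: countable_Int1 countable_rat)
  moreover have "AE \<omega> in M. continuous_on {0..} (\<lambda>t. Q t \<omega>)" "AE \<omega> in M. continuous_on {0..} (\<lambda>t. Q' t \<omega>)"
    using Q by (auto simp: quadratic_variation_def)
  ultimately show ?thesis
  proof eventually_elim
    case (elim \<omega>)
    show ?case
    proof (intro allI impI)
      fix t :: real assume "0 \<le> t"
      show "Q t \<omega> = Q' t \<omega>"
        by (rule continuous_on_eq_Rats[OF elim(2,3) _ \<open>0 \<le> t\<close>]) (use elim(1) in auto)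
    qed
  qed
qed

text \<open>The shift by \<open>t\<close> maps \<open>{-t..}\<close> to \<open>{0..}\<close>: the
  limit in \<open>h\<close> is two-sided for \<open>t > 0\<close> and one-sided at
  \<open>t = 0\<close>, where there is no past.\<close>

lemma difference_quotient_tendsto:
  fixes f :: "real \<Rightarrow> real"
  assumes "(f has_real_derivative D) (at t within {0..})"
  shows "((\<lambda>h. (f (t + h) - f t) / h) \<longlongrightarrow> D) (at 0 within {-t..})"
proof -
  have "((\<lambda>y. (f y - f t) / (y - t)) \<longlongrightarrow> D) (at t within {0..})"
    using assms by (simp add: has_field_derivative_iff)
  moreover have "filterlim (\<lambda>h. t + h) (at t within {0..}) (at 0 within {-t..})"
    unfolding filterlim_at
  proof
    show "((\<lambda>h. t + h) \<longlongrightarrow> t) (at 0 within {-t..})"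
      by (rule tendsto_eq_intros refl | simp)+
    show "\<forall>\<^sub>F h in at 0 within {-t..}. t + h \<in> {0..} \<and> t + h \<noteq> t"
      unfolding eventually_at_filter by (intro always_eventually) auto
  qed
  ultimately have "((\<lambda>h. (f (t + h) - f t) / (t + h - t)) \<longlongrightarrow> D) (at 0 within {-t..})"
    by (rule filterlim_compose)
  then show ?thesis by simp
qed

text \<open>Where \<open>r t\<close> equals 1 the denominator is 0, and the quotient takes the
  default value 0 for every \<open>h\<close>. At \<open>t = 0\<close> this is excluded by
  \<open>r0 \<noteq> 1\<close>; at \<open>t > 0\<close> it has probability 0. Existence is stated
  beside the claim on all versions \<open>Q\<close>, so that the latter is not vacuous.\<close>

theorem proposition5p1:
  fixes M :: "'a measure"
    and W r :: "real \<Rightarrow> 'a \<Rightarrow> real"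
    and a b \<sigma> \<beta> r0 T :: real
  assumes "prob_space M"
    and "wiener_process M W"
    and "a > 0" and "b > 0" and "\<sigma> > 0" and "1/2 < \<beta>" and "\<beta> < 1" and "r0 > 0"
    and "strong_solution M W (\<lambda>x. a - b * x) (\<lambda>x. \<sigma> * x powr \<beta>) r0 r"
    and "AE \<omega> in M. \<forall>t\<ge>0. r t \<omega> > 0"
    and "T > 0"
  shows "(\<exists>Q. quadratic_variation M r Q) \<and>
    (\<forall>Q. quadratic_variation M r Q \<longrightarrow>
      (\<forall>t\<in>{0..T}. (t = 0 \<longrightarrow> r0 \<noteq> 1) \<longrightarrow>
        (AE \<omega> in M.
          ((\<lambda>h. ln ((Q (t + h) \<omega> - Q t \<omega>) / (\<sigma>\<^sup>2 * h)) / (2 * ln (r t \<omega>)))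
             \<longlongrightarrow> \<beta>) (at 0 within {-t..}))))"
proof -
  interpret brownian M W
    using assms(1,2) by (simp add: brownian_def brownian_axioms_def)
  note sol = \<open>strong_solution M W (\<lambda>x. a - b * x) (\<lambda>x. \<sigma> * x powr \<beta>) r0 r\<close>[unfolded strong_solution_def]
  define H where "H t \<omega> = \<sigma> * r t \<omega> powr \<beta>" for t \<omega>
  define A where "A t \<omega> = (LINT s:{0..t}|lborel. a - b * r s \<omega>)" for t \<omega>
  define Q0 where "Q0 t \<omega> = (LINT s:{0..t}|lborel. (H s \<omega>)\<^sup>2)" for t \<omega>
  obtain X where ito: "ito_integral M F W H X" and eq: "AE \<omega> in M. \<forall>t\<ge>0. r t \<omega> = r0 + A t \<omega> + X t \<omega>"
    using sol unfolding A_def H_def[abs_def] by blast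
  have adapted: "adapted_process F r" and r_cont: "AE \<omega> in M. continuous_on {0..} (\<lambda>t. r t \<omega>)"
    using sol by blast+
  note pos = \<open>AE \<omega> in M. \<forall>t\<ge>0. r t \<omega> > 0\<close>
  have H_cont: "AE \<omega> in M. continuous_on {0..} (\<lambda>s. H s \<omega>)"
    using r_cont pos
  proof eventually_elim
    case (elim \<omega>)
    \<comment> \<open>Continuity of \<open>powr\<close> along the path uses that the base is
      nonzero, which positivity of \<open>r\<close> supplies.\<close>
    show ?case unfolding H_def
      by (intro continuous_intros elim(1)) (use elim(2) in fastforce)
  qed
  \<comment> \<open>The constant depends on the path and on \<open>t\<close>, but the null set does
    not. The same bound serves the dyadic sums and the drift condition in
    \<open>no_atom\<close>.\<close>
  have A_lip: "AE \<omega> in M. \<forall>t\<ge>0. \<exists>C. \<forall>u v. 0 \<le> u \<longrightarrow> u \<le> v \<longrightarrow> v \<le> t \<longrightarrow> \<bar>A v \<omega> - A u \<omega>\<bar> \<le> C * (v - u)"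
    using r_cont
  proof eventually_elim
    case (elim \<omega>)
    show ?case
    proof (intro allI impI)
      fix t :: real assume "0 \<le> t"
      have c: "continuous_on {0..v} (\<lambda>s. a - b * r s \<omega>)" for v
        by (intro continuous_intros continuous_on_subset[OF elim]) auto
      have "compact ((\<lambda>s. a - b * r s \<omega>) ` {0..t})" by (intro compact_continuous_image c) simp
      then obtain C where C: "\<forall>s\<in>{0..t}. \<bar>a - b * r s \<omega>\<bar> \<le> C"
        by (auto dest!: compact_imp_bounded simp: bounded_iff)
      have "\<bar>A v \<omega> - A u \<omega>\<bar> \<le> C * (v - u)" if "0 \<le> u" "u \<le> v" "v \<le> t" for u v
        unfolding A_def using that C by (intro set_integral_increment_bound c) auto
      then show "\<exists>C. \<forall>u v. 0 \<le> u \<longrightarrow> u \<le> v \<longrightarrow> v \<le> t \<longrightarrow> \<bar>A v \<omega> - A u \<omega>\<bar> \<le> C * (v - u)" by blast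
    qed
  qed
  have QV: "quadratic_variation M r Q0"
    unfolding quadratic_variation_def
  proof (intro conjI allI impI)
    show "Q0 t \<in> borel_measurable M" for t
      unfolding Q0_def[abs_def] by (rule square_integral_measurable[OF ito])
    show "AE \<omega> in M. continuous_on {0..} (\<lambda>t. Q0 t \<omega>)"
      using H_cont
    proof eventually_elim
      case (elim \<omega>)
      show ?case unfolding Q0_def by (intro set_integral_continuous continuous_intros elim)
    qed
    fix t :: real assume "0 \<le> t"
    show "AE \<omega> in M. (\<lambda>n. \<Sum>k=1..2^n. (r (real k * t / 2^n) \<omega> - r ((real k - 1) * t / 2^n) \<omega>)\<^sup>2) \<longlonglongrightarrow> Q0 t \<omega>"
      using ito_quadratic_variation[OF ito H_cont \<open>0 \<le> t\<close>] A_lip eq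
    proof eventually_elim
      case (elim \<omega>)
      from elim(2) \<open>0 \<le> t\<close> obtain C where C: "\<forall>u v. 0 \<le> u \<longrightarrow> u \<le> v \<longrightarrow> v \<le> t \<longrightarrow> \<bar>A v \<omega> - A u \<omega>\<bar> \<le> C * (v - u)" by blast
      have "(\<lambda>n. \<Sum>k<2^n. (A (real (Suc k) * t / 2 ^ n) \<omega> - A (real k * t / 2 ^ n) \<omega>)\<^sup>2) \<longlonglongrightarrow> 0"
        using C \<open>0 \<le> t\<close> by (intro dyadic_square_sum_lipschitz[where C=C]) auto
      from sum_square_perturbation[OF elim(1) this]
      have lim: "(\<lambda>n. \<Sum>k<2^n. (X (real (Suc k) * t / 2 ^ n) \<omega> - X (real k * t / 2 ^ n) \<omega> +
          (A (real (Suc k) * t / 2 ^ n) \<omega> - A (real k * t / 2 ^ n) \<omega>))\<^sup>2) \<longlonglongrightarrow> Q0 t \<omega>"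
        unfolding Q0_def .
      have "(\<Sum>k=1..2^n. (r (real k * t / 2^n) \<omega> - r ((real k - 1) * t / 2^n) \<omega>)\<^sup>2)
        = (\<Sum>k<2^n. (X (real (Suc k) * t / 2 ^ n) \<omega> - X (real k * t / 2 ^ n) \<omega> +
          (A (real (Suc k) * t / 2 ^ n) \<omega> - A (real k * t / 2 ^ n) \<omega>))\<^sup>2)" for n :: nat
      proof -
        have r_eq: "r (real k * t / 2 ^ n) \<omega> = r0 + A (real k * t / 2 ^ n) \<omega> + X (real k * t / 2 ^ n) \<omega>" for k
          using elim(3) \<open>0 \<le> t\<close> by simp
        have "(\<Sum>k=1..2^n. (r (real k * t / 2^n) \<omega> - r ((real k - 1) * t / 2^n) \<omega>)\<^sup>2)
          = (\<Sum>k<2^n. (r (real (Suc k) * t / 2^n) \<omega> - r (real k * t / 2^n) \<omega>)\<^sup>2)"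
          by (simp add: sum.atLeast1_atMost_eq)
        then show ?thesis
          unfolding r_eq by (simp add: algebra_simps)
      qed
      with lim show ?case by simp
    qed
  qed
  have not_1: "AE \<omega> in M. r t \<omega> \<noteq> 1" if "0 \<le> t" and t0: "t = 0 \<longrightarrow> r0 \<noteq> 1" for t
  proof (cases "t = 0")
    case True
    have A0: "A 0 \<omega> = 0" for \<omega>
      unfolding A_def using step_function_integral[of 0 "\<lambda>_. 0" "\<lambda>s. a - b * r s \<omega>"] by simp
    \<comment> \<open>At time 0 both integrals vanish, so \<open>r 0\<close> is almost surely the
      initial value \<open>r0\<close>.\<close>
    show ?thesis
      using eq ito_integral_0[OF ito] by eventually_elim (use True t0 A0 in auto)
  next
    case False
    with that have "0 < t" by simp
    show ?thesis
    \<comment> \<open>At \<open>r t \<omega> = 1\<close> the coefficient \<open>H t \<omega>\<close>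
      equals \<open>\<sigma>\<close>, which lies strictly above the threshold
      \<open>\<sigma> / 2\<close>.\<close>
    proof (rule no_atom[OF ito adapted H_cont, where c="\<sigma> / 2"])
      show "AE \<omega> in M. \<exists>C. \<forall>s\<in>{0..t}. \<bar>(r t \<omega> - X t \<omega>) - (r s \<omega> - X s \<omega>)\<bar> \<le> C * (t - s)"
        using A_lip eq
      proof eventually_elim
        case (elim \<omega>)
        from elim(1) \<open>0 < t\<close> obtain C where C: "\<forall>u v. 0 \<le> u \<longrightarrow> u \<le> v \<longrightarrow> v \<le> t \<longrightarrow> \<bar>A v \<omega> - A u \<omega>\<bar> \<le> C * (v - u)"
          by (meson less_imp_le)
        have "\<bar>(r t \<omega> - X t \<omega>) - (r s \<omega> - X s \<omega>)\<bar> \<le> C * (t - s)" if "s \<in> {0..t}" for s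
        proof -
          have "(r t \<omega> - X t \<omega>) - (r s \<omega> - X s \<omega>) = A t \<omega> - A s \<omega>" using elim(2) that by simp
          then show ?thesis using C that by simp
        qed
        then show ?case by blast
      qed
      show "AE \<omega> in M. r t \<omega> = 1 \<longrightarrow> \<sigma> / 2 < H t \<omega>" using \<open>\<sigma> > 0\<close> by (simp add: H_def)
    qed (use \<open>0 < t\<close> \<open>\<sigma> > 0\<close> in auto)
  qed
  show ?thesis
  proof (intro conjI exI[of _ Q0] QV allI impI ballI)
    fix Q t assume Q: "quadratic_variation M r Q" and t: "t \<in> {0..T}" and t0: "t = 0 \<longrightarrow> r0 \<noteq> 1"
    from t have "0 \<le> t" by simp
    show "AE \<omega> in M. ((\<lambda>h. ln ((Q (t + h) \<omega> - Q t \<omega>) / (\<sigma>\<^sup>2 * h)) / (2 * ln (r t \<omega>))) \<longlongrightarrow> \<beta>) (at 0 within {-t..})"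
      using quadratic_variation_indistinguishable[OF Q QV] H_cont pos not_1[OF \<open>0 \<le> t\<close> t0]
    proof eventually_elim
      case (elim \<omega>)
      have rt: "0 < r t \<omega>" "r t \<omega> \<noteq> 1" using elim \<open>0 \<le> t\<close> by auto
      have "((\<lambda>t. Q0 t \<omega>) has_real_derivative (H t \<omega>)\<^sup>2) (at t within {0..})"
        unfolding Q0_def by (rule set_integral_has_derivative[OF _ \<open>0 \<le> t\<close>]) (intro continuous_intros elim)
      from difference_quotient_tendsto[OF this]
      \<comment> \<open>The derivative is positive because \<open>r t \<omega>\<close> is, so the
        logarithm passes to the limit; division by \<open>2 * ln (r t \<omega>)\<close> is
        legitimate because \<open>r t \<omega> \<noteq> 1\<close>.\<close>
      have "((\<lambda>h. ln ((Q0 (t + h) \<omega> - Q0 t \<omega>) / h / \<sigma>\<^sup>2) / (2 * ln (r t \<omega>)))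
          \<longlongrightarrow> ln ((H t \<omega>)\<^sup>2 / \<sigma>\<^sup>2) / (2 * ln (r t \<omega>))) (at 0 within {-t..})"
        using rt \<open>\<sigma> > 0\<close> by (intro tendsto_intros) (auto simp: H_def)
      also have "(H t \<omega>)\<^sup>2 / \<sigma>\<^sup>2 = r t \<omega> powr (2 * \<beta>)"
        using \<open>\<sigma> > 0\<close> by (simp add: H_def power_mult_distrib power2_eq_square powr_add[symmetric])
      also have "ln (r t \<omega> powr (2 * \<beta>)) / (2 * ln (r t \<omega>)) = \<beta>"
        using rt by (simp add: ln_powr)
      finally show ?case
      \<comment> \<open>One null set serves all \<open>h\<close>: on \<open>{-t..}\<close> the time
        \<open>t + h\<close> is nonnegative, so \<open>Q\<close> and \<open>Q0\<close> agree at both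
        times in the quotient.\<close>
      proof (rule Lim_transform_eventually)
        show "\<forall>\<^sub>F h in at 0 within {-t..}. ln ((Q0 (t + h) \<omega> - Q0 t \<omega>) / h / \<sigma>\<^sup>2) / (2 * ln (r t \<omega>))
            = ln ((Q (t + h) \<omega> - Q t \<omega>) / (\<sigma>\<^sup>2 * h)) / (2 * ln (r t \<omega>))"
          unfolding eventually_at_filter using elim(1) \<open>0 \<le> t\<close>
          by (intro always_eventually) (auto simp: mult.commute)
      qed
    qed
  qed
qed

end
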